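(* Let $\nu>0$, $T>0$, and let $u_0\in L^2(\Omega)$ be the initial datum and $f(\cdot,t)\in L^2(\Omega)$, $t\in[0,T]$, the source term. If $f(\cdot,t)$ is continuous with respect to $t$, then the semi-discrete HDG problem: find $(\boldsymbol q_h(t),u_h(t),\widehat u_h(t))\in \boldsymbol Q_h\times V_h\times\widehat V_h$ such that $$\boldsymbol q_h+\mathcal K_h(u_h,\widehat u_h)=0,$$ $$(u_{h,t},w)_{\mathcal T_h}+\nu(\mathcal K_h(u_h,\widehat u_h),\mathcal K_h(w,\mu))_{\mathcal T_h}+\mathcal S_h(u_h,\widehat u_h;w,\mu)+\mathcal B_h(u_h;u_h,\widehat u_h;w,\mu)=(f,w)_{\mathcal T_h}\quad\forall (w,\mu)\in V_h\times\widehat V_h,$$ $$u_h(0)=\Pi_k^o u_0,$$ admits a unique solution $(\boldsymbol q_h(t),u_h(t),\widehat u_h(t))$ for any $t\in[0,T]$.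
   Context: $\Omega\subset\mathbb R^d$ ($d=2,3$) is a polyhedral domain. $\mathcal T_h=\{K\}$ is a partition of $\Omega$ into open polygons/polyhedra; $h_K$ is the infimum of the diameters of circles (spheres) containing $K$, $h=\max_K h_K$. The partition is shape-regular: there are constants $\theta_*,l_*>0$ such that each $K$ is star-shaped with respect to every point of some circle (sphere) centered at a point of $K$ with radius $\theta_*h_K$, and the distance between any two vertices of $K$ is at least $l_*h_K$. $\varepsilon_h$ is the set of all edges/faces and $\varepsilon_h^\partial$ the set of those on $\partial\Omega$; $\boldsymbol n$ is the unit outward normal to $\partial K$. Inner products: $(u,v)_{\mathcal T_h}=\sum_K\int_K uv$, $\langle u,v\rangle_{\partial\mathcal T_h}=\sum_K\int_{\partial K}uv$ (componentwise for vectors). For integers $k\ge1$, $l\in\{k-1,k\}$: $\boldsymbol Q_h=\{\boldsymbol v\in[L^2(\Omega)]^d:\boldsymbol v|_K\in[P_{k-1}(K)]^d\ \forall K\}$, $V_h=\{v\in L^2(\Omega):v|_K\in P_k(K)\ \forall K\}$, $\widehat V_h=\{\widehat v\in L^2(\varepsilon_h):\widehat v|_E\in P_l(E)\ \forall E\in\varepsilon_h,\ \widehat v|_{\varepsilon_h^\partial}=0\}$, where $P_m(D)$ denotes polynomials of degree at most $m$ on $D$. $\Pi_k^o$ is the elementwise $L^2$ projection onto $V_h$; $\Pi_l^\partial$ is the facewise $L^2$ projection onto polynomials of degree $\le l$ (applied on each $\partial K$ to traces from $K$). $\mathcal K_h:V_h\times\widehat V_h\to\boldsymbol Q_h$ is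 defined by $(\mathcal K_h(w,\mu),\boldsymbol r)_{\mathcal T_h}=-(w,\nabla_h\cdot\boldsymbol r)_{\mathcal T_h}+\langle\mu,\boldsymbol r\cdot\boldsymbol n\rangle_{\partial\mathcal T_h}$ for all $\boldsymbol r\in\boldsymbol Q_h$ ($\nabla_h\cdot$ the elementwise divergence). $\mathcal S_h(u_h,\widehat u_h;w,\mu)=\nu\langle\tau(\Pi_l^\partial u_h-\widehat u_h),\Pi_l^\partial w-\mu\rangle_{\partial\mathcal T_h}$ with $\tau|_{\partial K}=h_K^{-1}$. $\boldsymbol b(v)=[v,\dots,v]^T\in\mathbb R^d$, and $\mathcal B_h(v_h;u_h,\widehat u_h;w,\mu)=-\frac13(\boldsymbol b(v_h)u_h,\nabla w)_{\mathcal T_h}+\frac13(\boldsymbol b(v_h)\cdot\nabla u_h,w)_{\mathcal T_h}-\frac13\langle\boldsymbol b(v_h)\cdot\boldsymbol n\,u_h,\mu\rangle_{\partial\mathcal T_h}+\frac13\langle\boldsymbol b(v_h)\cdot\boldsymbol n\,\widehat u_h,w\rangle_{\partial\mathcal T_h}$ (gradients elementwise). *)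

theory Defs
  imports "HOL-Analysis.Analysis"
begin

section \<open>Polytopal meshes\<close>

text \<open>
  Open polygons, polyhedra and flat faces, not necessarily convex: \<open>S\<close> is connected, its closure is
  a finite union of polytopes, and \<open>S\<close> is the interior of its closure relative to its affine hull,
  so slits are excluded.  For \<open>n = CARD('d)\<close> the relative interior is the interior and \<open>S\<close> is a
  polyhedral domain; for \<open>n = CARD('d) - 1\<close> it is a relatively open piece of a hyperplane.
\<close>
definition open_polytopal :: "nat \<Rightarrow> (real^'d) set \<Rightarrow> bool" where
  "open_polytopal n S \<longleftrightarrow>
     S \<noteq> {} \<and> connected S \<and> aff_dim S = int n \<and>
     (\<exists>\<P>. finite \<P> \<and> (\<forall>P\<in>\<P>. polytope P) \<and> closure S = \<Union>\<P>) \<and>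
     rel_interior (closure S) = S"

definition cell_faces :: "(real^'d) set set \<Rightarrow> (real^'d) set \<Rightarrow> (real^'d) set set" where
  "cell_faces \<E> K = {F \<in> \<E>. F \<subseteq> frontier K}"

text \<open>
  The cells \<open>\<T>\<close> partition \<open>\<Omega>\<close> up to the null set of cell boundaries.  The skeleton \<open>\<E>\<close> consists of
  pairwise disjoint relatively open faces, each lying between two cells or on the boundary of \<open>\<Omega>\<close>.
  It is part of the mesh because hanging nodes may split a flat side of a cell into several faces.
\<close>
definition polytopal_mesh ::
    "(real^'d) set \<Rightarrow> (real^'d) set set \<Rightarrow> (real^'d) set set \<Rightarrow> bool" where
  "polytopal_mesh \<Omega> \<T> \<E> \<longleftrightarrow>
     finite \<T> \<and> (\<forall>K\<in>\<T>. open_polytopal CARD('d) K) \<and> pairwise disjnt \<T> \<and>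
     closure \<Omega> = (\<Union>K\<in>\<T>. closure K) \<and>
     finite \<E> \<and> (\<forall>F\<in>\<E>. open_polytopal (CARD('d) - 1) F) \<and> pairwise disjnt \<E> \<and>
     (\<forall>F\<in>\<E>. (\<exists>K\<in>\<T>. \<exists>K'\<in>\<T>. K \<noteq> K' \<and> F \<subseteq> frontier K \<inter> frontier K') \<or>
             (\<exists>K\<in>\<T>. F \<subseteq> frontier K \<inter> frontier \<Omega>)) \<and>
     (\<forall>K\<in>\<T>. frontier K = (\<Union>F\<in>cell_faces \<E> K. closure F))"

definition cell_size :: "(real^'d) set \<Rightarrow> real" where
  "cell_size K = Inf {2 * r |r. \<exists>x. K \<subseteq> cball x r}"

text \<open>
  A boundary point is a vertex iff there is no direction along which all faces of the cell are
  locally invariant: in the relative interior of a face, or of an edge in 3D, such a direction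
  exists, whereas at a corner or at a hanging node where faces of the cell end there is none.
\<close>
definition cell_vertices :: "(real^'d) set set \<Rightarrow> (real^'d) set \<Rightarrow> (real^'d) set" where
  "cell_vertices \<E> K = {x \<in> frontier K.
     \<not> (\<exists>v e. v \<noteq> 0 \<and> 0 < e \<and>
          (\<forall>F\<in>cell_faces \<E> K. \<forall>y\<in>ball x e. \<forall>s::real.
             y + s *\<^sub>R v \<in> ball x e \<longrightarrow> (y \<in> F \<longleftrightarrow> y + s *\<^sub>R v \<in> F)))}"

definition shape_regular ::
    "real \<Rightarrow> real \<Rightarrow> (real^'d) set set \<Rightarrow> (real^'d) set set \<Rightarrow> bool" where
  "shape_regular \<theta> \<rho> \<T> \<E> \<longleftrightarrow> 0 < \<theta> \<and> 0 < \<rho> \<and>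
     (\<forall>K\<in>\<T>.
        (\<exists>c\<in>K. \<forall>y\<in>cball c (\<theta> * cell_size K). \<forall>z\<in>K. closed_segment y z \<subseteq> K) \<and>
        (\<forall>a\<in>cell_vertices \<E> K. \<forall>b\<in>cell_vertices \<E> K. a \<noteq> b \<longrightarrow> \<rho> * cell_size K \<le> dist a b))"

text \<open>Near a point in the relative interior of a face, the cell is a half-ball.\<close>
definition outward_normal :: "(real^'d) set \<Rightarrow> real^'d \<Rightarrow> real^'d" where
  "outward_normal K x =
     (THE n. norm n = 1 \<and> (\<exists>e>0. \<forall>y\<in>ball x e. y \<in> K \<longleftrightarrow> (y - x) \<bullet> n < 0))"


section \<open>Integration and traces\<close>

text \<open>
  The \<open>(d-1)\<close>-dimensional measure on the hyperplane spanned by \<open>F\<close>: push-forward, under the orthogonal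
  projection, of \<open>d\<close>-dimensional Lebesgue measure on the slab of width 1 around the hyperplane.
\<close>
definition surface_measure :: "(real^'d) set \<Rightarrow> (real^'d) measure" where
  "surface_measure F =
     distr (restrict_space lborel {x. infdist x (affine hull F) \<le> 1/2}) borel
       (closest_point (affine hull F))"

definition L2_on :: "'a measure \<Rightarrow> 'a set \<Rightarrow> ('a \<Rightarrow> 'b::euclidean_space) \<Rightarrow> bool" where
  "L2_on M D v \<longleftrightarrow> set_borel_measurable M D v \<and> set_integrable M D (\<lambda>x. (norm (v x))\<^sup>2)"

definition L2_dist :: "'a measure \<Rightarrow> 'a set \<Rightarrow> ('a \<Rightarrow> real) \<Rightarrow> ('a \<Rightarrow> real) \<Rightarrow> real" where
  "L2_dist M D v w = sqrt (LINT x:D|M. (v x - w x)\<^sup>2)"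

definition cell_prod ::
    "(real^'d) set set \<Rightarrow> (real^'d \<Rightarrow> 'b::euclidean_space) \<Rightarrow> (real^'d \<Rightarrow> 'b) \<Rightarrow> real" where
  "cell_prod \<T> u v = (\<Sum>K\<in>\<T>. LINT x:K|lebesgue. u x \<bullet> v x)"

text \<open>
  Functions on the union of all cell boundaries may differ on the two sides of a face, hence carry
  the cell as an additional argument.  The faces of \<open>K\<close> cover its boundary up to a null set.
\<close>
definition bdry_prod ::
    "(real^'d) set set \<Rightarrow> (real^'d) set set \<Rightarrow>
     ((real^'d) set \<Rightarrow> real^'d \<Rightarrow> real) \<Rightarrow> ((real^'d) set \<Rightarrow> real^'d \<Rightarrow> real) \<Rightarrow> real" where
  "bdry_prod \<T> \<E> u v =
     (\<Sum>K\<in>\<T>. \<Sum>F\<in>cell_faces \<E> K. LINT x:F|surface_measure F. u K x * v K x)"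

definition trace_from :: "(real^'d) set \<Rightarrow> (real^'d \<Rightarrow> 'b::euclidean_space) \<Rightarrow> real^'d \<Rightarrow> 'b" where
  "trace_from K v x = Lim (at x within K) v"

definition grad :: "(real^'d \<Rightarrow> real) \<Rightarrow> real^'d \<Rightarrow> real^'d" where
  "grad v x = (\<chi> i. frechet_derivative v (at x) (axis i 1))"

definition divergence :: "(real^'d \<Rightarrow> real^'d) \<Rightarrow> real^'d \<Rightarrow> real" where
  "divergence r x = (\<Sum>i\<in>UNIV. frechet_derivative (\<lambda>y. r y $ i) (at x) (axis i 1))"


section \<open>Discrete spaces and projections\<close>

definition polynomial_deg_le :: "nat \<Rightarrow> (real^'d \<Rightarrow> real) \<Rightarrow> bool" where
  "polynomial_deg_le m p \<longleftrightarrow>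
     (\<exists>c. \<forall>x. p x = (\<Sum>\<alpha> | (\<Sum>i\<in>UNIV. \<alpha> i) \<le> m. c \<alpha> * (\<Prod>i\<in>UNIV. (x $ i) ^ \<alpha> i)))"

definition restrict0 :: "'a set \<Rightarrow> ('a \<Rightarrow> real) \<Rightarrow> 'a \<Rightarrow> real" where
  "restrict0 D v = (\<lambda>x. if x \<in> D then v x else 0)"

definition polys_on :: "nat \<Rightarrow> (real^'d) set \<Rightarrow> (real^'d \<Rightarrow> real) set" where
  "polys_on m D = {restrict0 D p |p. polynomial_deg_le m p}"

text \<open>
  Elements of the three discrete spaces are \<open>L\<^sup>2\<close> classes.  Each class is represented by the unique
  function that is a polynomial on every (open) cell or face and vanishes elsewhere, so that
  equality of functions is equality of classes.
\<close>
definition flux_space ::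
    "(real^'d) set \<Rightarrow> (real^'d) set set \<Rightarrow> nat \<Rightarrow> (real^'d \<Rightarrow> real^'d) set" where
  "flux_space \<Omega> \<T> k = {r. L2_on lebesgue \<Omega> r \<and>
     (\<forall>K\<in>\<T>. \<forall>i. restrict0 K (\<lambda>x. r x $ i) \<in> polys_on (k - 1) K) \<and>
     (\<forall>x. x \<notin> \<Union>\<T> \<longrightarrow> r x = 0)}"

definition scalar_space ::
    "(real^'d) set \<Rightarrow> (real^'d) set set \<Rightarrow> nat \<Rightarrow> (real^'d \<Rightarrow> real) set" where
  "scalar_space \<Omega> \<T> k = {v. L2_on lebesgue \<Omega> v \<and>
     (\<forall>K\<in>\<T>. restrict0 K v \<in> polys_on k K) \<and>
     (\<forall>x. x \<notin> \<Union>\<T> \<longrightarrow> v x = 0)}"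

definition trace_space ::
    "(real^'d) set \<Rightarrow> (real^'d) set set \<Rightarrow> nat \<Rightarrow> (real^'d \<Rightarrow> real) set" where
  "trace_space \<Omega> \<E> l = {\<mu>.
     (\<forall>F\<in>\<E>. L2_on (surface_measure F) F \<mu> \<and> restrict0 F \<mu> \<in> polys_on l F) \<and>
     (\<forall>F\<in>\<E>. F \<subseteq> frontier \<Omega> \<longrightarrow> (\<forall>x\<in>F. \<mu> x = 0)) \<and>
     (\<forall>x. x \<notin> \<Union>\<E> \<longrightarrow> \<mu> x = 0)}"

definition L2_proj ::
    "(real^'d) measure \<Rightarrow> nat \<Rightarrow> (real^'d) set \<Rightarrow> (real^'d \<Rightarrow> real) \<Rightarrow> real^'d \<Rightarrow> real" where
  "L2_proj M m D g =
     (THE p. p \<in> polys_on m D \<and> (\<forall>q\<in>polys_on m D. (LINT x:D|M. (g x - p x) * q x) = 0))"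

text \<open>At most one summand is nonzero, since the cells (faces) are disjoint and local projections vanish
  outside of their cell (face).\<close>
definition cell_proj :: "(real^'d) set set \<Rightarrow> nat \<Rightarrow> (real^'d \<Rightarrow> real) \<Rightarrow> real^'d \<Rightarrow> real" where
  "cell_proj \<T> k g x = (\<Sum>K\<in>\<T>. L2_proj lebesgue k K g x)"

definition face_proj ::
    "(real^'d) set set \<Rightarrow> nat \<Rightarrow> (real^'d) set \<Rightarrow> (real^'d \<Rightarrow> real) \<Rightarrow> real^'d \<Rightarrow> real" where
  "face_proj \<E> l K v x =
     (\<Sum>F\<in>cell_faces \<E> K. L2_proj (surface_measure F) l F (trace_from K v) x)"


section \<open>The semi-discrete HDG scheme\<close>

definition hdg_K ::
    "(real^'d) set \<Rightarrow> (real^'d) set set \<Rightarrow> (real^'d) set set \<Rightarrow> nat \<Rightarrow>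
     (real^'d \<Rightarrow> real) \<Rightarrow> (real^'d \<Rightarrow> real) \<Rightarrow> real^'d \<Rightarrow> real^'d" where
  "hdg_K \<Omega> \<T> \<E> k w \<mu> =
     (THE q. q \<in> flux_space \<Omega> \<T> k \<and>
        (\<forall>r\<in>flux_space \<Omega> \<T> k.
           cell_prod \<T> q r =
             - cell_prod \<T> w (divergence r)
             + bdry_prod \<T> \<E> (\<lambda>K. \<mu>) (\<lambda>K x. trace_from K r x \<bullet> outward_normal K x)))"

definition hdg_S ::
    "(real^'d) set set \<Rightarrow> (real^'d) set set \<Rightarrow> nat \<Rightarrow> real \<Rightarrow>
     (real^'d \<Rightarrow> real) \<Rightarrow> (real^'d \<Rightarrow> real) \<Rightarrow> (real^'d \<Rightarrow> real) \<Rightarrow> (real^'d \<Rightarrow> real) \<Rightarrow> real" where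
  "hdg_S \<T> \<E> l \<nu> u uhat w \<mu> =
     \<nu> * bdry_prod \<T> \<E>
       (\<lambda>K x. inverse (cell_size K) * (face_proj \<E> l K u x - uhat x))
       (\<lambda>K x. face_proj \<E> l K w x - \<mu> x)"

text \<open>The vector \<open>\<^bold>b(v) = (v, \<dots>, v)\<close> is the library's \<open>vec v\<close>.\<close>
definition hdg_B ::
    "(real^'d) set set \<Rightarrow> (real^'d) set set \<Rightarrow> (real^'d \<Rightarrow> real) \<Rightarrow>
     (real^'d \<Rightarrow> real) \<Rightarrow> (real^'d \<Rightarrow> real) \<Rightarrow> (real^'d \<Rightarrow> real) \<Rightarrow> (real^'d \<Rightarrow> real) \<Rightarrow> real" where
  "hdg_B \<T> \<E> v u uhat w \<mu> =
     - (1/3) * cell_prod \<T> (\<lambda>x. u x *\<^sub>R vec (v x)) (grad w)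
     + (1/3) * cell_prod \<T> (\<lambda>x. vec (v x) \<bullet> grad u x) w
     - (1/3) * bdry_prod \<T> \<E>
         (\<lambda>K x. (vec (trace_from K v x) \<bullet> outward_normal K x) * trace_from K u x) (\<lambda>K. \<mu>)
     + (1/3) * bdry_prod \<T> \<E>
         (\<lambda>K x. (vec (trace_from K v x) \<bullet> outward_normal K x) * uhat x) (\<lambda>K. trace_from K w)"

text \<open>
  The time derivative is taken pointwise in space; on the finite-dimensional space
  \<open>scalar_space \<Omega> \<T> k\<close> this agrees with the derivative in the \<open>L\<^sup>2\<close> norm.  It is
  one-sided at the two ends of the time interval.
\<close>
definition hdg_solution ::
    "(real^'d) set \<Rightarrow> (real^'d) set set \<Rightarrow> (real^'d) set set \<Rightarrow> nat \<Rightarrow> nat \<Rightarrow> real \<Rightarrow> real \<Rightarrow>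
     (real \<Rightarrow> real^'d \<Rightarrow> real) \<Rightarrow> (real^'d \<Rightarrow> real) \<Rightarrow>
     (real \<Rightarrow> real^'d \<Rightarrow> real^'d) \<Rightarrow> (real \<Rightarrow> real^'d \<Rightarrow> real) \<Rightarrow> (real \<Rightarrow> real^'d \<Rightarrow> real) \<Rightarrow> bool" where
  "hdg_solution \<Omega> \<T> \<E> k l \<nu> T f u0 q u uhat \<longleftrightarrow>
     (\<forall>t\<in>{0..T}.
        q t \<in> flux_space \<Omega> \<T> k \<and> u t \<in> scalar_space \<Omega> \<T> k \<and> uhat t \<in> trace_space \<Omega> \<E> l \<and>
        (\<forall>x. (\<lambda>s. u s x) differentiable (at t within {0..T})) \<and>
        (\<forall>x. q t x + hdg_K \<Omega> \<T> \<E> k (u t) (uhat t) x = 0) \<and>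
        (\<forall>w\<in>scalar_space \<Omega> \<T> k. \<forall>\<mu>\<in>trace_space \<Omega> \<E> l.
           cell_prod \<T> (\<lambda>x. vector_derivative (\<lambda>s. u s x) (at t within {0..T})) w
           + \<nu> * cell_prod \<T> (hdg_K \<Omega> \<T> \<E> k (u t) (uhat t)) (hdg_K \<Omega> \<T> \<E> k w \<mu>)
           + hdg_S \<T> \<E> l \<nu> (u t) (uhat t) w \<mu>
           + hdg_B \<T> \<E> (u t) (u t) (uhat t) w \<mu>
           = cell_prod \<T> (f t) w)) \<and>
     u 0 = cell_proj \<T> k u0"

end

theory Submission
  imports Defs "HOL-Library.Function_Algebras"
begin

text \<open>
  The scheme is a differential-algebraic system on finite-dimensional spaces, and the theorem is
  global existence and uniqueness for it.  The flux \<open>q\<close> is explicit: \<open>hdg_K\<close> is the Riesz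
  representer of a functional that is linear in \<open>(u, uhat)\<close>.  The equation tested with \<open>(0, \<mu>)\<close>
  contains no time derivative.  It is linear in \<open>uhat\<close>, since the convection form does not couple
  \<open>uhat\<close> to \<open>\<mu>\<close>, and it is coercive in \<open>uhat\<close>, since the stabilization \<open>hdg_S\<close> contributes
  \<open>\<nu> / h\<^sub>K\<close> times the square of \<open>uhat\<close> on every face.  Hence \<open>uhat\<close> is a function of \<open>u\<close>, and what
  is left is an ordinary differential equation for \<open>u\<close>.

  In coordinates with respect to an orthonormal basis the right-hand side of this equation is a
  polynomial of the unknowns plus the source, which is continuous in time.  It is therefore locally
  Lipschitz, and Gronwall's inequality gives uniqueness.  Existence on all of \<open>[0, T]\<close> uses the
  energy: testing with the solution itself, the convection form vanishes by antisymmetry and the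
  diffusion form is nonnegative, so the \<open>L\<^sup>2\<close> norm of \<open>u\<close> is bounded in terms of the data.  The
  nonlinearity may then be cut off beyond that bound; the cut-off equation is globally Lipschitz and
  is solved by Picard iteration, and its solution never enters the region where the cut-off acts
  (\<open>dissipative_ode_exists\<close>).  The elimination of \<open>uhat\<close> and the transfer between coordinates and
  abstract spaces are carried out for a general problem in the locale \<open>evolution_problem\<close>.

  It remains to see that the forms of the scheme are bilinear and definite as stated with Lebesgue
  integrals, which requires every integrand to be bounded and measurable.  The only delicate
  integrand is the outward normal, which a mesh may leave unspecified at some points of a face: it is
  locally constant on a relatively open part of the face and constant on the rest
  (\<open>bounded_borel_outward_normal\<close>).  Definiteness holds since polynomials are continuous and
  nonempty relatively open subsets of cells and faces have positive measure (\<open>patch\<close>).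

  The time derivative in the scheme is taken at each point of space.  It agrees with the derivative
  in the discrete space because a finite-dimensional space of functions has a basis dual to finitely
  many point evaluations (\<open>nodal_basis\<close>).
\<close>

section \<open>Linear algebra in spaces of functions\<close>

instantiation "fun" :: (type, real_vector) real_vector
begin

definition "c *\<^sub>R f = (\<lambda>x. c *\<^sub>R f x)"

instance
  by standard (simp_all add: fun_eq_iff scaleR_fun_def algebra_simps)

end

lemma scaleR_fun_apply [simp]: "(c *\<^sub>R f) x = c *\<^sub>R f x"
  by (simp add: scaleR_fun_def)

lemma sum_fun_apply: "(\<Sum>i\<in>I. f i) x = (\<Sum>i\<in>I. f i x)"
  by (induction I rule: infinite_finite_induct) auto

definition linear_on :: "'v::real_vector set \<Rightarrow> ('v \<Rightarrow> 'w::real_vector) \<Rightarrow> bool" where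
  "linear_on V f \<longleftrightarrow>
     (\<forall>u\<in>V. \<forall>v\<in>V. f (u + v) = f u + f v) \<and> (\<forall>c. \<forall>v\<in>V. f (c *\<^sub>R v) = c *\<^sub>R f v)"

definition bilinear_on ::
    "'v::real_vector set \<Rightarrow> 'w::real_vector set \<Rightarrow> ('v \<Rightarrow> 'w \<Rightarrow> real) \<Rightarrow> bool" where
  "bilinear_on V W f \<longleftrightarrow> (\<forall>v\<in>V. linear_on W (f v)) \<and> (\<forall>w\<in>W. linear_on V (\<lambda>v. f v w))"

definition inner_product_on :: "'v::real_vector set \<Rightarrow> ('v \<Rightarrow> 'v \<Rightarrow> real) \<Rightarrow> bool" where
  "inner_product_on V m \<longleftrightarrow>
     bilinear_on V V m \<and> (\<forall>u\<in>V. \<forall>v\<in>V. m u v = m v u) \<and> (\<forall>v\<in>V. v \<noteq> 0 \<longrightarrow> 0 < m v v)"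

definition findim :: "'v::real_vector set \<Rightarrow> bool" where
  "findim V \<longleftrightarrow> subspace V \<and> (\<exists>B. finite B \<and> V \<subseteq> span B)"

lemma linear_onI:
  assumes "\<And>u v. u \<in> V \<Longrightarrow> v \<in> V \<Longrightarrow> f (u + v) = f u + f v"
    and "\<And>c v. v \<in> V \<Longrightarrow> f (c *\<^sub>R v) = c *\<^sub>R f v"
  shows "linear_on V f"
  using assms by (simp add: linear_on_def)

lemma linear_onD:
  assumes "linear_on V f"
  shows "u \<in> V \<Longrightarrow> v \<in> V \<Longrightarrow> f (u + v) = f u + f v"
    and "v \<in> V \<Longrightarrow> f (c *\<^sub>R v) = c *\<^sub>R f v"
  using assms by (simp_all add: linear_on_def)

lemma linear_on_zero: "linear_on V f \<Longrightarrow> 0 \<in> V \<Longrightarrow> f 0 = 0"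
  using linear_onD(2)[of V f 0 0] by simp

lemma linear_on_diff:
  assumes "linear_on V f" "subspace V" "u \<in> V" "v \<in> V"
  shows "f (u - v) = f u - f v"
  using linear_onD(1)[OF assms(1), of u "(-1) *\<^sub>R v"] linear_onD(2)[OF assms(1), of v "-1"] assms
  by (simp add: subspace_scale subspace_neg)

lemma linear_on_sum:
  assumes "linear_on V f" "subspace V" "\<And>i. i \<in> I \<Longrightarrow> s i \<in> V"
  shows "f (\<Sum>i\<in>I. c i *\<^sub>R s i) = (\<Sum>i\<in>I. c i *\<^sub>R f (s i))"
  using assms(3)
proof (induction I rule: infinite_finite_induct)
  case (insert x F)
  then show ?case
    by (simp add: linear_onD[OF assms(1)] subspace_scale[OF assms(2)] subspace_sum[OF assms(2)])
qed (simp_all add: linear_on_zero[OF assms(1) subspace_0[OF assms(2)]])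

lemma linear_on_combine:
  assumes "linear_on V f" "linear_on V g"
  shows "linear_on V (\<lambda>v. a *\<^sub>R f v + b *\<^sub>R g v)"
  using assms by (simp add: linear_on_def algebra_simps)

lemma bilinear_onI:
  assumes "\<And>v. v \<in> V \<Longrightarrow> linear_on W (f v)" "\<And>w. w \<in> W \<Longrightarrow> linear_on V (\<lambda>v. f v w)"
  shows "bilinear_on V W f"
  using assms by (simp add: bilinear_on_def)

lemma bilinear_onD:
  assumes "bilinear_on V W f"
  shows "v \<in> V \<Longrightarrow> linear_on W (f v)" and "w \<in> W \<Longrightarrow> linear_on V (\<lambda>v. f v w)"
  using assms by (simp_all add: bilinear_on_def)

lemma findim_span:
  assumes "findim V"
  obtains B where "finite B" "B \<subseteq> V" "span B = V"
proof -
  from assms obtain C where "subspace V" "finite C" "V \<subseteq> span C"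
    by (auto simp: findim_def)
  obtain B where B: "B \<subseteq> V" "independent B" "V \<subseteq> span B"
    by (rule basis_exists)
  have "finite B"
    using independent_span_bound[OF \<open>finite C\<close> B(2)] B(1) \<open>V \<subseteq> span C\<close> by blast
  moreover have "span B = V"
    using B \<open>subspace V\<close> by (meson span_minimal subset_antisym)
  ultimately show thesis
    using that B by blast
qed

text \<open>
  Gram-Schmidt, by induction on a finite spanning set.  The basis is indexed by natural numbers
  because the differential equations below are systems with unknowns \<open>0, ..., n - 1\<close>.
\<close>
lemma orthonormal_basis:
  assumes "findim V" and m: "inner_product_on V m"
  obtains n :: nat and e where "\<And>i. i < n \<Longrightarrow> e i \<in> V"
    and "\<And>i j. i < n \<Longrightarrow> j < n \<Longrightarrow> m (e i) (e j) = (if i = j then 1 else 0)"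
    and "\<And>v. v \<in> V \<Longrightarrow> v = (\<Sum>i<n. m v (e i) *\<^sub>R e i)"
proof -
  have sV: "subspace V" and bil: "bilinear_on V V m"
    and sym: "\<And>u v. u \<in> V \<Longrightarrow> v \<in> V \<Longrightarrow> m u v = m v u"
    and pos: "\<And>v. v \<in> V \<Longrightarrow> v \<noteq> 0 \<Longrightarrow> 0 < m v v"
    using assms by (auto simp: findim_def inner_product_on_def)
  note lin2 = bilinear_onD(1)[OF bil] and lin1 = bilinear_onD(2)[OF bil]
  obtain B where B: "finite B" "B \<subseteq> V" "span B = V"
    using findim_span[OF assms(1)] .
  have "\<exists>n e. (\<forall>i<n::nat. e i \<in> V) \<and> (\<forall>i<n. \<forall>j<n. m (e i) (e j) = (if i = j then 1 else 0)) \<and>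
          (\<forall>v\<in>span B. v = (\<Sum>i<n. m v (e i) *\<^sub>R e i))"
    using B(1,2)
  proof (induction B rule: finite_induct)
    case empty
    show ?case by (rule exI[of _ 0]) auto
  next
    case (insert b B)
    then have "\<exists>n e. (\<forall>i<n::nat. e i \<in> V) \<and> (\<forall>i<n. \<forall>j<n. m (e i) (e j) = (if i = j then 1 else 0)) \<and>
          (\<forall>v\<in>span B. v = (\<Sum>i<n. m v (e i) *\<^sub>R e i))" by blast
    then obtain n e where e0: "\<forall>i<n::nat. e i \<in> V"
      "\<forall>i<n. \<forall>j<n. m (e i) (e j) = (if i = j then 1 else 0)"
      "\<forall>v\<in>span B. v = (\<Sum>i<n. m v (e i) *\<^sub>R e i)" by (elim exE conjE) (rule that)
    note e = e0[rule_format]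
    have b: "b \<in> V" and BV: "span B \<subseteq> V" using insert sV by (auto simp: span_minimal)
    define p where "p = (\<Sum>i<n. m b (e i) *\<^sub>R e i)"
    \<comment> \<open>The component of the new vector \<open>b\<close> that is orthogonal to the basis obtained so far; it is
      appended, normalized, unless it vanishes.\<close>
    define r where "r = b - p"
    have pV: "p \<in> V" unfolding p_def using e(1) sV by (auto intro!: subspace_sum subspace_scale)
    have rV: "r \<in> V" using b pV sV by (simp add: r_def subspace_diff)
    have re: "m r (e i) = 0" if "i < n" for i
    proof -
      have "m p (e i) = (\<Sum>j<n. m b (e j) *\<^sub>R m (e j) (e i))"
        unfolding p_def using linear_on_sum[OF lin1[OF e(1)[OF that]] sV, of "{..<n}" e] e(1) by auto
      also have "\<dots> = (\<Sum>j<n. if j = i then m b (e j) else 0)"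
        using that e(2) by (intro sum.cong) auto
      also have "\<dots> = m b (e i)" using that by simp
      finally show ?thesis
        using linear_on_diff[OF lin1[OF e(1)[OF that]] sV b pV] by (simp add: r_def)
    qed
    have span_p: "p = (\<Sum>i<n. m p (e i) *\<^sub>R e i)"
    proof -
      have "m p (e i) = m b (e i)" if "i < n" for i
        using re[OF that] linear_on_diff[OF lin1[OF e(1)[OF that]] sV b pV] by (simp add: r_def)
      then show ?thesis by (simp add: p_def)
    qed
    have decomp: "\<exists>x k. x \<in> V \<and> v = x + k *\<^sub>R r \<and> x = (\<Sum>i<n. m x (e i) *\<^sub>R e i)"
      if v: "v \<in> span (insert b B)" for v
    proof -
      obtain k where k: "v - k *\<^sub>R b \<in> span B" using v span_breakdown_eq by blast
      let ?y = "v - k *\<^sub>R b"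
      have yV: "?y \<in> V" using k BV by blast
      have kpV: "k *\<^sub>R p \<in> V" using pV sV by (simp add: subspace_scale)
      have "m (?y + k *\<^sub>R p) (e i) = m ?y (e i) + k * m p (e i)" if "i < n" for i
        using linear_onD[OF lin1[OF e(1)[OF that]]] yV kpV pV by simp
      then have "(\<Sum>i<n. m (?y + k *\<^sub>R p) (e i) *\<^sub>R e i)
          = (\<Sum>i<n. m ?y (e i) *\<^sub>R e i) + k *\<^sub>R (\<Sum>i<n. m p (e i) *\<^sub>R e i)"
        by (simp add: scaleR_add_left sum.distrib scaleR_sum_right)
      also have "\<dots> = ?y + k *\<^sub>R p" using e(3)[OF k] span_p by simp
      finally show ?thesis
        using subspace_add[OF sV yV kpV]
        by (intro exI[of _ "?y + k *\<^sub>R p"] exI[of _ k] conjI) (simp_all add: r_def scaleR_diff_right)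
    qed
    show ?case
    proof (cases "r = 0")
      case True
      then have "v = (\<Sum>i<n. m v (e i) *\<^sub>R e i)" if "v \<in> span (insert b B)" for v
        using decomp[OF that] by auto
      then show ?thesis using e(1,2) by (intro exI[of _ n] exI[of _ e] conjI allI impI ballI)
    next
      case False
      define s where "s = sqrt (m r r)"
      have s: "s > 0" "s * s = m r r" using pos[OF rV False] by (simp_all add: s_def)
      define e' where "e' = e(n := (1/s) *\<^sub>R r)"
      have new: "(1/s) *\<^sub>R r \<in> V" using rV sV by (simp add: subspace_scale)
      have e'V: "e' i \<in> V" if "i < Suc n" for i
        using that e(1)[of i] new by (auto simp: e'_def less_Suc_eq)
      have xr: "m x ((1/s) *\<^sub>R r) = (1/s) * m x r" if "x \<in> V" for x
        using linear_onD(2)[OF lin2[OF that] rV] by simp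
      have er: "m (e i) r = 0" if "i < n" for i
        using re[OF that] sym[OF rV e(1)[OF that]] by simp
      have rx: "m ((1/s) *\<^sub>R r) x = (1/s) * m r x" if "x \<in> V" for x
        using linear_onD(2)[OF lin1[OF that] rV] by simp
      have orth: "m (e' i) (e' j) = (if i = j then 1 else 0)" if "i < Suc n" "j < Suc n" for i j
        using that e(2)[of i j] er[of i] re[of j] s
        by (auto simp: e'_def less_Suc_eq xr e(1) rx rV new)
      have "v = (\<Sum>i<Suc n. m v (e' i) *\<^sub>R e' i)" if v: "v \<in> span (insert b B)" for v
      proof -
        obtain x k where xk: "x \<in> V" "v = x + k *\<^sub>R r" "x = (\<Sum>i<n. m x (e i) *\<^sub>R e i)"
          using decomp[OF v] by blast
        have krV: "k *\<^sub>R r \<in> V" using rV sV by (simp add: subspace_scale)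
        have add: "m v y = m x y + k * m r y" if "y \<in> V" for y
          using linear_onD[OF lin1[OF that]] xk(1) krV rV by (simp add: xk(2))
        have "m x r = (\<Sum>i<n. m x (e i) *\<^sub>R m (e i) r)"
          by (subst xk(3)) (rule linear_on_sum[OF lin1[OF rV] sV], use e(1) in auto)
        also have "\<dots> = 0" using er by simp
        finally have "m v ((1/s) *\<^sub>R r) = k * s"
          using s(1) add[OF new] xr[OF xk(1)] xr[OF rV] by (simp add: s(2)[symmetric])
        then have "m v (e' n) *\<^sub>R e' n = k *\<^sub>R r"
          using s(1) by (simp add: e'_def)
        moreover have "(\<Sum>i<n. m v (e' i) *\<^sub>R e' i) = (\<Sum>i<n. m x (e i) *\<^sub>R e i)"
          by (rule sum.cong) (auto simp: e'_def add e(1) re)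
        ultimately show ?thesis using xk by simp
      qed
      then show ?thesis using e'V orth
        by (intro exI[of _ "Suc n"] exI[of _ e'] conjI allI impI ballI)
    qed
  qed
  then show thesis
    unfolding B(3)
  proof (elim exE conjE)
    fix n :: nat and e
    assume e: "\<forall>i<n. e i \<in> V" "\<forall>i<n. \<forall>j<n. m (e i) (e j) = (if i = j then 1 else 0)"
      "\<forall>v\<in>V. v = (\<Sum>i<n. m v (e i) *\<^sub>R e i)"
    show thesis by (rule that[OF e[rule_format]])
  qed
qed

lemma riesz_representation:
  assumes V: "findim V" and m: "inner_product_on V m" and f: "linear_on V f"
  shows "\<exists>!p. p \<in> V \<and> (\<forall>q\<in>V. m p q = f q)"
proof -
  have sV: "subspace V" and bil: "bilinear_on V V m"
    and pos: "\<And>v. v \<in> V \<Longrightarrow> v \<noteq> 0 \<Longrightarrow> 0 < m v v"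
    and sym: "\<And>u v. u \<in> V \<Longrightarrow> v \<in> V \<Longrightarrow> m u v = m v u"
    using assms by (auto simp: findim_def inner_product_on_def)
  obtain n :: nat and e where e: "\<And>i. i < n \<Longrightarrow> e i \<in> V"
     "\<And>v. v \<in> V \<Longrightarrow> v = (\<Sum>i<n. m v (e i) *\<^sub>R e i)"
    by (rule orthonormal_basis[OF V m]) (rule that)
  show ?thesis
  proof (rule ex_ex1I)
    let ?p = "\<Sum>i<n. f (e i) *\<^sub>R e i"
    have "m ?p q = f q" if q: "q \<in> V" for q
    proof -
      have "m ?p q = (\<Sum>i<n. f (e i) *\<^sub>R m (e i) q)"
        using linear_on_sum[OF bilinear_onD(2)[OF bil q] sV, of "{..<n}" e] e(1) by auto
      also have "\<dots> = (\<Sum>i<n. m q (e i) *\<^sub>R f (e i))"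
        using sym q e(1) by (intro sum.cong) auto
      also have "\<dots> = f (\<Sum>i<n. m q (e i) *\<^sub>R e i)"
        using linear_on_sum[OF f sV, of "{..<n}" e] e(1) by auto
      also have "\<dots> = f q" using e(2)[OF q] by simp
      finally show ?thesis .
    qed
    moreover have "?p \<in> V" using e(1) sV by (auto intro!: subspace_sum subspace_scale)
    ultimately show "\<exists>p. p \<in> V \<and> (\<forall>q\<in>V. m p q = f q)" by blast
  next
    fix p q assume *: "p \<in> V \<and> (\<forall>x\<in>V. m p x = f x)" "q \<in> V \<and> (\<forall>x\<in>V. m q x = f x)"
    then have pq: "p - q \<in> V" using sV by (simp add: subspace_diff)
    have "m (p - q) (p - q) = 0"
      using linear_on_diff[OF bilinear_onD(2)[OF bil pq] sV] * pq by simp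
    then show "p = q" using pos[OF pq] by auto
  qed
qed

text \<open>
  Functions in the space are determined by their values on the finite set \<open>P\<close>, and the \<open>g p\<close> are
  the Lagrange basis for these nodes.  Through this basis, pointwise statements about a curve in
  the space, such as differentiability in time, become statements about finitely many scalars.
\<close>
lemma nodal_basis:
  fixes V :: "('a \<Rightarrow> real) set"
  assumes "findim V"
  obtains P g where "finite P" "\<And>p. p \<in> P \<Longrightarrow> g p \<in> V"
    and "\<And>v. v \<in> V \<Longrightarrow> v = (\<Sum>p\<in>P. v p *\<^sub>R g p)"
proof -
  have sV: "subspace V" using assms by (simp add: findim_def)
  obtain B where B: "finite B" "B \<subseteq> V" "span B = V"
    using findim_span[OF assms] .
  have "\<exists>P g. finite P \<and> (\<forall>p\<in>P. g p \<in> V) \<and>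
          (\<forall>p\<in>P. \<forall>q\<in>P. g p q = (if p = q then 1 else 0)) \<and> (\<forall>v\<in>span B. v = (\<Sum>p\<in>P. v p *\<^sub>R g p))"
    using B(1,2)
  proof (induction B rule: finite_induct)
    case empty
    show ?case by (rule exI[of _ "{}"]) auto
  next
    case (insert b B)
    then have "\<exists>P g. finite P \<and> (\<forall>p\<in>P. g p \<in> V) \<and>
          (\<forall>p\<in>P. \<forall>q\<in>P. g p q = (if p = q then 1 else 0)) \<and> (\<forall>v\<in>span B. v = (\<Sum>p\<in>P. v p *\<^sub>R g p))"
      by blast
    then obtain P g where P0: "finite P" "\<forall>p\<in>P. g p \<in> V"
      "\<forall>p\<in>P. \<forall>q\<in>P. g p q = (if p = q then 1 else 0)"
      "\<forall>v\<in>span B. v = (\<Sum>p\<in>P. v p *\<^sub>R g p)" by (elim exE conjE) (rule that)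
    note P = P0[rule_format]
    \<comment> \<open>The interpolation error of the new function.  It vanishes at the old nodes; any point where it
      does not vanish is a new node.\<close>
    define r where "r = b - (\<Sum>p\<in>P. b p *\<^sub>R g p)"
    have rV: "r \<in> V" unfolding r_def using insert P(2) sV
      by (auto intro!: subspace_diff subspace_sum subspace_scale)
    have r0: "r q = 0" if "q \<in> P" for q
    proof -
      have "(\<Sum>p\<in>P. b p * g p q) = (\<Sum>p\<in>P. if p = q then b p else 0)"
        using that P(3) by (intro sum.cong) auto
      then show ?thesis using that P(1) by (simp add: r_def sum_fun_apply)
    qed
    have decomp: "\<exists>k. v = (\<Sum>p\<in>P. v p *\<^sub>R g p) + k *\<^sub>R r" if v: "v \<in> span (insert b B)" for v
    proof -
      obtain k where k: "v - k *\<^sub>R b \<in> span B" using v span_breakdown_eq by blast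
      have "v - k *\<^sub>R b = (\<Sum>p\<in>P. (v p - k * b p) *\<^sub>R g p)"
        using P(4)[OF k] by simp
      also have "\<dots> = (\<Sum>p\<in>P. v p *\<^sub>R g p) - k *\<^sub>R (\<Sum>p\<in>P. b p *\<^sub>R g p)"
        by (simp add: scaleR_diff_left sum_subtractf scaleR_sum_right)
      finally show ?thesis
        by (intro exI[of _ k]) (simp add: r_def algebra_simps)
    qed
    show ?case
    proof (cases "r = 0")
      case True
      then have "v = (\<Sum>p\<in>P. v p *\<^sub>R g p)" if "v \<in> span (insert b B)" for v
        using decomp[OF that] by auto
      then show ?thesis using P(1-3) by (intro exI[of _ P] exI[of _ g] conjI allI impI ballI)
    next
      case False
      then obtain x where x: "r x \<noteq> 0" by (auto simp: fun_eq_iff)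
      then have xP: "x \<notin> P" using r0 by blast
      define h where "h = (1 / r x) *\<^sub>R r"
      have h: "h \<in> V" "h x = 1" "\<And>q. q \<in> P \<Longrightarrow> h q = 0"
        using rV sV x r0 by (auto simp: h_def subspace_scale)
      define g' where "g' p = (if p = x then h else g p - g p x *\<^sub>R h)" for p
      have "g' p \<in> V" if "p \<in> insert x P" for p
        using that P(2) h(1) sV by (auto simp: g'_def intro!: subspace_diff subspace_scale)
      moreover have "g' p q = (if p = q then 1 else 0)" if "p \<in> insert x P" "q \<in> insert x P" for p q
        using that P(3) h xP by (auto simp: g'_def)
      moreover have "v = (\<Sum>p\<in>insert x P. v p *\<^sub>R g' p)" if v: "v \<in> span (insert b B)" for v
      proof -
        obtain k where k: "v = (\<Sum>p\<in>P. v p *\<^sub>R g p) + k *\<^sub>R r" using decomp[OF v] by blast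
        have "v x = (\<Sum>p\<in>P. v p * g p x) + k * r x"
          by (subst k) (simp add: sum_fun_apply)
        then have "(v x - (\<Sum>p\<in>P. v p * g p x)) *\<^sub>R h = k *\<^sub>R r"
          using x by (simp add: h_def)
        moreover have "(\<Sum>p\<in>insert x P. v p *\<^sub>R g' p)
            = v x *\<^sub>R h + (\<Sum>p\<in>P. v p *\<^sub>R g p - (v p * g p x) *\<^sub>R h)"
          using P(1) xP by (auto simp: g'_def scaleR_diff_right intro!: sum.cong)
        moreover have "\<dots> = (\<Sum>p\<in>P. v p *\<^sub>R g p) + (v x - (\<Sum>p\<in>P. v p * g p x)) *\<^sub>R h"
          by (simp add: sum_subtractf scaleR_diff_left scaleR_sum_left)
        ultimately show ?thesis using k by simp
      qed
      ultimately show ?thesis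
        using P(1) by (intro exI[of _ "insert x P"] exI[of _ g'] conjI allI impI ballI finite.insertI)
    qed
  qed
  then show thesis
    unfolding B(3)
  proof (elim exE conjE)
    fix P g
    assume P: "finite P" "\<forall>p\<in>P. g p \<in> V" "\<forall>v\<in>V. v = (\<Sum>p\<in>P. v p *\<^sub>R g p)"
    show thesis by (rule that[OF P(1) P(2,3)[rule_format]])
  qed
qed

section \<open>Ordinary differential equations with arbitrarily many unknowns\<close>

lemma nat_eq_of_dist: "\<bar>real m - real n\<bar> < 1 \<Longrightarrow> m = n"
  by linarith

text \<open>
  The number of unknowns of the discrete problem is not given by a type.  A system of scalar
  equations is treated as one scalar function of time and component index, and Picard iteration
  takes place in the Banach space of bounded continuous functions on \<open>real \<times> nat\<close>.  The latter is
  available over metric domains, hence the discrete space \<open>nat\<close> is given the distance of the line.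
\<close>
instantiation nat :: metric_space
begin

definition "dist m n = \<bar>real m - real n\<bar>"

definition "uniformity = (INF e\<in>{0<..}. principal {(m, n::nat). dist m n < e})"

instance
proof
  fix U :: "nat set"
  have "\<forall>\<^sub>F (m', n) in uniformity. m' = m \<longrightarrow> n \<in> U" if "m \<in> U" for m
  proof -
    have "\<forall>\<^sub>F (m, n) in uniformity. dist m (n::nat) < 1"
      unfolding uniformity_nat_def by (rule eventually_INF1[of 1]) (auto simp: eventually_principal)
    then show ?thesis
      by (rule eventually_mono) (use that in \<open>auto simp: dist_nat_def dest!: nat_eq_of_dist\<close>)
  qed
  then show "open U = (\<forall>m\<in>U. \<forall>\<^sub>F (m', n) in uniformity. m' = m \<longrightarrow> n \<in> U)"
    by (simp add: open_discrete)
qed (auto simp: dist_nat_def uniformity_nat_def)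

end

lemma continuous_on_real_times_nat:
  fixes f :: "nat \<Rightarrow> real \<Rightarrow> real"
  assumes "\<And>i. continuous_on UNIV (f i)"
  shows "continuous_on UNIV (\<lambda>p. f (snd p) (fst p))"
proof -
  have "continuous_on (\<Union>i\<in>UNIV. UNIV \<times> {i::nat}) (\<lambda>p. f (snd p) (fst p))"
  proof (rule continuous_on_open_UN)
    fix i :: nat
    show "open (UNIV \<times> {i} :: (real \<times> nat) set)"
      by (intro open_Times open_UNIV) (simp add: open_discrete)
    have "continuous_on (UNIV \<times> {i}) (\<lambda>p. f i (fst p))"
      by (intro continuous_on_compose2[OF assms[of i]] continuous_intros) auto
    then show "continuous_on (UNIV \<times> {i}) (\<lambda>p. f (snd p) (fst p))"
      by (rule continuous_on_eq) auto
  qed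
  moreover have "(\<Union>i\<in>UNIV. UNIV \<times> {i::nat}) = (UNIV :: (real \<times> nat) set)" by auto
  ultimately show ?thesis by simp
qed

lemma continuous_on_lipschitz_compose:
  fixes h :: "real \<Rightarrow> (nat \<Rightarrow> real) \<Rightarrow> real"
  assumes lip: "\<And>t a b. t \<in> S \<Longrightarrow> \<bar>h t a - h t b\<bar> \<le> L * (\<Sum>j<n. \<bar>a j - b j\<bar>)"
    and cont: "\<And>a. continuous_on S (\<lambda>t. h t a)"
    and y: "\<And>j. j < n \<Longrightarrow> continuous_on S (\<lambda>t. y t j)"
  shows "continuous_on S (\<lambda>t. h t (y t))"
  unfolding continuous_on_def
proof
  fix t assume t: "t \<in> S"
  have "((\<lambda>s. L * (\<Sum>j<n. \<bar>y s j - y t j\<bar>)) \<longlongrightarrow> L * (\<Sum>j<n. \<bar>y t j - y t j\<bar>)) (at t within S)"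
    using y t by (intro tendsto_intros) (auto simp: continuous_on_def)
  then have lim: "((\<lambda>s. L * (\<Sum>j<n. \<bar>y s j - y t j\<bar>)) \<longlongrightarrow> 0) (at t within S)"
    by simp
  have "((\<lambda>s. h s (y s) - h s (y t)) \<longlongrightarrow> 0) (at t within S)"
  proof (rule Lim_null_comparison[OF _ lim])
    show "\<forall>\<^sub>F s in at t within S. norm (h s (y s) - h s (y t)) \<le> L * (\<Sum>j<n. \<bar>y s j - y t j\<bar>)"
      unfolding eventually_at_filter by (rule always_eventually) (simp add: lip)
  qed
  from tendsto_add[OF this, of "\<lambda>s. h s (y t)" "h t (y t)"]
  show "((\<lambda>s. h s (y s)) \<longlongrightarrow> h t (y t)) (at t within S)"
    using cont[of "y t"] t unfolding continuous_on_def by simp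
qed

text \<open>
  Banach's fixed point theorem, applied to the functions \<open>exp (- r * t) * x t i\<close> with \<open>r\<close> large
  compared to the Lipschitz constant.  With this weight the Picard operator is a contraction on the
  whole interval \<open>[0, T]\<close> at once, so that no solutions on short intervals have to be glued.
\<close>
lemma picard_global_lipschitz:
  fixes H :: "real \<Rightarrow> (nat \<Rightarrow> real) \<Rightarrow> nat \<Rightarrow> real"
  assumes T: "0 < T"
    and lip: "\<And>t a b i. t \<in> {0..T} \<Longrightarrow> i < n \<Longrightarrow> \<bar>H t a i - H t b i\<bar> \<le> L * (\<Sum>j<n. \<bar>a j - b j\<bar>)"
    and cont: "\<And>a i. i < n \<Longrightarrow> continuous_on {0..T} (\<lambda>t. H t a i)"
  shows "\<exists>x. \<forall>i<n. x 0 i = c i \<and>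
           (\<forall>t\<in>{0..T}. ((\<lambda>s. x s i) has_real_derivative H t (x t) i) (at t within {0..T}))"
proof -
  define M where "M = max 0 L"
  have M: "0 \<le> M" by (simp add: M_def)
  have lipM: "\<bar>H t a i - H t b i\<bar> \<le> M * (\<Sum>j<n. \<bar>a j - b j\<bar>)" if "t \<in> {0..T}" "i < n" for t a b i
    using lip[OF that, of a b] mult_right_mono[of L M "\<Sum>j<n. \<bar>a j - b j\<bar>"]
    by (force simp: M_def sum_nonneg)
  \<comment> \<open>The integral operator has Lipschitz constant at most \<open>M * n / r\<close>, which is below 1/2.\<close>
  define r where "r = 2 * M * n + 1"
  have r: "0 < r" using M by (simp add: r_def add_nonneg_pos)
  \<comment> \<open>Bounded continuous functions live on the whole line; time is frozen outside of \<open>[0, T]\<close>.\<close>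
  define \<tau> where "\<tau> t = max 0 (min T t)" for t
  have \<tau>: "\<tau> t \<in> {0..T}" for t using T by (auto simp: \<tau>_def)
  have \<tau>c: "continuous_on UNIV \<tau>" unfolding \<tau>_def by (intro continuous_intros)
  define J where "J v s = H s (\<lambda>j. exp (r * s) * apply_bcontfun v (s, j))"
    for v :: "(real \<times> nat) \<Rightarrow>\<^sub>C real" and s
  have Jc: "continuous_on {0..T} (\<lambda>s. J v s i)" if "i < n" for v i
    unfolding J_def
  proof (rule continuous_on_lipschitz_compose[where L = M and n = n and h = "\<lambda>s a. H s a i"
          and y = "\<lambda>s j. exp (r * s) * apply_bcontfun v (s, j)"])
    fix j
    have "continuous_on {0..T} (\<lambda>s. apply_bcontfun v (s, j))"
      by (rule continuous_on_compose2[OF continuous_on_apply_bcontfun[of UNIV v]])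
         (auto intro!: continuous_intros)
    then show "continuous_on {0..T} (\<lambda>s. exp (r * s) * apply_bcontfun v (s, j))"
      by (intro continuous_intros)
  qed (use lipM cont that in blast)+
  have Ji: "(\<lambda>s. J v s i) integrable_on {0..u}" if "i < n" "u \<in> {0..T}" for v i u
    using that by (intro integrable_continuous_real continuous_on_subset[OF Jc]) auto
  define \<Psi> where "\<Psi> v i u =
      (if i < n then exp (- (r * u)) * (c i + integral {0..u} (\<lambda>s. J v s i)) else 0)" for v i u
  have \<Psi>c: "continuous_on {0..T} (\<Psi> v i)" for v i
  proof (cases "i < n")
    case True
    show ?thesis unfolding \<Psi>_def using True
      by simp (intro continuous_intros indefinite_integral_continuous_1 Ji, use T in auto)
  qed (simp add: \<Psi>_def)
  have \<Psi>b: "\<exists>B. \<forall>i. \<forall>u\<in>{0..T}. \<bar>\<Psi> v i u\<bar> \<le> B" for v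
  proof -
    have "\<exists>B. \<forall>u\<in>{0..T}. \<bar>\<Psi> v i u\<bar> \<le> B" for i
      using compact_imp_bounded[OF compact_continuous_image[OF \<Psi>c[of v i] compact_Icc]]
      by (auto simp: bounded_iff)
    then obtain B where B: "\<And>i u. u \<in> {0..T} \<Longrightarrow> \<bar>\<Psi> v i u\<bar> \<le> B i" by metis
    have "0 \<le> B i" for i using B[of 0 i] T by force
    have "\<bar>\<Psi> v i u\<bar> \<le> (\<Sum>j<n. B j)" if u: "u \<in> {0..T}" for i u
    proof (cases "i < n")
      case True
      then show ?thesis
        using B[OF u, of i] member_le_sum[of i "{..<n}" B] \<open>\<And>i. 0 \<le> B i\<close> by auto
    next
      case False
      then show ?thesis using \<open>\<And>i. 0 \<le> B i\<close> by (simp add: \<Psi>_def sum_nonneg)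
    qed
    then show ?thesis by blast
  qed
  define \<Phi> where "\<Phi> v = Bcontfun (\<lambda>p. \<Psi> v (snd p) (\<tau> (fst p)))" for v
  have \<Phi>: "apply_bcontfun (\<Phi> v) p = \<Psi> v (snd p) (\<tau> (fst p))" for v p
  proof -
    obtain B where "\<And>i u. u \<in> {0..T} \<Longrightarrow> \<bar>\<Psi> v i u\<bar> \<le> B" using \<Psi>b[of v] by blast
    moreover have "continuous_on UNIV (\<lambda>p. \<Psi> v (snd p) (\<tau> (fst p)))"
      by (rule continuous_on_real_times_nat[where f = "\<lambda>i t. \<Psi> v i (\<tau> t)"],
          rule continuous_on_compose2[OF \<Psi>c \<tau>c]) (use \<tau> in auto)
    ultimately have "(\<lambda>p. \<Psi> v (snd p) (\<tau> (fst p))) \<in> bcontfun"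
      using \<tau> by (intro bcontfun_normI[where b = B]) auto
    then show ?thesis by (simp add: \<Phi>_def Bcontfun_inverse)
  qed
  have contr: "dist (\<Phi> v) (\<Phi> w) \<le> 1/2 * dist v w" for v w
  proof (rule dist_bound)
    fix p :: "real \<times> nat"
    obtain i where i: "i = snd p" by simp
    define u where "u = \<tau> (fst p)"
    have u: "u \<in> {0..T}" "0 \<le> u" using \<tau> by (auto simp: u_def)
    define D where "D = dist v w"
    have D: "0 \<le> D" by (simp add: D_def)
    have "\<bar>\<Psi> v i u - \<Psi> w i u\<bar> \<le> 1/2 * D"
    proof (cases "i < n")
      case True
      have Jd: "\<bar>J v s i - J w s i\<bar> \<le> M * n * D * exp (r * s)" if s: "s \<in> {0..u}" for s
      proof -
        have "\<bar>J v s i - J w s i\<bar> \<le>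
            M * (\<Sum>j<n. \<bar>exp (r * s) * apply_bcontfun v (s, j) - exp (r * s) * apply_bcontfun w (s, j)\<bar>)"
          unfolding J_def using s u True by (intro lipM) auto
        also have "\<dots> \<le> M * (\<Sum>j<n. exp (r * s) * D)"
        proof (intro mult_left_mono sum_mono M)
          fix j
          have "\<bar>apply_bcontfun v (s, j) - apply_bcontfun w (s, j)\<bar> \<le> D"
            unfolding D_def using dist_bounded[of v "(s, j)" w] by (simp add: dist_real_def)
          then show "\<bar>exp (r * s) * apply_bcontfun v (s, j) - exp (r * s) * apply_bcontfun w (s, j)\<bar>
              \<le> exp (r * s) * D"
            by (simp add: abs_mult flip: right_diff_distrib)
        qed
        finally show ?thesis by (simp add: mult_ac)
      qed
      have E: "((\<lambda>s. M * n * D * exp (r * s)) has_integral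
                 M * n * D * (exp (r * u) / r) - M * n * D * (exp (r * 0) / r)) {0..u}"
        using u r
        by (intro fundamental_theorem_of_calculus)
           (auto intro!: derivative_eq_intros simp flip: has_real_derivative_iff_has_vector_derivative)
      have "\<bar>integral {0..u} (\<lambda>s. J v s i) - integral {0..u} (\<lambda>s. J w s i)\<bar>
          = norm (integral {0..u} (\<lambda>s. J v s i - J w s i))"
        using Ji[OF True u(1)] by (simp add: integral_diff)
      also have "\<dots> \<le> integral {0..u} (\<lambda>s. M * n * D * exp (r * s))"
        using Jd Ji[OF True u(1)] E by (intro integral_norm_bound_integral) (auto intro: integrable_diff)
      also have "\<dots> = M * n * D * (exp (r * u) / r) - M * n * D / r"
        using integral_unique[OF E] by simp
      also have "\<dots> \<le> M * n * D * (exp (r * u) / r)"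
        using M D r by simp
      finally have "\<bar>integral {0..u} (\<lambda>s. J v s i) - integral {0..u} (\<lambda>s. J w s i)\<bar>
          \<le> M * n * D * (exp (r * u) / r)" .
      moreover have "\<Psi> v i u - \<Psi> w i u
          = exp (- (r * u)) * (integral {0..u} (\<lambda>s. J v s i) - integral {0..u} (\<lambda>s. J w s i))"
        using True by (simp add: \<Psi>_def algebra_simps)
      ultimately have "\<bar>\<Psi> v i u - \<Psi> w i u\<bar> \<le> exp (- (r * u)) * (M * n * D * (exp (r * u) / r))"
        by (simp only: abs_mult abs_exp_cancel mult_left_mono exp_ge_zero)
      also have "\<dots> = (M * n / r) * D" by (simp add: exp_minus field_simps)
      also have "\<dots> \<le> 1/2 * D"
        using r D M by (intro mult_right_mono) (auto simp: r_def field_simps)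
      finally show ?thesis .
    next
      case False
      then show ?thesis using D by (simp add: \<Psi>_def)
    qed
    then show "dist (apply_bcontfun (\<Phi> v) p) (apply_bcontfun (\<Phi> w) p) \<le> 1/2 * dist v w"
      by (simp add: \<Phi> u_def i D_def dist_real_def)
  qed
  obtain v where v: "\<Phi> v = v"
    using banach_fix_type[of "1/2" \<Phi>] contr by auto
  define x where "x t i = exp (r * t) * apply_bcontfun v (t, i)" for t i
  have JH: "J v s i = H s (x s) i" for s i
    by (simp add: J_def x_def[abs_def])
  have x: "x t i = c i + integral {0..t} (\<lambda>s. H s (x s) i)" if "i < n" "t \<in> {0..T}" for i t
  proof -
    have "\<tau> t = t" using that by (auto simp: \<tau>_def)
    then have "apply_bcontfun v (t, i) = exp (- (r * t)) * (c i + integral {0..t} (\<lambda>s. J v s i))"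
      using \<Phi>[of v "(t, i)"] v that by (simp add: \<Psi>_def)
    then show ?thesis unfolding x_def JH by (simp flip: exp_add mult.assoc)
  qed
  have "x 0 i = c i \<and>
      (\<forall>t\<in>{0..T}. ((\<lambda>s. x s i) has_real_derivative H t (x t) i) (at t within {0..T}))" if i: "i < n" for i
  proof (intro conjI ballI)
    show "x 0 i = c i" using T by (subst x[OF i]) auto
    fix t assume t: "t \<in> {0..T}"
    have "((\<lambda>s. c i + integral {0..s} (\<lambda>s. H s (x s) i)) has_real_derivative H t (x t) i)
        (at t within {0..T})"
      using Jc[OF i, of v] t
      by (auto simp: JH intro!: derivative_eq_intros integral_has_real_derivative)
    then show "((\<lambda>s. x s i) has_real_derivative H t (x t) i) (at t within {0..T})"
      by (rule has_field_derivative_transform_within[OF _ zero_less_one t])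
         (rule x[OF i, symmetric])
  qed
  then show ?thesis by blast
qed

text \<open>
  Only the first \<open>n\<close> entries of a sequence are unknowns of the system; they are measured in the sum
  norm.
\<close>
definition lipschitz_on_ball :: "nat \<Rightarrow> real \<Rightarrow> real \<Rightarrow> ((nat \<Rightarrow> real) \<Rightarrow> real) \<Rightarrow> bool" where
  "lipschitz_on_ball n M L h \<longleftrightarrow> 0 \<le> L \<and>
     (\<forall>a b. (\<Sum>j<n. \<bar>a j\<bar>) \<le> M \<longrightarrow> (\<Sum>j<n. \<bar>b j\<bar>) \<le> M \<longrightarrow>
        \<bar>h a - h b\<bar> \<le> L * (\<Sum>j<n. \<bar>a j - b j\<bar>))"

definition locally_lipschitz :: "nat \<Rightarrow> ((nat \<Rightarrow> real) \<Rightarrow> real) \<Rightarrow> bool" where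
  "locally_lipschitz n h \<longleftrightarrow> (\<forall>M\<ge>0. \<exists>L. lipschitz_on_ball n M L h)"

lemma locally_lipschitzI:
  "(\<And>M. 0 \<le> M \<Longrightarrow> \<exists>L. lipschitz_on_ball n M L h) \<Longrightarrow> locally_lipschitz n h"
  by (simp add: locally_lipschitz_def)

lemma locally_lipschitzD: "locally_lipschitz n h \<Longrightarrow> 0 \<le> M \<Longrightarrow> \<exists>L. lipschitz_on_ball n M L h"
  by (simp add: locally_lipschitz_def)

lemma lipschitz_on_ballI:
  assumes "0 \<le> L"
    and "\<And>a b. (\<Sum>j<n. \<bar>a j\<bar>) \<le> M \<Longrightarrow> (\<Sum>j<n. \<bar>b j\<bar>) \<le> M \<Longrightarrow>
           \<bar>h a - h b\<bar> \<le> L * (\<Sum>j<n. \<bar>a j - b j\<bar>)"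
  shows "lipschitz_on_ball n M L h"
  using assms by (simp add: lipschitz_on_ball_def)

lemma lipschitz_on_ballD:
  assumes "lipschitz_on_ball n M L h"
  shows "0 \<le> L"
    and "(\<Sum>j<n. \<bar>a j\<bar>) \<le> M \<Longrightarrow> (\<Sum>j<n. \<bar>b j\<bar>) \<le> M \<Longrightarrow>
           \<bar>h a - h b\<bar> \<le> L * (\<Sum>j<n. \<bar>a j - b j\<bar>)"
  using assms by (simp_all add: lipschitz_on_ball_def)

lemma lipschitz_on_ball_bounded:
  assumes "lipschitz_on_ball n M L h" "0 \<le> M"
  shows "\<exists>C\<ge>0. \<forall>a. (\<Sum>j<n. \<bar>a j\<bar>) \<le> M \<longrightarrow> \<bar>h a\<bar> \<le> C"
proof -
  note L = lipschitz_on_ballD[OF assms(1)]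
  have "\<bar>h a\<bar> \<le> \<bar>h (\<lambda>_. 0)\<bar> + L * M" if a: "(\<Sum>j<n. \<bar>a j\<bar>) \<le> M" for a
  proof -
    have "\<bar>h a - h (\<lambda>_. 0)\<bar> \<le> L * (\<Sum>j<n. \<bar>a j\<bar>)" using L(2)[OF a, of "\<lambda>_. 0"] assms(2) by simp
    also have "\<dots> \<le> L * M" using a L(1) by (rule mult_left_mono)
    finally show ?thesis by linarith
  qed
  moreover have "0 \<le> \<bar>h (\<lambda>_. 0)\<bar> + L * M" using L(1) assms(2) by simp
  ultimately show ?thesis by blast
qed

lemma locally_lipschitz_const [simp]: "locally_lipschitz n (\<lambda>_. c)"
  by (intro locally_lipschitzI exI[of _ 0] lipschitz_on_ballI) simp_all

lemma locally_lipschitz_coord: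
  assumes "i < n"
  shows "locally_lipschitz n (\<lambda>a. a i)"
proof (intro locally_lipschitzI exI[of _ 1] lipschitz_on_ballI)
  fix a b :: "nat \<Rightarrow> real"
  show "\<bar>a i - b i\<bar> \<le> 1 * (\<Sum>j<n. \<bar>a j - b j\<bar>)"
    using member_le_sum[of i "{..<n}" "\<lambda>j. \<bar>a j - b j\<bar>"] assms by simp
qed simp

lemma locally_lipschitz_add:
  assumes "locally_lipschitz n g" "locally_lipschitz n h"
  shows "locally_lipschitz n (\<lambda>a. g a + h a)"
proof (rule locally_lipschitzI)
  fix M :: real assume "0 \<le> M"
  then obtain K L where K: "lipschitz_on_ball n M K g" and L: "lipschitz_on_ball n M L h"
    using assms locally_lipschitzD by blast
  have "lipschitz_on_ball n M (K + L) (\<lambda>a. g a + h a)"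
  proof (rule lipschitz_on_ballI)
    fix a b :: "nat \<Rightarrow> real"
    assume ab: "(\<Sum>j<n. \<bar>a j\<bar>) \<le> M" "(\<Sum>j<n. \<bar>b j\<bar>) \<le> M"
    show "\<bar>g a + h a - (g b + h b)\<bar> \<le> (K + L) * (\<Sum>j<n. \<bar>a j - b j\<bar>)"
      using lipschitz_on_ballD(2)[OF K ab] lipschitz_on_ballD(2)[OF L ab]
      unfolding distrib_right by linarith
  qed (use lipschitz_on_ballD(1)[OF K] lipschitz_on_ballD(1)[OF L] in simp)
  then show "\<exists>L. lipschitz_on_ball n M L (\<lambda>a. g a + h a)" by blast
qed

lemma locally_lipschitz_mult:
  assumes "locally_lipschitz n g" "locally_lipschitz n h"
  shows "locally_lipschitz n (\<lambda>a. g a * h a)"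
proof (rule locally_lipschitzI)
  fix M :: real assume M: "0 \<le> M"
  then obtain K L where K: "lipschitz_on_ball n M K g" and L: "lipschitz_on_ball n M L h"
    using assms locally_lipschitzD by blast
  obtain C where C: "0 \<le> C" "\<forall>a. (\<Sum>j<n. \<bar>a j\<bar>) \<le> M \<longrightarrow> \<bar>g a\<bar> \<le> C"
    using lipschitz_on_ball_bounded[OF K M] by blast
  obtain D where D: "0 \<le> D" "\<forall>a. (\<Sum>j<n. \<bar>a j\<bar>) \<le> M \<longrightarrow> \<bar>h a\<bar> \<le> D"
    using lipschitz_on_ball_bounded[OF L M] by blast
  note K0 = lipschitz_on_ballD(1)[OF K] and L0 = lipschitz_on_ballD(1)[OF L]
  have "lipschitz_on_ball n M (K * D + C * L) (\<lambda>a. g a * h a)"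
  proof (rule lipschitz_on_ballI)
    fix a b :: "nat \<Rightarrow> real"
    assume ab: "(\<Sum>j<n. \<bar>a j\<bar>) \<le> M" "(\<Sum>j<n. \<bar>b j\<bar>) \<le> M"
    let ?S = "\<Sum>j<n. \<bar>a j - b j\<bar>"
    have S: "0 \<le> ?S" by (simp add: sum_nonneg)
    have "g a * h a - g b * h b = (g a - g b) * h a + g b * (h a - h b)"
      by (simp add: algebra_simps)
    then have "\<bar>g a * h a - g b * h b\<bar> \<le> \<bar>g a - g b\<bar> * \<bar>h a\<bar> + \<bar>g b\<bar> * \<bar>h a - h b\<bar>"
      by (metis abs_mult abs_triangle_ineq)
    also have "\<dots> \<le> (K * ?S) * D + C * (L * ?S)"
    proof (intro add_mono mult_mono)
      show "\<bar>g a - g b\<bar> \<le> K * ?S" "\<bar>h a - h b\<bar> \<le> L * ?S" "\<bar>h a\<bar> \<le> D" "\<bar>g b\<bar> \<le> C"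
        using lipschitz_on_ballD(2)[OF K ab] lipschitz_on_ballD(2)[OF L ab] C D ab by blast+
    qed (use C D S K0 L0 in simp_all)
    finally show "\<bar>g a * h a - g b * h b\<bar> \<le> (K * D + C * L) * ?S" by (simp add: algebra_simps)
  qed (use K0 L0 C(1) D(1) in simp)
  then show "\<exists>L. lipschitz_on_ball n M L (\<lambda>a. g a * h a)" by blast
qed

text \<open>
  The function \<open>E t * exp (- C * t)\<close> is nonincreasing.
\<close>
lemma gronwall:
  fixes E :: "real \<Rightarrow> real"
  assumes deriv: "\<And>t. t \<in> {0..T} \<Longrightarrow> (E has_real_derivative E' t) (at t within {0..T})"
    and le: "\<And>t. t \<in> {0..T} \<Longrightarrow> E' t \<le> C * E t"
    and t: "t \<in> {0..T}"
  shows "E t \<le> E 0 * exp (C * t)"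
proof -
  define g where "g t = E t * exp (- (C * t))" for t
  have g: "(g has_real_derivative (E' s - C * E s) * exp (- (C * s))) (at s within {0..T})"
    if "s \<in> {0..T}" for s
    unfolding g_def using deriv[OF that]
    by (auto intro!: derivative_eq_intros simp: algebra_simps)
  have "g t \<le> g 0"
  proof (rule DERIV_nonpos_imp_decreasing_open[where f = g and a = 0 and b = t])
    fix s assume s: "0 < s" "s < t"
    then have "(g has_real_derivative (E' s - C * E s) * exp (- (C * s))) (at s)"
      using g[of s] t at_within_Icc_at[of 0 s T] by auto
    moreover have "(E' s - C * E s) * exp (- (C * s)) \<le> 0"
      using le[of s] s t by (intro mult_nonpos_nonneg) auto
    ultimately show "\<exists>y. (g has_real_derivative y) (at s) \<and> y \<le> 0" by blast
  next
    have "continuous_on {0..T} g" using g by (rule DERIV_continuous_on)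
    then show "continuous_on {0..t} g" by (rule continuous_on_subset) (use t in auto)
  qed (use t in auto)
  then show ?thesis by (simp add: g_def exp_minus field_simps)
qed

text \<open>
  A cut-off function in the norm of the unknowns, equal to 1 on the ball of radius \<open>M\<close> and to 0
  outside of the ball of radius \<open>M + 1\<close>.
\<close>
definition cutoff :: "nat \<Rightarrow> real \<Rightarrow> (nat \<Rightarrow> real) \<Rightarrow> real" where
  "cutoff n M a = max 0 (min 1 (M + 1 - (\<Sum>j<n. \<bar>a j\<bar>)))"

text \<open>
  If one of two points lies in the support of the cut-off and the other does not, the difference of
  values is bounded by the variation of the cut-off, since the product vanishes at the latter.
\<close>
lemma cutoff_mult_lipschitz:
  assumes "locally_lipschitz n h" "0 \<le> M"
  shows "\<exists>L\<ge>0. \<forall>a b. \<bar>cutoff n M a * h a - cutoff n M b * h b\<bar> \<le> L * (\<Sum>j<n. \<bar>a j - b j\<bar>)"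
proof -
  have M: "0 \<le> M + 1" using assms(2) by simp
  obtain L where L: "lipschitz_on_ball n (M + 1) L h"
    using locally_lipschitzD[OF assms(1) M] by blast
  obtain C where C: "0 \<le> C" "\<forall>a. (\<Sum>j<n. \<bar>a j\<bar>) \<le> M + 1 \<longrightarrow> \<bar>h a\<bar> \<le> C"
    using lipschitz_on_ball_bounded[OF L M] by blast
  note L0 = lipschitz_on_ballD(1)[OF L]
  have cut: "\<bar>cutoff n M a - cutoff n M b\<bar> \<le> (\<Sum>j<n. \<bar>a j - b j\<bar>)" for a b
  proof -
    have "(\<Sum>j<n. \<bar>a j\<bar>) \<le> (\<Sum>j<n. \<bar>a j - b j\<bar> + \<bar>b j\<bar>)"
      by (rule sum_mono) linarith
    moreover have "(\<Sum>j<n. \<bar>b j\<bar>) \<le> (\<Sum>j<n. \<bar>a j - b j\<bar> + \<bar>a j\<bar>)"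
      by (rule sum_mono) linarith
    ultimately show ?thesis unfolding cutoff_def sum.distrib by linarith
  qed
  have out: "cutoff n M b = 0" if "\<not> (\<Sum>j<n. \<bar>b j\<bar>) \<le> M + 1" for b
    using that by (simp add: cutoff_def)
  have c01: "0 \<le> cutoff n M a" "cutoff n M a \<le> 1" for a
    by (simp_all add: cutoff_def)
  have one: "\<bar>cutoff n M a * h a - cutoff n M b * h b\<bar> \<le> (C + L) * (\<Sum>j<n. \<bar>a j - b j\<bar>)"
    if a: "(\<Sum>j<n. \<bar>a j\<bar>) \<le> M + 1" for a b
  proof -
    let ?S = "\<Sum>j<n. \<bar>a j - b j\<bar>"
    have S: "0 \<le> ?S" by (simp add: sum_nonneg)
    have "cutoff n M b * \<bar>h a - h b\<bar> \<le> L * ?S"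
    proof (cases "(\<Sum>j<n. \<bar>b j\<bar>) \<le> M + 1")
      case True
      have "cutoff n M b * \<bar>h a - h b\<bar> \<le> 1 * \<bar>h a - h b\<bar>"
        by (rule mult_right_mono) (simp_all add: c01)
      also have "\<dots> \<le> L * ?S" using lipschitz_on_ballD(2)[OF L a True] by simp
      finally show ?thesis .
    qed (use out S L0 in simp)
    moreover have "\<bar>cutoff n M a - cutoff n M b\<bar> * \<bar>h a\<bar> \<le> ?S * C"
      using cut[of a b] C a S by (intro mult_mono) auto
    moreover have "cutoff n M a * h a - cutoff n M b * h b
        = (cutoff n M a - cutoff n M b) * h a + cutoff n M b * (h a - h b)"
      by (simp add: algebra_simps)
    then have "\<bar>cutoff n M a * h a - cutoff n M b * h b\<bar>
        \<le> \<bar>cutoff n M a - cutoff n M b\<bar> * \<bar>h a\<bar> + cutoff n M b * \<bar>h a - h b\<bar>"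
      using abs_triangle_ineq c01(1)[of b] by (metis abs_mult abs_of_nonneg)
    ultimately show ?thesis by (simp add: algebra_simps)
  qed
  have "\<bar>cutoff n M a * h a - cutoff n M b * h b\<bar> \<le> (C + L) * (\<Sum>j<n. \<bar>a j - b j\<bar>)" for a b
  proof -
    consider "(\<Sum>j<n. \<bar>a j\<bar>) \<le> M + 1" | "(\<Sum>j<n. \<bar>b j\<bar>) \<le> M + 1"
      | "\<not> (\<Sum>j<n. \<bar>a j\<bar>) \<le> M + 1" "\<not> (\<Sum>j<n. \<bar>b j\<bar>) \<le> M + 1" by blast
    then show ?thesis
    proof cases
      case 1 then show ?thesis by (rule one)
    next
      case 2
      from one[OF this, of a] show ?thesis by (simp add: abs_minus_commute)
    next
      case 3
      then show ?thesis using out L0 C(1) by (simp add: sum_nonneg)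
    qed
  qed
  moreover have "0 \<le> C + L" using C(1) L0 by simp
  ultimately show ?thesis by blast
qed

definition ode_solution ::
    "nat \<Rightarrow> real \<Rightarrow> (real \<Rightarrow> nat \<Rightarrow> real) \<Rightarrow> ((nat \<Rightarrow> real) \<Rightarrow> nat \<Rightarrow> real) \<Rightarrow> (real \<Rightarrow> nat \<Rightarrow> real) \<Rightarrow> bool"
  where "ode_solution n T F G x \<longleftrightarrow>
    (\<forall>i<n. \<forall>t\<in>{0..T}. ((\<lambda>s. x s i) has_real_derivative F t i - G (x t) i) (at t within {0..T}))"

text \<open>
  The dissipation condition survives multiplication of \<open>G\<close> by a nonnegative factor.  The energy bound
  thus holds for the cut-off equation with a constant that does not depend on the cut-off, so
  that the radius \<open>M\<close> can be chosen in advance such that the cut-off equals 1 along the solution.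
\<close>
lemma dissipative_ode_exists:
  assumes T: "0 < T"
    and lip: "\<And>i. i < n \<Longrightarrow> locally_lipschitz n (\<lambda>a. G a i)"
    and diss: "\<And>a. 0 \<le> (\<Sum>i<n. a i * G a i)"
    and F: "\<And>i. i < n \<Longrightarrow> continuous_on {0..T} (\<lambda>t. F t i)"
  shows "\<exists>x. (\<forall>i<n. x 0 i = c i) \<and> ode_solution n T F G x"
proof -
  have "continuous_on {0..T} (\<lambda>t. \<Sum>i<n. (F t i)\<^sup>2)"
    using F by (intro continuous_intros) auto
  then have "bounded ((\<lambda>t. \<Sum>i<n. (F t i)\<^sup>2) ` {0..T})"
    by (intro compact_imp_bounded compact_continuous_image) auto
  then obtain K where K: "\<And>t. t \<in> {0..T} \<Longrightarrow> \<bar>\<Sum>i<n. (F t i)\<^sup>2\<bar> \<le> K"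
    unfolding bounded_iff by fastforce
  define M where "M = real n + ((\<Sum>i<n. (c i)\<^sup>2) + K) * exp T"
  have "0 \<le> K" using K[of 0] T by force
  then have M: "0 \<le> M" by (simp add: M_def sum_nonneg)
  have "\<exists>L\<ge>0. \<forall>a b. \<bar>cutoff n M a * G a i - cutoff n M b * G b i\<bar> \<le> L * (\<Sum>j<n. \<bar>a j - b j\<bar>)"
    if "i < n" for i
    by (rule cutoff_mult_lipschitz[OF lip[OF that] M])
  then obtain L where L: "\<And>i. i < n \<Longrightarrow> 0 \<le> L i"
    "\<And>i a b. i < n \<Longrightarrow> \<bar>cutoff n M a * G a i - cutoff n M b * G b i\<bar> \<le> L i * (\<Sum>j<n. \<bar>a j - b j\<bar>)"
    by metis
  define H where "H t a i = F t i - cutoff n M a * G a i" for t a i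
  have "\<exists>x. \<forall>i<n. x 0 i = c i \<and>
           (\<forall>t\<in>{0..T}. ((\<lambda>s. x s i) has_real_derivative H t (x t) i) (at t within {0..T}))"
  proof (rule picard_global_lipschitz[OF T])
    fix t a b i assume i: "i < n"
    have "\<bar>H t a i - H t b i\<bar> = \<bar>cutoff n M a * G a i - cutoff n M b * G b i\<bar>"
      by (simp add: H_def abs_minus_commute)
    also have "\<dots> \<le> L i * (\<Sum>j<n. \<bar>a j - b j\<bar>)" by (rule L(2)[OF i])
    also have "\<dots> \<le> (\<Sum>i<n. L i) * (\<Sum>j<n. \<bar>a j - b j\<bar>)"
      using L(1) i by (intro mult_right_mono member_le_sum) (auto simp: sum_nonneg)
    finally show "\<bar>H t a i - H t b i\<bar> \<le> (\<Sum>i<n. L i) * (\<Sum>j<n. \<bar>a j - b j\<bar>)" .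
  next
    fix a i assume "i < n"
    then show "continuous_on {0..T} (\<lambda>t. H t a i)"
      unfolding H_def using F by (intro continuous_intros) auto
  qed
  then obtain x where x0: "\<And>i. i < n \<Longrightarrow> x 0 i = c i"
    and x: "\<And>i t. i < n \<Longrightarrow> t \<in> {0..T} \<Longrightarrow>
      ((\<lambda>s. x s i) has_real_derivative H t (x t) i) (at t within {0..T})"
    by blast
  have bound: "(\<Sum>i<n. \<bar>x t i\<bar>) \<le> M" if t: "t \<in> {0..T}" for t
  proof -
    \<comment> \<open>The constant \<open>K\<close> absorbs the source: \<open>2 * x * F\<close> is at most \<open>x\<^sup>2 + F\<^sup>2\<close>, so \<open>E' \<le> E\<close>.\<close>
    define E where "E s = (\<Sum>i<n. (x s i)\<^sup>2) + K" for s
    have "E t \<le> E 0 * exp (1 * t)"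
    proof (rule gronwall[OF _ _ t])
      fix s assume s: "s \<in> {0..T}"
      show "(E has_real_derivative (\<Sum>i<n. 2 * x s i * H s (x s) i)) (at s within {0..T})"
        unfolding E_def using x s
        by (auto intro!: derivative_eq_intros simp: power2_eq_square algebra_simps)
      have "(\<Sum>i<n. 2 * x s i * H s (x s) i)
          = (\<Sum>i<n. 2 * x s i * F s i) - 2 * cutoff n M (x s) * (\<Sum>i<n. x s i * G (x s) i)"
        by (simp add: H_def algebra_simps sum_subtractf sum_distrib_left)
      also have "\<dots> \<le> (\<Sum>i<n. 2 * x s i * F s i)"
        using diss[of "x s"] by (simp add: cutoff_def)
      also have "\<dots> \<le> (\<Sum>i<n. (x s i)\<^sup>2 + (F s i)\<^sup>2)"
        by (intro sum_mono) (rule sum_squares_bound)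
      also have "\<dots> \<le> 1 * E s"
        using K[OF s] by (simp add: E_def sum.distrib)
      finally show "(\<Sum>i<n. 2 * x s i * H s (x s) i) \<le> 1 * E s" .
    qed
    also have "\<dots> \<le> E 0 * exp T"
      using t \<open>0 \<le> K\<close> by (intro mult_left_mono) (auto simp: E_def sum_nonneg)
    also have "\<dots> = M - n" using x0 by (simp add: E_def M_def)
    finally have "(\<Sum>i<n. (x t i)\<^sup>2) \<le> M - n" using \<open>0 \<le> K\<close> by (simp add: E_def)
    moreover have "(\<Sum>i<n. \<bar>x t i\<bar>) \<le> (\<Sum>i<n. 1 + (x t i)\<^sup>2)"
    proof (rule sum_mono)
      fix i
      show "\<bar>x t i\<bar> \<le> 1 + (x t i)\<^sup>2"
        using sum_squares_bound[of "\<bar>x t i\<bar>" 1] by simp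
    qed
    ultimately show ?thesis by (simp add: sum.distrib)
  qed
  have "cutoff n M (x t) = 1" if "t \<in> {0..T}" for t
    using bound[OF that] by (simp add: cutoff_def)
  then have "ode_solution n T F G x"
    using x by (simp add: ode_solution_def H_def)
  then show ?thesis using x0 by blast
qed

text \<open>
  Both solutions are bounded on the compact interval, hence \<open>G\<close> is Lipschitz along them, and the
  squared distance satisfies the hypothesis of Gronwall's inequality with initial value 0.
\<close>
lemma ode_unique:
  assumes T: "0 < T"
    and lip: "\<And>i. i < n \<Longrightarrow> locally_lipschitz n (\<lambda>a. G a i)"
    and x: "ode_solution n T F G x" and y: "ode_solution n T F G y"
    and init: "\<And>i. i < n \<Longrightarrow> x 0 i = y 0 i"
    and t: "t \<in> {0..T}" and i: "i < n"
  shows "x t i = y t i"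
proof -
  have bnd: "\<exists>M. \<forall>t\<in>{0..T}. (\<Sum>i<n. \<bar>z t i\<bar>) \<le> M" if "ode_solution n T F G z" for z
  proof -
    have "continuous_on {0..T} (\<lambda>t. z t i)" if "i < n" for i
      using \<open>ode_solution n T F G z\<close> that
      by (intro DERIV_continuous_on[where D = "\<lambda>t. F t i - G (z t) i"]) (auto simp: ode_solution_def)
    then have "continuous_on {0..T} (\<lambda>t. \<Sum>i<n. \<bar>z t i\<bar>)" by (intro continuous_intros) auto
    then have "bounded ((\<lambda>t. \<Sum>i<n. \<bar>z t i\<bar>) ` {0..T})"
      by (intro compact_imp_bounded compact_continuous_image) auto
    then obtain B where "\<And>t. t \<in> {0..T} \<Longrightarrow> \<bar>\<Sum>i<n. \<bar>z t i\<bar>\<bar> \<le> B"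
      unfolding bounded_iff by fastforce
    then show ?thesis by (meson abs_le_D1)
  qed
  obtain Mx My where Mx: "\<And>t. t \<in> {0..T} \<Longrightarrow> (\<Sum>i<n. \<bar>x t i\<bar>) \<le> Mx"
    and My: "\<And>t. t \<in> {0..T} \<Longrightarrow> (\<Sum>i<n. \<bar>y t i\<bar>) \<le> My"
    using bnd[OF x] bnd[OF y] by blast
  define M where "M = max 0 (max Mx My)"
  have M: "0 \<le> M" "\<And>t. t \<in> {0..T} \<Longrightarrow> (\<Sum>i<n. \<bar>x t i\<bar>) \<le> M"
    "\<And>t. t \<in> {0..T} \<Longrightarrow> (\<Sum>i<n. \<bar>y t i\<bar>) \<le> M"
    using Mx My by (auto simp: M_def le_max_iff_disj)
  have "\<exists>L. lipschitz_on_ball n M L (\<lambda>a. G a i)" if "i < n" for i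
    using locally_lipschitzD[OF lip[OF that] M(1)] .
  then obtain L where L: "\<And>i. i < n \<Longrightarrow> lipschitz_on_ball n M (L i) (\<lambda>a. G a i)" by metis
  define E where "E s = (\<Sum>i<n. (x s i - y s i)\<^sup>2)" for s
  define C where "C = (\<Sum>i<n. 2 * L i) * n"
  have "E t \<le> E 0 * exp (C * t)"
  proof (rule gronwall[OF _ _ t])
    fix s assume s: "s \<in> {0..T}"
    show "(E has_real_derivative (\<Sum>i<n. 2 * (x s i - y s i) * (G (y s) i - G (x s) i)))
        (at s within {0..T})"
      unfolding E_def
    proof (rule DERIV_sum)
      fix i assume "i \<in> {..<n}"
      then have "((\<lambda>s. x s i - y s i) has_real_derivative
          (F s i - G (x s) i) - (F s i - G (y s) i)) (at s within {0..T})"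
        using x y s by (intro DERIV_diff) (auto simp: ode_solution_def)
      from DERIV_power[OF this, of 2]
      show "((\<lambda>s. (x s i - y s i)\<^sup>2) has_real_derivative
          2 * (x s i - y s i) * (G (y s) i - G (x s) i)) (at s within {0..T})"
        by (simp add: algebra_simps)
    qed
    define D where "D = (\<Sum>i<n. \<bar>x s i - y s i\<bar>)"
    have D: "0 \<le> D" by (simp add: D_def sum_nonneg)
    have "2 * (x s i - y s i) * (G (y s) i - G (x s) i) \<le> 2 * L i * D\<^sup>2" if i: "i < n" for i
    proof -
      have "\<bar>G (x s) i - G (y s) i\<bar> \<le> L i * D"
        using lipschitz_on_ballD(2)[OF L[OF i] M(2)[OF s] M(3)[OF s]] by (simp add: D_def)
      moreover have "\<bar>x s i - y s i\<bar> \<le> D"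
        unfolding D_def using member_le_sum[of i "{..<n}" "\<lambda>i. \<bar>x s i - y s i\<bar>"] i by simp
      ultimately have "\<bar>x s i - y s i\<bar> * \<bar>G (x s) i - G (y s) i\<bar> \<le> D * (L i * D)"
        using D by (intro mult_mono) auto
      moreover have "(x s i - y s i) * (G (y s) i - G (x s) i)
          \<le> \<bar>x s i - y s i\<bar> * \<bar>G (x s) i - G (y s) i\<bar>"
        by (metis abs_ge_self abs_minus_commute abs_mult)
      ultimately have "(x s i - y s i) * (G (y s) i - G (x s) i) \<le> D * (L i * D)" by simp
      then have "2 * ((x s i - y s i) * (G (y s) i - G (x s) i)) \<le> 2 * (D * (L i * D))" by simp
      then show ?thesis by (simp only: power2_eq_square mult_ac)
    qed
    then have "(\<Sum>i<n. 2 * (x s i - y s i) * (G (y s) i - G (x s) i)) \<le> (\<Sum>i<n. 2 * L i * D\<^sup>2)"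
      by (intro sum_mono) auto
    also have "\<dots> = (\<Sum>i<n. 2 * L i) * D\<^sup>2" by (simp add: sum_distrib_right)
    also have "\<dots> \<le> (\<Sum>i<n. 2 * L i) * (n * E s)"
    proof (rule mult_left_mono)
      have "D\<^sup>2 \<le> (\<Sum>i<n. (1::real)\<^sup>2) * (\<Sum>i<n. \<bar>x s i - y s i\<bar>\<^sup>2)"
        unfolding D_def using Cauchy_Schwarz_ineq_sum[of "\<lambda>_. 1" "\<lambda>i. \<bar>x s i - y s i\<bar>" "{..<n}"] by simp
      then show "D\<^sup>2 \<le> n * E s" by (simp add: E_def)
      show "0 \<le> (\<Sum>i<n. 2 * L i)" using L lipschitz_on_ballD(1) by (intro sum_nonneg) fastforce
    qed
    finally show "(\<Sum>i<n. 2 * (x s i - y s i) * (G (y s) i - G (x s) i)) \<le> C * E s"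
      by (simp add: C_def)
  qed
  also have "\<dots> = 0" using init by (simp add: E_def)
  finally have "E t = 0" by (simp add: E_def sum_nonneg antisym)
  then show ?thesis using i by (auto simp: E_def sum_nonneg_eq_0_iff)
qed

section \<open>An evolution problem coupled to a stationary equation\<close>

text \<open>
  Vectors whose coefficients with respect to finitely many fixed vectors of \<open>S\<close> are locally Lipschitz
  functions of the unknowns.  This form is stable under evaluation of linear and bilinear maps that
  are only known to be linear on the subspace \<open>S\<close>.
\<close>
inductive lipschitz_family :: "nat \<Rightarrow> 'v::real_vector set \<Rightarrow> ((nat \<Rightarrow> real) \<Rightarrow> 'v) \<Rightarrow> bool"
  for n S where
  zero: "lipschitz_family n S (\<lambda>_. 0)"
| add: "lipschitz_family n S z \<Longrightarrow> locally_lipschitz n c \<Longrightarrow> s \<in> S \<Longrightarrow>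
    lipschitz_family n S (\<lambda>a. z a + c a *\<^sub>R s)"

lemma lipschitz_family_add_sum:
  fixes k :: nat
  assumes z: "lipschitz_family n S z"
    and "\<And>i. i < k \<Longrightarrow> locally_lipschitz n (c i)" "\<And>i. i < k \<Longrightarrow> s i \<in> S"
  shows "lipschitz_family n S (\<lambda>a. z a + (\<Sum>i<k. c i a *\<^sub>R s i))"
  using assms(2,3)
proof (induction k)
  case (Suc k)
  have "lipschitz_family n S (\<lambda>a. (z a + (\<Sum>i<k. c i a *\<^sub>R s i)) + c k a *\<^sub>R s k)"
    using Suc by (intro lipschitz_family.add) auto
  then show ?case by (simp add: add.assoc)
qed (use z in simp)

lemma lipschitz_family_in:
  assumes "lipschitz_family n S z" "subspace S"
  shows "z a \<in> S"
  using assms(1) by induction (auto simp: subspace_0 subspace_add subspace_scale assms(2))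

lemma locally_lipschitz_linear:
  assumes "lipschitz_family n S z" and S: "subspace S" and f: "linear_on S f"
  shows "locally_lipschitz n (\<lambda>a. f (z a))"
  using assms(1)
proof induction
  case zero
  then show ?case by simp
next
  case (add z c s)
  have "f (z a + c a *\<^sub>R s) = f (z a) + c a * f s" for a
    using linear_onD[OF f] lipschitz_family_in[OF add(1) S] add(3) S by (simp add: subspace_scale)
  moreover have "locally_lipschitz n (\<lambda>a. f (z a) + c a * f s)"
    by (intro locally_lipschitz_add locally_lipschitz_mult add locally_lipschitz_const)
  ultimately show ?case by simp
qed

lemma locally_lipschitz_bilinear:
  assumes "lipschitz_family n S z" and y: "lipschitz_family n R y"
    and S: "subspace S" and R: "subspace R" and f: "bilinear_on S R f"
  shows "locally_lipschitz n (\<lambda>a. f (z a) (y a))"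
  using assms(1)
proof induction
  case zero
  have "f 0 (y a) = 0" for a
    using linear_on_zero[OF bilinear_onD(2)[OF f lipschitz_family_in[OF y R]] subspace_0[OF S]] .
  then show ?case by simp
next
  case (add z c s)
  have "f (z a + c a *\<^sub>R s) (y a) = f (z a) (y a) + c a * f s (y a)" for a
    using linear_onD[OF bilinear_onD(2)[OF f lipschitz_family_in[OF y R]]]
      lipschitz_family_in[OF add(1) S] add(3) S by (simp add: subspace_scale)
  moreover have "locally_lipschitz n (\<lambda>a. f (z a) (y a) + c a * f s (y a))"
    by (intro locally_lipschitz_add locally_lipschitz_mult add locally_lipschitz_linear[OF y R]
        bilinear_onD(1)[OF f])
  ultimately show ?case by simp
qed

lemma has_real_derivative_unique_Icc:
  fixes f :: "real \<Rightarrow> real"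
  assumes "0 < T" "t \<in> {0..T}"
    and "(f has_real_derivative a) (at t within {0..T})"
    and "(f has_real_derivative b) (at t within {0..T})"
  shows "a = b"
  using vector_derivative_unique_within_closed_interval[of 0 T t f a b] assms
  by (simp add: has_real_derivative_iff_has_vector_derivative)

text \<open>
  The abstract form of the scheme: find \<open>u\<close> in \<open>V\<close> and \<open>\<zeta>\<close> in \<open>W\<close> with
  \<open>m u' w + A (u, \<zeta>) (w, \<mu>) + B u (u, \<zeta>) (w, \<mu>) = F t w\<close> for all test pairs \<open>(w, \<mu>)\<close>.  Only \<open>u\<close> is
  differentiated in time.  The conditions \<open>A_pos\<close> and \<open>B_trace\<close> allow to solve for \<open>\<zeta>\<close>, the
  conditions \<open>A_nonneg\<close> and \<open>B_skew\<close> give the energy estimate.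
\<close>
locale evolution_problem =
  fixes V :: "'v::real_vector set" and W :: "'w::real_vector set"
    and m :: "'v \<Rightarrow> 'v \<Rightarrow> real"
    and A :: "'v \<times> 'w \<Rightarrow> 'v \<times> 'w \<Rightarrow> real"
    and B :: "'v \<Rightarrow> 'v \<times> 'w \<Rightarrow> 'v \<times> 'w \<Rightarrow> real"
    and F :: "real \<Rightarrow> 'v \<Rightarrow> real" and T :: real
  assumes T_pos: "0 < T"
    and findim_V: "findim V" and findim_W: "findim W"
    and inner_m: "inner_product_on V m"
    and bilinear_A: "bilinear_on (V \<times> W) (V \<times> W) A"
    and A_sym: "\<And>y z. y \<in> V \<times> W \<Longrightarrow> z \<in> V \<times> W \<Longrightarrow> A y z = A z y"
    and A_nonneg: "\<And>z. z \<in> V \<times> W \<Longrightarrow> 0 \<le> A z z"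
    and A_pos: "\<And>\<mu>. \<mu> \<in> W \<Longrightarrow> \<mu> \<noteq> 0 \<Longrightarrow> 0 < A (0, \<mu>) (0, \<mu>)"
    and bilinear_B: "\<And>v. v \<in> V \<Longrightarrow> bilinear_on (V \<times> W) (V \<times> W) (B v)"
    and linear_B: "\<And>y z. y \<in> V \<times> W \<Longrightarrow> z \<in> V \<times> W \<Longrightarrow> linear_on V (\<lambda>v. B v y z)"
    and B_skew: "\<And>v z. v \<in> V \<Longrightarrow> z \<in> V \<times> W \<Longrightarrow> B v z z = 0"
    and B_trace: "\<And>v \<zeta> \<mu>. v \<in> V \<Longrightarrow> \<zeta> \<in> W \<Longrightarrow> \<mu> \<in> W \<Longrightarrow> B v (0, \<zeta>) (0, \<mu>) = 0"
    and linear_F: "\<And>t. t \<in> {0..T} \<Longrightarrow> linear_on V (F t)"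
    and cont_F: "\<And>w. w \<in> V \<Longrightarrow> continuous_on {0..T} (\<lambda>t. F t w)"
begin

definition solution :: "(real \<Rightarrow> 'v) \<Rightarrow> (real \<Rightarrow> 'w) \<Rightarrow> bool" where
  "solution u \<zeta> \<longleftrightarrow> (\<forall>t\<in>{0..T}. u t \<in> V \<and> \<zeta> t \<in> W \<and> (\<forall>w\<in>V. \<forall>\<mu>\<in>W.
     ((\<lambda>s. m (u s) w) has_real_derivative
        F t w - A (u t, \<zeta> t) (w, \<mu>) - B (u t) (u t, \<zeta> t) (w, \<mu>)) (at t within {0..T})))"

lemma subspaces: "subspace V" "subspace W" "subspace (V \<times> W)"
  using findim_V findim_W by (auto simp: findim_def intro: subspace_Times)

lemma zeros: "0 \<in> V" "0 \<in> W"
  using subspaces subspace_0 by blast+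

lemma inner_trace: "inner_product_on W (\<lambda>\<zeta> \<mu>. A (0, \<zeta>) (0, \<mu>))"
proof -
  have emb: "linear_on W (\<lambda>\<mu>. f (0, \<mu>))" if "linear_on (V \<times> W) f" for f :: "'v \<times> 'w \<Rightarrow> real"
    using linear_onD(1)[OF that, of "(0, _)" "(0, _)"] linear_onD(2)[OF that, of "(0, _)"] zeros
    by (intro linear_onI) auto
  show ?thesis
    unfolding inner_product_on_def
    using emb[OF bilinear_onD(1)[OF bilinear_A]] emb[OF bilinear_onD(2)[OF bilinear_A]]
      A_sym A_pos zeros by (auto intro!: bilinear_onI)
qed

definition load :: "'v \<Rightarrow> 'w \<Rightarrow> real" where
  "load u \<mu> = - (A (u, 0) (0, \<mu>) + B u (u, 0) (0, \<mu>))"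

text \<open>
  The second unknown as a function of the first: the solution of the stationary equation.
\<close>
definition trace_of :: "'v \<Rightarrow> 'w" where
  "trace_of u = (THE \<zeta>. \<zeta> \<in> W \<and> (\<forall>\<mu>\<in>W. A (0, \<zeta>) (0, \<mu>) = load u \<mu>))"

lemma linear_load: "u \<in> V \<Longrightarrow> linear_on W (load u)"
proof (rule linear_onI)
  assume u: "u \<in> V"
  note lA = linear_onD[OF bilinear_onD(1)[OF bilinear_A, of "(u, 0)"]]
  note lB = linear_onD[OF bilinear_onD(1)[OF bilinear_B[OF u], of "(u, 0)"]]
  show "load u (\<mu> + \<mu>') = load u \<mu> + load u \<mu>'" if "\<mu> \<in> W" "\<mu>' \<in> W" for \<mu> \<mu>'
    using lA(1)[of "(0, \<mu>)" "(0, \<mu>')"] lB(1)[of "(0, \<mu>)" "(0, \<mu>')"] u that zeros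
    by (simp add: load_def)
  show "load u (c *\<^sub>R \<mu>) = c *\<^sub>R load u \<mu>" if "\<mu> \<in> W" for c \<mu>
    using lA(2)[of "(0, \<mu>)" c] lB(2)[of "(0, \<mu>)" c] u that zeros
    by (simp add: load_def algebra_simps)
qed

lemma trace_of_ex1: "u \<in> V \<Longrightarrow> \<exists>!\<zeta>. \<zeta> \<in> W \<and> (\<forall>\<mu>\<in>W. A (0, \<zeta>) (0, \<mu>) = load u \<mu>)"
  by (rule riesz_representation[OF findim_W inner_trace linear_load])

lemma trace_of:
  assumes "u \<in> V"
  shows "trace_of u \<in> W" and "\<mu> \<in> W \<Longrightarrow> A (0, trace_of u) (0, \<mu>) = load u \<mu>"
  using theI'[OF trace_of_ex1[OF assms]] by (auto simp: trace_of_def)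

text \<open>
  The left-hand side is the residual of the stationary equation in the unknown \<open>\<zeta>\<close>; coercivity
  of \<open>A\<close> on \<open>W\<close> makes it uniquely solvable.
\<close>
lemma trace_equation:
  assumes u: "u \<in> V" and \<zeta>: "\<zeta> \<in> W"
  shows "(\<forall>\<mu>\<in>W. A (u, \<zeta>) (0, \<mu>) + B u (u, \<zeta>) (0, \<mu>) = 0) \<longleftrightarrow> \<zeta> = trace_of u"
proof -
  have "A (u, \<zeta>) (0, \<mu>) + B u (u, \<zeta>) (0, \<mu>) = A (0, \<zeta>) (0, \<mu>) - load u \<mu>" if \<mu>: "\<mu> \<in> W" for \<mu>
    using linear_onD(1)[OF bilinear_onD(2)[OF bilinear_A, of "(0, \<mu>)"], of "(u, 0)" "(0, \<zeta>)"]
      linear_onD(1)[OF bilinear_onD(2)[OF bilinear_B[OF u], of "(0, \<mu>)"], of "(u, 0)" "(0, \<zeta>)"]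
      B_trace[OF u \<zeta> \<mu>] u \<zeta> \<mu> zeros by (simp add: load_def)
  then show ?thesis
    using trace_of_ex1[OF u] trace_of[OF u] \<zeta> by auto
qed

text \<open>
  The form that remains after elimination of the second unknown; its values on \<open>(u, u)\<close> are the
  dissipation.
\<close>
definition reduced :: "'v \<Rightarrow> 'v \<Rightarrow> real" where
  "reduced u w = A (u, trace_of u) (w, 0) + B u (u, trace_of u) (w, 0)"

lemma reduced_test:
  assumes u: "u \<in> V" and w: "w \<in> V" and \<mu>: "\<mu> \<in> W"
  shows "A (u, trace_of u) (w, \<mu>) + B u (u, trace_of u) (w, \<mu>) = reduced u w"
proof -
  have z: "(u, trace_of u) \<in> V \<times> W" using u trace_of(1)[OF u] by simp
  have "A (u, trace_of u) (0, \<mu>) + B u (u, trace_of u) (0, \<mu>) = 0"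
    using trace_equation[OF u trace_of(1)[OF u]] \<mu> by blast
  then show ?thesis
    using linear_onD(1)[OF bilinear_onD(1)[OF bilinear_A z], of "(w, 0)" "(0, \<mu>)"]
      linear_onD(1)[OF bilinear_onD(1)[OF bilinear_B[OF u] z], of "(w, 0)" "(0, \<mu>)"] w \<mu> zeros
    by (simp add: reduced_def)
qed

lemma reduced_dissipative: "u \<in> V \<Longrightarrow> 0 \<le> reduced u u"
  using reduced_test[of u u "trace_of u"] trace_of(1)[of u] A_nonneg[of "(u, trace_of u)"]
    B_skew[of u "(u, trace_of u)"] by simp

lemma linear_reduced: "u \<in> V \<Longrightarrow> linear_on V (reduced u)"
proof (rule linear_onI)
  assume u: "u \<in> V"
  then have z: "(u, trace_of u) \<in> V \<times> W" using trace_of(1) by simp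
  note lA = linear_onD[OF bilinear_onD(1)[OF bilinear_A z]]
  note lB = linear_onD[OF bilinear_onD(1)[OF bilinear_B[OF u] z]]
  show "reduced u (v + w) = reduced u v + reduced u w" if "v \<in> V" "w \<in> V" for v w
    using lA(1)[of "(v, 0)" "(w, 0)"] lB(1)[of "(v, 0)" "(w, 0)"] that zeros
    by (simp add: reduced_def)
  show "reduced u (c *\<^sub>R v) = c *\<^sub>R reduced u v" if "v \<in> V" for c v
    using lA(2)[of "(v, 0)" c] lB(2)[of "(v, 0)" c] that zeros
    by (simp add: reduced_def algebra_simps)
qed

text \<open>
  Comparing the equations for two test pairs with the same first component gives the stationary
  equation, and what remains is the reduced equation.
\<close>
lemma solution_iff:
  "solution u \<zeta> \<longleftrightarrow> (\<forall>t\<in>{0..T}. u t \<in> V \<and> \<zeta> t = trace_of (u t) \<and> (\<forall>w\<in>V.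
     ((\<lambda>s. m (u s) w) has_real_derivative F t w - reduced (u t) w) (at t within {0..T})))"
  (is "_ \<longleftrightarrow> ?R")
proof
  assume sol: "solution u \<zeta>"
  show ?R
  proof
    fix t assume t: "t \<in> {0..T}"
    have u: "u t \<in> V" and \<zeta>: "\<zeta> t \<in> W"
      and d: "\<And>w \<mu>. w \<in> V \<Longrightarrow> \<mu> \<in> W \<Longrightarrow> ((\<lambda>s. m (u s) w) has_real_derivative
        F t w - A (u t, \<zeta> t) (w, \<mu>) - B (u t) (u t, \<zeta> t) (w, \<mu>)) (at t within {0..T})"
      using sol t by (auto simp: solution_def)
    have z: "(u t, \<zeta> t) \<in> V \<times> W" using u \<zeta> by simp
    note A0 = linear_on_zero[OF bilinear_onD(1)[OF bilinear_A z]]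
    note B0 = linear_on_zero[OF bilinear_onD(1)[OF bilinear_B[OF u] z]]
    \<comment> \<open>Both \<open>\<mu>\<close> and \<open>0\<close> give the same derivative of \<open>m (u s) 0\<close>.\<close>
    have "A (u t, \<zeta> t) (0, \<mu>) + B (u t) (u t, \<zeta> t) (0, \<mu>) = 0" if "\<mu> \<in> W" for \<mu>
      using has_real_derivative_unique_Icc[OF T_pos t d[OF zeros(1) that] d[OF zeros]]
        A0 B0 zeros by (simp add: zero_prod_def)
    then have tr: "\<zeta> t = trace_of (u t)"
      using trace_equation[OF u \<zeta>] by blast
    have "((\<lambda>s. m (u s) w) has_real_derivative F t w - reduced (u t) w) (at t within {0..T})"
      if "w \<in> V" for w
      using d[OF that zeros(2)] reduced_test[OF u that zeros(2)] tr by (simp add: diff_diff_eq)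
    then show "u t \<in> V \<and> \<zeta> t = trace_of (u t) \<and> (\<forall>w\<in>V.
        ((\<lambda>s. m (u s) w) has_real_derivative F t w - reduced (u t) w) (at t within {0..T}))"
      using u tr by blast
  qed
next
  assume R: ?R
  then show "solution u \<zeta>"
    unfolding solution_def using trace_of(1) reduced_test by (simp add: diff_diff_eq)
qed

text \<open>
  In coordinates with respect to orthonormal bases of both spaces the problem is a dissipative
  system of ordinary differential equations.  The trace \<open>trace_of (U a)\<close> is quadratic in the
  coordinates \<open>a\<close> and the reduced form cubic; all that is used of this is local Lipschitz continuity.
\<close>
theorem unique_solution:
  assumes u0: "u0 \<in> V"
  shows "\<exists>u \<zeta>. solution u \<zeta> \<and> u 0 = u0 \<and>
    (\<forall>u' \<zeta>'. solution u' \<zeta>' \<and> u' 0 = u0 \<longrightarrow> (\<forall>t\<in>{0..T}. u' t = u t \<and> \<zeta>' t = \<zeta> t))"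
proof -
  have bil_m: "bilinear_on V V m" and sym_m: "\<And>v w. v \<in> V \<Longrightarrow> w \<in> V \<Longrightarrow> m v w = m w v"
    using inner_m by (auto simp: inner_product_on_def)
  obtain n :: nat and e where e: "\<And>i. i < n \<Longrightarrow> e i \<in> V"
    "\<And>i j. i < n \<Longrightarrow> j < n \<Longrightarrow> m (e i) (e j) = (if i = j then 1 else 0)"
    "\<And>v. v \<in> V \<Longrightarrow> v = (\<Sum>i<n. m v (e i) *\<^sub>R e i)"
    by (rule orthonormal_basis[OF findim_V inner_m]) (rule that)
  obtain p :: nat and g where g: "\<And>i. i < p \<Longrightarrow> g i \<in> W"
    "\<And>i j. i < p \<Longrightarrow> j < p \<Longrightarrow> A (0, g i) (0, g j) = (if i = j then 1 else 0)"
    "\<And>\<mu>. \<mu> \<in> W \<Longrightarrow> \<mu> = (\<Sum>i<p. A (0, \<mu>) (0, g i) *\<^sub>R g i)"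
    by (rule orthonormal_basis[OF findim_W inner_trace]) (rule that)
  define U where "U a = (\<Sum>i<n. a i *\<^sub>R e i)" for a
  define G where "G a i = reduced (U a) (e i)" for a i
  have UV: "U a \<in> V" for a
    unfolding U_def using e(1) subspaces(1) by (auto intro!: subspace_sum subspace_scale)
  have coord_U: "m (U a) (e i) = a i" if "i < n" for a i
  proof -
    have "m (U a) (e i) = (\<Sum>j<n. a j *\<^sub>R m (e j) (e i))"
      unfolding U_def
      using linear_on_sum[OF bilinear_onD(2)[OF bil_m e(1)[OF that]] subspaces(1), of "{..<n}" e] e(1)
      by auto
    also have "\<dots> = (\<Sum>j<n. if j = i then a j else 0)"
      using e(2) that by (intro sum.cong) auto
    finally show ?thesis using that by simp
  qed
  have U_coord: "U (\<lambda>i. m v (e i)) = v" if "v \<in> V" for v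
    using e(3)[OF that] by (simp add: U_def)
  have U_cong: "U a = U b" if "\<And>i. i < n \<Longrightarrow> a i = b i" for a b
    unfolding U_def using that by (intro sum.cong) auto
  have lip: "locally_lipschitz n (\<lambda>a. G a i)" if i: "i < n" for i
  proof -
    have lf_U: "lipschitz_family n V U"
      using lipschitz_family_add_sum[OF lipschitz_family.zero, of n n "\<lambda>i a. a i" e]
        locally_lipschitz_coord e(1) by (simp add: U_def[abs_def])
    have lf_U0: "lipschitz_family n (V \<times> W) (\<lambda>a. (U a, 0))"
    proof -
      have U0: "(U a, 0) = 0 + (\<Sum>i<n. a i *\<^sub>R (e i, 0))" for a
        by (simp add: U_def prod_eq_iff fst_sum snd_sum)
      show ?thesis
        unfolding U0
        by (rule lipschitz_family_add_sum[OF lipschitz_family.zero])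
           (use locally_lipschitz_coord e(1) zeros in auto)
    qed
    have bil_test: "bilinear_on V (V \<times> W) (\<lambda>v z. B v z y)" if "y \<in> V \<times> W" for y
      using bilinear_onD(2)[OF bilinear_B that] linear_B that by (intro bilinear_onI) auto
    have ll: "locally_lipschitz n (\<lambda>a. A (z a) y + B (U a) (z a) y)"
      if "lipschitz_family n (V \<times> W) z" "y \<in> V \<times> W" for z y
      using locally_lipschitz_linear[OF that(1) subspaces(3) bilinear_onD(2)[OF bilinear_A that(2)]]
        locally_lipschitz_bilinear[OF lf_U that(1) subspaces(1,3) bil_test[OF that(2)]]
      by (rule locally_lipschitz_add)
    have ll_load: "locally_lipschitz n (\<lambda>a. load (U a) (g i))" if "i < p" for i
      using locally_lipschitz_mult[OF locally_lipschitz_const[of n "-1"] ll[OF lf_U0, of "(0, g i)"]]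
        g(1)[OF that] zeros by (simp add: load_def)
    have Z: "(U a, trace_of (U a)) = (U a, 0) + (\<Sum>i<p. load (U a) (g i) *\<^sub>R (0, g i))" for a
    proof -
      have "trace_of (U a) = (\<Sum>i<p. A (0, trace_of (U a)) (0, g i) *\<^sub>R g i)"
        by (rule g(3)[OF trace_of(1)[OF UV]])
      also have "\<dots> = (\<Sum>i<p. load (U a) (g i) *\<^sub>R g i)"
        using trace_of(2)[OF UV] g(1) by (intro sum.cong) auto
      finally show ?thesis by (simp add: prod_eq_iff fst_sum snd_sum)
    qed
    have lf_Z: "lipschitz_family n (V \<times> W) (\<lambda>a. (U a, trace_of (U a)))"
      unfolding Z by (rule lipschitz_family_add_sum[OF lf_U0]) (use ll_load g(1) zeros in auto)
    show ?thesis
      using ll[OF lf_Z, of "(e i, 0)"] e(1)[OF i] zeros by (simp add: G_def reduced_def)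
  qed
  have G_U: "(\<Sum>i<n. a i * G b i) = reduced (U b) (U a)" for a b
    unfolding G_def U_def[of a]
    using linear_on_sum[OF linear_reduced[OF UV[of b]] subspaces(1), of "{..<n}" e] e(1) by simp
  have "\<exists>x. (\<forall>i<n. x 0 i = m u0 (e i)) \<and> ode_solution n T (\<lambda>t i. F t (e i)) G x"
  proof (rule dissipative_ode_exists[OF T_pos lip])
    show "0 \<le> (\<Sum>i<n. a i * G a i)" for a
      using G_U[of a a] reduced_dissipative[OF UV[of a]] by simp
    show "continuous_on {0..T} (\<lambda>t. F t (e i))" if "i < n" for i
      by (rule cont_F[OF e(1)[OF that]])
  qed
  then obtain x where x0: "\<And>i. i < n \<Longrightarrow> x 0 i = m u0 (e i)"
    and x: "ode_solution n T (\<lambda>t i. F t (e i)) G x" by blast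
  have "solution (\<lambda>t. U (x t)) (\<lambda>t. trace_of (U (x t)))"
    unfolding solution_iff
  proof (intro ballI conjI UV refl)
    fix t w assume t: "t \<in> {0..T}" and w: "w \<in> V"
    have "m (U a) w = (\<Sum>i<n. a i * m w (e i))" for a
    proof -
      have "m (U a) w = (\<Sum>i<n. a i *\<^sub>R m (e i) w)"
        unfolding U_def
        using linear_on_sum[OF bilinear_onD(2)[OF bil_m w] subspaces(1), of "{..<n}" e] e(1) by auto
      then show ?thesis using sym_m e(1) w by (auto intro!: sum.cong)
    qed
    moreover have "((\<lambda>s. \<Sum>i<n. x s i * m w (e i)) has_real_derivative
        (\<Sum>i<n. (F t (e i) - G (x t) i) * m w (e i))) (at t within {0..T})"
      using x t by (intro DERIV_sum DERIV_cmult_right) (auto simp: ode_solution_def)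
    moreover have "(\<Sum>i<n. (F t (e i) - G (x t) i) * m w (e i)) = F t w - reduced (U (x t)) w"
    proof -
      have "F t w = (\<Sum>i<n. m w (e i) * F t (e i))"
        by (subst e(3)[OF w]) (use linear_on_sum[OF linear_F[OF t] subspaces(1), of "{..<n}" e] e(1) in simp)
      moreover have "reduced (U (x t)) w = (\<Sum>i<n. m w (e i) * G (x t) i)"
        using G_U[of "\<lambda>i. m w (e i)" "x t"] U_coord[OF w] by simp
      ultimately show ?thesis by (simp add: algebra_simps sum_subtractf)
    qed
    ultimately show "((\<lambda>s. m (U (x s)) w) has_real_derivative F t w - reduced (U (x t)) w)
        (at t within {0..T})" by simp
  qed
  moreover have "U (x 0) = u0"
    using U_cong[of "x 0" "\<lambda>i. m u0 (e i)"] x0 U_coord[OF u0] by simp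
  moreover have "u' t = U (x t) \<and> \<zeta>' t = trace_of (U (x t))"
    if sol: "solution u' \<zeta>'" and init: "u' 0 = u0" and t: "t \<in> {0..T}" for u' \<zeta>' t
  proof -
    have s: "u' s \<in> V" "\<zeta>' s = trace_of (u' s)"
      "\<And>w. w \<in> V \<Longrightarrow> ((\<lambda>r. m (u' r) w) has_real_derivative F s w - reduced (u' s) w) (at s within {0..T})"
      if "s \<in> {0..T}" for s
      using sol that unfolding solution_iff by auto
    have "ode_solution n T (\<lambda>t i. F t (e i)) G (\<lambda>t i. m (u' t) (e i))"
      unfolding ode_solution_def G_def using s e(1) U_coord by simp
    then have "m (u' t) (e i) = x t i" if "i < n" for i
      using ode_unique[OF T_pos lip _ x _ t that] init x0 by simp
    then have "U (\<lambda>i. m (u' t) (e i)) = U (x t)"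
      by (rule U_cong)
    then show ?thesis using s[OF t] U_coord by simp
  qed
  ultimately show ?thesis by blast
qed

end

section \<open>Bounded fields on cells and faces\<close>

text \<open>
  The value of the function outside of \<open>D\<close> is irrelevant, so that traces, gradients and normals
  qualify although they have no meaning there.
\<close>
definition bounded_borel :: "(real^'d) set \<Rightarrow> (real^'d \<Rightarrow> 'b::euclidean_space) \<Rightarrow> bool" where
  "bounded_borel D f \<longleftrightarrow>
     (\<lambda>x. indicator D x *\<^sub>R f x) \<in> borel_measurable borel \<and> (\<exists>C. \<forall>x\<in>D. norm (f x) \<le> C)"

lemma bounded_borel_cong: "(\<And>x. x \<in> D \<Longrightarrow> f x = g x) \<Longrightarrow> bounded_borel D f \<longleftrightarrow> bounded_borel D g"
proof -
  assume fg: "\<And>x. x \<in> D \<Longrightarrow> f x = g x"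
  then have "(\<lambda>x. indicator D x *\<^sub>R f x) = (\<lambda>x. indicator D x *\<^sub>R g x)"
    by (intro ext) (use fg in \<open>auto simp: indicator_def\<close>)
  with fg show ?thesis unfolding bounded_borel_def by auto
qed

lemma bounded_borel_add:
  assumes "bounded_borel D f" "bounded_borel D g"
  shows "bounded_borel D (\<lambda>x. f x + g x)"
proof -
  obtain C1 C2 where "\<forall>x\<in>D. norm (f x) \<le> C1" "\<forall>x\<in>D. norm (g x) \<le> C2"
    using assms by (auto simp: bounded_borel_def)
  then have "\<forall>x\<in>D. norm (f x + g x) \<le> C1 + C2"
    by (auto intro: norm_triangle_mono)
  then show ?thesis
    using assms by (auto simp: bounded_borel_def scaleR_add_right)
qed

lemma bounded_borel_scaleR:
  assumes "bounded_borel D c" "bounded_borel D f"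
  shows "bounded_borel D (\<lambda>x. c x *\<^sub>R f x)"
proof -
  obtain C1 C2 where C: "\<forall>x\<in>D. norm (c x) \<le> C1" "\<forall>x\<in>D. norm (f x) \<le> C2"
    using assms by (auto simp: bounded_borel_def)
  then have "\<forall>x\<in>D. norm (c x *\<^sub>R f x) \<le> \<bar>C1\<bar> * \<bar>C2\<bar>"
    by (fastforce intro!: mult_mono)
  moreover have "(\<lambda>x. indicator D x *\<^sub>R (c x *\<^sub>R f x))
      = (\<lambda>x. (indicator D x *\<^sub>R c x) *\<^sub>R (indicator D x *\<^sub>R f x))"
    by (auto simp: indicator_def)
  moreover have "(\<lambda>x. (indicator D x *\<^sub>R c x) *\<^sub>R (indicator D x *\<^sub>R f x)) \<in> borel_measurable borel"
    by (rule borel_measurable_scaleR) (use assms in \<open>simp_all only: bounded_borel_def\<close>)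
  ultimately show ?thesis
    unfolding bounded_borel_def by auto
qed

lemma bounded_borel_mult:
  fixes f g :: "real^'d \<Rightarrow> real"
  shows "bounded_borel D f \<Longrightarrow> bounded_borel D g \<Longrightarrow> bounded_borel D (\<lambda>x. f x * g x)"
  using bounded_borel_scaleR[of D f g] by simp

lemma bounded_borel_inner:
  assumes "bounded_borel D f" "bounded_borel D g"
  shows "bounded_borel D (\<lambda>x. f x \<bullet> g x)"
proof -
  obtain C1 C2 where C: "\<forall>x\<in>D. norm (f x) \<le> C1" "\<forall>x\<in>D. norm (g x) \<le> C2"
    using assms by (auto simp: bounded_borel_def)
  have "norm (f x \<bullet> g x) \<le> \<bar>C1\<bar> * \<bar>C2\<bar>" if x: "x \<in> D" for x
  proof -
    have "norm (f x \<bullet> g x) \<le> norm (f x) * norm (g x)" by (simp add: Cauchy_Schwarz_ineq2)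
    also have "\<dots> \<le> \<bar>C1\<bar> * \<bar>C2\<bar>" using C x by (intro mult_mono) force+
    finally show ?thesis .
  qed
  moreover have "(\<lambda>x. indicator D x *\<^sub>R (f x \<bullet> g x))
      = (\<lambda>x. (indicator D x *\<^sub>R f x) \<bullet> (indicator D x *\<^sub>R g x))"
    by (auto simp: indicator_def)
  moreover have "(\<lambda>x. (indicator D x *\<^sub>R f x) \<bullet> (indicator D x *\<^sub>R g x)) \<in> borel_measurable borel"
    using assms unfolding bounded_borel_def by (intro borel_measurable_inner) auto
  ultimately show ?thesis
    unfolding bounded_borel_def by auto
qed

lemma bounded_borel_const:
  assumes "D \<in> sets borel"
  shows "bounded_borel D (\<lambda>_. c)"
  using assms by (auto simp: bounded_borel_def)

lemma bounded_borel_continuous: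
  assumes "continuous_on UNIV f" "D \<in> sets borel" "bounded D"
  shows "bounded_borel D f"
proof -
  have "bounded (f ` closure D)"
    using assms by (intro compact_imp_bounded compact_continuous_image)
      (auto intro: continuous_on_subset simp: compact_closure)
  then have "\<exists>C. \<forall>x\<in>D. norm (f x) \<le> C"
    unfolding bounded_iff using closure_subset[of D] by blast
  then show ?thesis
    using assms by (auto simp: bounded_borel_def intro!: borel_measurable_continuous_on_indicator
        intro: continuous_on_subset)
qed

lemma bounded_borel_sum:
  assumes "\<And>i. i \<in> I \<Longrightarrow> bounded_borel D (f i)" "D \<in> sets borel"
  shows "bounded_borel D (\<lambda>x. \<Sum>i\<in>I. f i x)"
  using assms(1)
proof (induction I rule: infinite_finite_induct)
  case (insert i I)
  have "bounded_borel D (\<lambda>x. f i x + (\<Sum>i\<in>I. f i x))"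
    by (rule bounded_borel_add) (use insert in auto)
  then show ?case using insert by simp
qed (simp_all add: bounded_borel_const assms(2))

lemma bounded_borel_vec_lambda:
  fixes f :: "'d \<Rightarrow> real^'d \<Rightarrow> real"
  assumes "\<And>i. bounded_borel D (f i)" "D \<in> sets borel"
  shows "bounded_borel D (\<lambda>x. \<chi> i. f i x)"
proof -
  have "(\<chi> i. f i x) = (\<Sum>i\<in>UNIV. f i x *\<^sub>R axis i 1)" for x
    by (simp add: vec_eq_iff axis_def if_distrib cong: if_cong)
  moreover have "bounded_borel D (\<lambda>x. \<Sum>i\<in>UNIV. f i x *\<^sub>R axis i (1::real))"
    using assms by (intro bounded_borel_sum bounded_borel_scaleR bounded_borel_const)
  ultimately show ?thesis by simp
qed

text \<open>
  What cells with Lebesgue measure and faces with surface measure have in common: bounded Borel functions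
  are integrable, and continuous functions that vanish almost everywhere vanish everywhere.
\<close>
definition patch :: "(real^'d) measure \<Rightarrow> (real^'d) set \<Rightarrow> bool" where
  "patch M D \<longleftrightarrow> space M = UNIV \<and> sets borel \<subseteq> sets M \<and> D \<in> sets borel \<and> bounded D \<and>
     emeasure M D < \<infinity> \<and> (\<forall>U. open U \<longrightarrow> U \<inter> D \<noteq> {} \<longrightarrow> emeasure M (U \<inter> D) \<noteq> 0)"

lemma patchD:
  assumes "patch M D"
  shows "space M = UNIV" "sets borel \<subseteq> sets M" "D \<in> sets borel" "D \<in> sets M" "bounded D"
    "emeasure M D < \<infinity>" "\<And>U. open U \<Longrightarrow> U \<inter> D \<noteq> {} \<Longrightarrow> emeasure M (U \<inter> D) \<noteq> 0"
  using assms by (auto simp: patch_def)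

lemma bounded_borel_measurable:
  assumes "patch M D" "bounded_borel D f"
  shows "(\<lambda>x. indicator D x *\<^sub>R f x) \<in> borel_measurable M"
  using patchD(1,2)[OF assms(1)] assms(2)
  by (intro borel_measurable_subalgebra[of borel M]) (auto simp: bounded_borel_def)

lemma bounded_borel_set_integrable:
  assumes "patch M D" "bounded_borel D f"
  shows "set_integrable M D f"
proof -
  obtain C where C: "\<forall>x\<in>D. norm (f x) \<le> C" using assms(2) by (auto simp: bounded_borel_def)
  show ?thesis
    unfolding set_integrable_def
    by (rule integrableI_bounded_set[OF patchD(4)[OF assms(1)] bounded_borel_measurable[OF assms]
          patchD(6)[OF assms(1)], of C]) (use C in auto)
qed

lemma set_integrable_mult_bounded_borel:
  fixes f w :: "real^'d \<Rightarrow> real"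
  assumes "patch M D" "set_integrable M D f" "bounded_borel D w"
  shows "set_integrable M D (\<lambda>x. f x * w x)"
proof -
  obtain C where C: "\<forall>x\<in>D. norm (w x) \<le> C" using assms(3) by (auto simp: bounded_borel_def)
  have "(\<lambda>x. (indicator D x *\<^sub>R f x) * (indicator D x *\<^sub>R w x)) \<in> borel_measurable M"
    using assms(2) bounded_borel_measurable[OF assms(1,3)]
    unfolding set_integrable_def by (intro borel_measurable_times) auto
  then have meas: "set_borel_measurable M D (\<lambda>x. f x * w x)"
    unfolding set_borel_measurable_def
    by (rule subst[of _ _ "\<lambda>h. h \<in> borel_measurable M", rotated]) (auto simp: indicator_def)
  have "set_integrable M D (\<lambda>x. \<bar>C\<bar> * f x)" using assms(2) by simp
  then show ?thesis
  proof (rule set_integrable_bound[OF _ meas])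
    show "AE x in M. x \<in> D \<longrightarrow> norm (f x * w x) \<le> norm (\<bar>C\<bar> * f x)"
    proof (intro AE_I2 impI)
      fix x assume "x \<in> D"
      then have "\<bar>w x\<bar> \<le> \<bar>C\<bar>" using C by force
      then have "\<bar>w x\<bar> * \<bar>f x\<bar> \<le> \<bar>C\<bar> * \<bar>f x\<bar>" by (rule mult_right_mono) simp
      then show "norm (f x * w x) \<le> norm (\<bar>C\<bar> * f x)"
        by (simp add: abs_mult mult.commute)
    qed
  qed
qed

lemma integral_square_zero_imp_zero:
  fixes v p :: "real^'d \<Rightarrow> 'b::euclidean_space"
  assumes M: "patch M D" and p: "continuous_on UNIV p" and v: "\<And>x. x \<in> D \<Longrightarrow> v x = p x"
    and int: "(LINT x:D|M. v x \<bullet> v x) = 0" and x: "x \<in> D"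
  shows "v x = 0"
proof (rule ccontr)
  assume nz: "v x \<noteq> 0"
  define h where "h y = indicator D y *\<^sub>R (p y \<bullet> p y)" for y
  have "bounded_borel D p" using patchD[OF M] p by (intro bounded_borel_continuous) auto
  then have h_int: "integrable M h"
    using bounded_borel_set_integrable[OF M bounded_borel_inner] by (simp add: set_integrable_def h_def[abs_def])
  have "(LINT y:D|M. v y \<bullet> v y) = (\<integral>y. h y \<partial>M)"
    unfolding set_lebesgue_integral_def h_def
    by (rule Bochner_Integration.integral_cong) (auto simp: indicator_def v)
  then have "integral\<^sup>L M h = 0" using int by simp
  moreover have "AE y in M. 0 \<le> h y" by (simp add: h_def)
  ultimately have ae: "AE y in M. h y = 0"
    using integral_nonneg_eq_0_iff_AE[OF h_int] by blast
  have "open (p -` (- {0}))"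
    using p open_vimage by (metis open_Compl closed_singleton)
  moreover have "x \<in> p -` (- {0}) \<inter> D" using x nz v by simp
  ultimately have "emeasure M (p -` (- {0}) \<inter> D) \<noteq> 0"
    using patchD(7)[OF M] by blast
  moreover have "p -` (- {0}) \<inter> D \<in> null_sets M"
  proof (rule AE_iff_null_sets[THEN iffD2])
    show "p -` (- {0}) \<inter> D \<in> sets M"
      using \<open>open (p -` (- {0}))\<close> patchD[OF M] by (meson borel_open sets.Int subsetD)
    show "AE y in M. y \<notin> p -` (- {0}) \<inter> D"
      using ae by eventually_elim (auto simp: h_def)
  qed
  ultimately show False by (simp add: null_sets_def)
qed

section \<open>Piecewise polynomials\<close>

lemma polynomial_deg_le_imp_real_polynomial:
  fixes p :: "real^'d \<Rightarrow> real"
  assumes "polynomial_deg_le m p"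
  shows "real_polynomial_function p"
proof -
  from assms obtain c where c: "\<And>x. p x = (\<Sum>\<alpha> | (\<Sum>i\<in>UNIV. \<alpha> i) \<le> m. c \<alpha> * (\<Prod>i\<in>UNIV. (x $ i) ^ \<alpha> i))"
    by (auto simp: polynomial_deg_le_def)
  have "real_polynomial_function (\<lambda>x::real^'d. \<Prod>i\<in>UNIV. (x $ i) ^ \<alpha> i)" for \<alpha> :: "'d \<Rightarrow> nat"
    by (intro real_polynomial_function_prod real_polynomial_function_power
        real_polynomial_function.intros(1) bounded_linear_vec_nth finite)
  then have "real_polynomial_function p"
    unfolding c[abs_def]
    by (cases "finite {\<alpha>::'d \<Rightarrow> nat. (\<Sum>i\<in>UNIV. \<alpha> i) \<le> m}")
       (auto intro!: real_polynomial_function_sum)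
  then show ?thesis .
qed

lemma real_polynomial_frechet_derivative:
  assumes "real_polynomial_function p"
  shows "\<exists>p'. real_polynomial_function p' \<and> (\<forall>x. frechet_derivative p (at x) v = p' x)"
  using assms
proof induction
  case (linear f)
  then show ?case
    by (intro exI[of _ "\<lambda>_. f v"])
       (auto simp: frechet_derivative_at[OF bounded_linear_imp_has_derivative, symmetric])
next
  case (const c)
  then show ?case by (intro exI[of _ "\<lambda>_. 0"]) auto
next
  case (add f g)
  then obtain f' g' where "real_polynomial_function f'" "\<forall>x. frechet_derivative f (at x) v = f' x"
    "real_polynomial_function g'" "\<forall>x. frechet_derivative g (at x) v = g' x" by blast
  then show ?case
    using frechet_derivative_at[OF has_derivative_add[OF
          frechet_derivative_works[THEN iffD1, OF differentiable_at_real_polynomial_function[OF add(1)]]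
          frechet_derivative_works[THEN iffD1, OF differentiable_at_real_polynomial_function[OF add(2)]]], symmetric]
    by (intro exI[of _ "\<lambda>x. f' x + g' x"]) auto
next
  case (mult f g)
  then obtain f' g' where fg: "real_polynomial_function f'" "\<forall>x. frechet_derivative f (at x) v = f' x"
    "real_polynomial_function g'" "\<forall>x. frechet_derivative g (at x) v = g' x" by blast
  have "frechet_derivative (\<lambda>x. f x * g x) (at x) v = f x * g' x + f' x * g x" for x
    using fg frechet_derivative_at[OF has_derivative_mult[OF
          frechet_derivative_works[THEN iffD1, OF differentiable_at_real_polynomial_function[OF mult(1)]]
          frechet_derivative_works[THEN iffD1, OF differentiable_at_real_polynomial_function[OF mult(2)]]], symmetric]
    by simp
  then show ?case
    using fg mult
    by (intro exI[of _ "\<lambda>x. f x * g' x + f' x * g x"]) auto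
qed

lemma real_polynomial_continuous: "real_polynomial_function p \<Longrightarrow> continuous_on S p"
  by (simp add: continuous_on_polymonial_function real_polynomial_function_eq)

lemma finite_multi_indices: "finite {\<alpha>::'d::finite \<Rightarrow> nat. (\<Sum>i\<in>UNIV. \<alpha> i) \<le> m}"
proof (rule finite_subset)
  show "{\<alpha>. (\<Sum>i\<in>UNIV. \<alpha> i) \<le> m} \<subseteq> PiE (UNIV::'d set) (\<lambda>_. {..m})"
  proof
    fix \<alpha> :: "'d \<Rightarrow> nat" assume "\<alpha> \<in> {\<alpha>. (\<Sum>i\<in>UNIV. \<alpha> i) \<le> m}"
    moreover have "\<alpha> i \<le> (\<Sum>i\<in>UNIV. \<alpha> i)" for i by (rule member_le_sum) auto
    ultimately show "\<alpha> \<in> PiE UNIV (\<lambda>_. {..m})" by (auto intro: order_trans)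
  qed
qed (simp add: finite_PiE)

lemma restrict0_linear:
  "restrict0 D (\<lambda>x. u x + v x) = restrict0 D u + restrict0 D v"
  "restrict0 D (\<lambda>x. c * v x) = c *\<^sub>R restrict0 D v"
  by (auto simp: restrict0_def fun_eq_iff)

lemma polynomial_deg_le_add:
  "polynomial_deg_le m p \<Longrightarrow> polynomial_deg_le m q \<Longrightarrow> polynomial_deg_le m (\<lambda>x. p x + q x)"
  unfolding polynomial_deg_le_def
  by (elim exE, rule_tac x = "\<lambda>\<alpha>. c \<alpha> + ca \<alpha>" in exI) (simp add: distrib_right sum.distrib)

lemma polynomial_deg_le_cmult:
  "polynomial_deg_le m p \<Longrightarrow> polynomial_deg_le m (\<lambda>x. a * p x)"
  unfolding polynomial_deg_le_def
  by (elim exE, rule_tac x = "\<lambda>\<alpha>. a * c \<alpha>" in exI) (simp add: sum_distrib_left mult.assoc)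

lemma polynomial_deg_le_0: "polynomial_deg_le m (\<lambda>_. 0)"
  unfolding polynomial_deg_le_def by (rule exI[of _ "\<lambda>_. 0"]) simp

lemma findim_polys_on:
  fixes D :: "(real^'d) set"
  shows "findim (polys_on m D)"
proof -
  let ?I = "{\<alpha>::'d \<Rightarrow> nat. (\<Sum>i\<in>UNIV. \<alpha> i) \<le> m}"
  let ?mono = "\<lambda>\<alpha>. restrict0 D (\<lambda>x. \<Prod>i\<in>UNIV. (x $ i) ^ \<alpha> i)"
  have "subspace (polys_on m D)"
  proof (rule subspaceI)
    show "0 \<in> polys_on m D"
      using polynomial_deg_le_0[of m] by (auto simp: polys_on_def restrict0_def fun_eq_iff)
  next
    fix u v assume "u \<in> polys_on m D" "v \<in> polys_on m D"
    then show "u + v \<in> polys_on m D"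
      unfolding polys_on_def using restrict0_linear(1)[symmetric] polynomial_deg_le_add by blast
  next
    fix c v assume "v \<in> polys_on m D"
    then show "c *\<^sub>R v \<in> polys_on m D"
      unfolding polys_on_def using restrict0_linear(2)[symmetric] polynomial_deg_le_cmult by blast
  qed
  moreover have "polys_on m D \<subseteq> span (?mono ` ?I)"
  proof
    fix v assume "v \<in> polys_on m D"
    then obtain p where p: "v = restrict0 D p" "polynomial_deg_le m p"
      by (auto simp: polys_on_def)
    then obtain c where "\<forall>x. p x = (\<Sum>\<alpha>\<in>?I. c \<alpha> * (\<Prod>i\<in>UNIV. (x $ i) ^ \<alpha> i))"
      unfolding polynomial_deg_le_def by blast
    with p(1) have v: "v = restrict0 D (\<lambda>x. \<Sum>\<alpha>\<in>?I. c \<alpha> * (\<Prod>i\<in>UNIV. (x $ i) ^ \<alpha> i))"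
      by (simp add: restrict0_def fun_eq_iff)
    have "v = (\<Sum>\<alpha>\<in>?I. c \<alpha> *\<^sub>R ?mono \<alpha>)"
      by (auto simp: v restrict0_def fun_eq_iff sum_fun_apply)
    also have "\<dots> \<in> span (?mono ` ?I)"
      by (intro span_sum span_scale span_base) auto
    finally show "v \<in> span (?mono ` ?I)" .
  qed
  ultimately show ?thesis
    unfolding findim_def using finite_multi_indices by blast
qed

lemma restrict0_in_polys_on:
  "restrict0 D v \<in> polys_on m D \<longleftrightarrow> (\<exists>p. polynomial_deg_le m p \<and> (\<forall>x\<in>D. v x = p x))"
  by (auto simp: polys_on_def restrict0_def fun_eq_iff)

lemma findim_subspace:
  assumes "findim V" "subspace U" "U \<subseteq> V"
  shows "findim U"
  using assms unfolding findim_def by (meson order_trans)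

definition piecewise_polys :: "nat \<Rightarrow> (real^'d) set set \<Rightarrow> (real^'d \<Rightarrow> real) set" where
  "piecewise_polys m \<D> =
     {v. (\<forall>D\<in>\<D>. restrict0 D v \<in> polys_on m D) \<and> (\<forall>x. x \<notin> \<Union>\<D> \<longrightarrow> v x = 0)}"

lemma restrict0_add: "restrict0 D (u + v) = restrict0 D u + restrict0 D v"
  and restrict0_scaleR: "restrict0 D (c *\<^sub>R v) = c *\<^sub>R restrict0 D v"
  and restrict0_0: "restrict0 D 0 = 0"
  by (auto simp: restrict0_def fun_eq_iff)

lemma findim_piecewise_polys:
  fixes \<D> :: "(real^'d) set set"
  assumes "finite \<D>" "pairwise disjnt \<D>"
  shows "findim (piecewise_polys m \<D>)"
proof -
  have sub: "subspace (polys_on m D)" for D :: "(real^'d) set"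
    using findim_polys_on[of m D] by (simp add: findim_def)
  have "\<exists>B. finite B \<and> polys_on m D \<subseteq> span B" for D :: "(real^'d) set"
    using findim_polys_on[of m D] by (simp add: findim_def)
  then obtain B where B: "\<And>D::(real^'d) set. finite (B D)" "\<And>D. polys_on m D \<subseteq> span (B D)" by metis
  have "subspace (piecewise_polys m \<D>)"
    unfolding piecewise_polys_def
    by (rule subspaceI)
       (auto simp: restrict0_add restrict0_scaleR restrict0_0 subspace_0 subspace_add subspace_scale sub)
  moreover have "piecewise_polys m \<D> \<subseteq> span (\<Union>(B ` \<D>))"
  proof
    fix v assume v: "v \<in> piecewise_polys m \<D>"
    have "v = (\<Sum>D\<in>\<D>. restrict0 D v)"
    proof
      fix x
      show "v x = (\<Sum>D\<in>\<D>. restrict0 D v) x"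
      proof (cases "x \<in> \<Union>\<D>")
        case True
        then obtain D where D: "D \<in> \<D>" "x \<in> D" by blast
        have "(\<Sum>D'\<in>\<D>. restrict0 D' v x) = (\<Sum>D'\<in>{D}. restrict0 D' v x)"
          using D assms by (intro sum.mono_neutral_right)
            (auto simp: restrict0_def pairwise_def disjnt_def)
        then show ?thesis using D by (simp add: sum_fun_apply restrict0_def)
      next
        case False
        then show ?thesis
          using v by (auto simp: sum_fun_apply restrict0_def piecewise_polys_def intro!: sum.neutral)
      qed
    qed
    also have "\<dots> \<in> span (\<Union>(B ` \<D>))"
    proof (rule span_sum)
      fix D assume "D \<in> \<D>"
      then have "restrict0 D v \<in> span (B D)" using v B(2) by (auto simp: piecewise_polys_def)
      then show "restrict0 D v \<in> span (\<Union>(B ` \<D>))"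
        using span_mono[of "B D" "\<Union>(B ` \<D>)"] \<open>D \<in> \<D>\<close> by blast
    qed
    finally show "v \<in> span (\<Union>(B ` \<D>))" .
  qed
  ultimately show ?thesis
    unfolding findim_def using B(1) assms(1) by (intro conjI exI[of _ "\<Union>(B ` \<D>)"]) auto
qed

text \<open>
  A vector field is the sum of its components times the unit vectors, and each summand is a linear
  image of a function in \<open>V\<close>.
\<close>
lemma findim_componentwise:
  fixes V :: "('a \<Rightarrow> real) set"
  assumes "findim V"
  shows "findim {r :: 'a \<Rightarrow> real^'d. \<forall>i. (\<lambda>x. r x $ i) \<in> V}" (is "findim ?R")
proof -
  have sub: "subspace V" using assms by (simp add: findim_def)
  obtain B where B: "finite B" "V \<subseteq> span B" using assms by (auto simp: findim_def)
  define \<Phi> where "\<Phi> i p = (\<lambda>x. p x *\<^sub>R axis i (1::real) :: real^'d)" for i and p :: "'a \<Rightarrow> real"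
  have lin: "linear (\<Phi> i)" for i
    by (rule linearI) (auto simp: \<Phi>_def fun_eq_iff scaleR_add_left)
  have "subspace ?R"
  proof (rule subspaceI)
    show "0 \<in> ?R" using subspace_0[OF sub] by (simp add: zero_fun_def)
    show "u + v \<in> ?R" if "u \<in> ?R" "v \<in> ?R" for u v
      using that subspace_add[OF sub, of "\<lambda>x. u x $ _" "\<lambda>x. v x $ _"] by (simp add: plus_fun_def)
    show "c *\<^sub>R v \<in> ?R" if "v \<in> ?R" for c v
      using that subspace_scale[OF sub, of "\<lambda>x. v x $ _"] by (simp add: scaleR_fun_def)
  qed
  moreover have "?R \<subseteq> span (\<Union>i. \<Phi> i ` B)"
  proof
    fix r assume r: "r \<in> ?R"
    have "r = (\<Sum>i\<in>UNIV. \<Phi> i (\<lambda>x. r x $ i))"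
      by (auto simp: fun_eq_iff vec_eq_iff sum_fun_apply \<Phi>_def axis_def if_distrib cong: if_cong)
    also have "\<dots> \<in> span (\<Union>i. \<Phi> i ` B)"
    proof (rule span_sum)
      fix i
      have "\<Phi> i (\<lambda>x. r x $ i) \<in> \<Phi> i ` span B" using r B(2) by auto
      also have "\<dots> = span (\<Phi> i ` B)" by (simp add: linear_span_image[OF lin])
      also have "\<dots> \<subseteq> span (\<Union>i. \<Phi> i ` B)" by (rule span_mono) auto
      finally show "\<Phi> i (\<lambda>x. r x $ i) \<in> span (\<Union>i. \<Phi> i ` B)" .
    qed
    finally show "r \<in> span (\<Union>i. \<Phi> i ` B)" .
  qed
  ultimately show ?thesis
    unfolding findim_def using B(1) by (intro conjI exI[of _ "\<Union>i. \<Phi> i ` B"]) auto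
qed

section \<open>Geometry of polytopal meshes\<close>

lemma emeasure_lborel_open_nonzero:
  fixes U :: "(real^'d) set"
  assumes "open U" "U \<noteq> {}"
  shows "emeasure lborel U \<noteq> 0"
proof
  assume "emeasure lborel U = 0"
  then have "U \<in> null_sets lborel" using assms(1) by (simp add: null_sets_def)
  then have "negligible U" by (simp add: negligible_iff_null_sets null_sets_completionI)
  then show False using open_not_negligible[OF assms] by blast
qed

lemma patch_lebesgue:
  assumes "open K" "bounded K"
  shows "patch lebesgue K"
  unfolding patch_def
proof (intro conjI allI impI)
  show "emeasure lebesgue K < \<infinity>"
    using emeasure_bounded_finite[OF assms(2)] assms(1) by simp
  fix U :: "(real^'a) set" assume "open U" "U \<inter> K \<noteq> {}"
  then show "emeasure lebesgue (U \<inter> K) \<noteq> 0"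
    using emeasure_lborel_open_nonzero[of "U \<inter> K"] assms(1) by (simp add: open_Int)
qed (use assms in \<open>auto intro: lborelD\<close>)

text \<open>
  The preimage of a bounded set in the slab around the hyperplane is bounded.  The preimage of a
  relatively open subset of the face contains an open subset of the slab, since the closest point
  projection is continuous and fixes the hyperplane; so it has positive measure.
\<close>
lemma patch_surface_measure:
  fixes F :: "(real^'d) set"
  assumes ne: "F \<noteq> {}" and bd: "bounded F" and G: "open G" "F = affine hull F \<inter> G"
  shows "patch (surface_measure F) F"
proof -
  define H where "H = affine hull F"
  define S where "S = {x. infdist x H \<le> 1/2}"
  define cp where "cp = closest_point H"
  have H: "closed H" "convex H" "H \<noteq> {}" "F = H \<inter> G"
    using ne G(2) by (auto simp: H_def closed_affine_hull affine_imp_convex)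
  have cpH: "cp x \<in> H" and cpd: "dist x (cp x) \<le> infdist x H" for x
  proof -
    show "cp x \<in> H" unfolding cp_def by (rule closest_point_in_set[OF H(1,3)])
    obtain y where y: "y \<in> H" "infdist x H = dist x y"
      by (rule infdist_attains_inf[OF H(1,3), of x]) (rule that)
    then show "dist x (cp x) \<le> infdist x H"
      unfolding cp_def using closest_point_exists(2)[OF H(1,3), of x] by simp
  qed
  have cp_cont: "continuous_on UNIV cp"
    unfolding cp_def by (rule continuous_on_closest_point[OF H(2,1,3)])
  have S: "closed S"
    unfolding S_def by (intro closed_Collect_le continuous_on_infdist continuous_intros)
  have cp_meas: "cp \<in> measurable (restrict_space lborel S) borel"
    using borel_measurable_continuous_onI[OF cp_cont] by (intro measurable_restrict_space1) simp
  have sm: "surface_measure F = distr (restrict_space lborel S) borel cp"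
    by (simp add: surface_measure_def S_def H_def cp_def)
  have em: "emeasure (surface_measure F) A = emeasure lborel (cp -` A \<inter> S)" if "A \<in> sets borel" for A
    unfolding sm using that S cp_meas
    by (simp add: emeasure_distr space_restrict_space emeasure_restrict_space)
  have FB: "F \<in> sets borel" using H(1,4) G(1) by auto
  show ?thesis
    unfolding patch_def
  proof (intro conjI allI impI FB bd)
    show "space (surface_measure F) = UNIV" "sets borel \<subseteq> sets (surface_measure F)"
      by (simp_all add: sm)
    obtain B where B: "\<And>x. x \<in> F \<Longrightarrow> norm x \<le> B" using bd by (auto simp: bounded_iff)
    have "norm x \<le> B + 1/2" if "x \<in> cp -` F \<inter> S" for x
    proof -
      have "norm (cp x) \<le> B" using that B by auto
      moreover have "norm (x - cp x) \<le> 1/2"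
        using that cpd[of x] by (auto simp: S_def dist_norm)
      ultimately show ?thesis using norm_triangle_sub[of x "cp x"] by linarith
    qed
    then have "bounded (cp -` F \<inter> S)" by (auto simp: bounded_iff)
    then show "emeasure (surface_measure F) F < \<infinity>"
      using emeasure_bounded_finite by (metis em[OF FB])
    fix U :: "(real^'d) set" assume U: "open U" "U \<inter> F \<noteq> {}"
    define Q where "Q = cp -` (U \<inter> G) \<inter> {x. infdist x H < 1/2}"
    have "open Q"
      unfolding Q_def using cp_cont U(1) G(1)
      by (intro open_Int open_vimage open_Collect_less continuous_on_infdist continuous_intros) auto
    moreover from U(2) obtain y where y: "y \<in> U" "y \<in> F" by blast
    then have "y \<in> Q"
      using H(4) closest_point_self[of y H] by (auto simp: Q_def cp_def)
    ultimately have "emeasure lborel Q \<noteq> 0" using emeasure_lborel_open_nonzero by blast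
    moreover have "cp -` (U \<inter> F) \<inter> S \<in> sets lborel"
    proof -
      have "cp -` (U \<inter> F) \<in> sets borel"
        using measurable_sets[OF borel_measurable_continuous_onI[OF cp_cont], of "U \<inter> F"] U(1) FB
        by (simp add: borel_open sets.Int)
      then show ?thesis using S by (simp add: sets.Int)
    qed
    moreover have "Q \<subseteq> cp -` (U \<inter> F) \<inter> S"
      using cpH H(4) by (auto simp: Q_def S_def)
    ultimately have "emeasure lborel (cp -` (U \<inter> F) \<inter> S) \<noteq> 0"
      using emeasure_mono by (metis le_zero_eq)
    then show "emeasure (surface_measure F) (U \<inter> F) \<noteq> 0"
      using U(1) FB by (simp add: em sets.Int borel_open)
  qed
qed

definition half_ball_normal :: "(real^'d) set \<Rightarrow> real^'d \<Rightarrow> real^'d \<Rightarrow> bool" where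
  "half_ball_normal K x n \<longleftrightarrow> norm n = 1 \<and> (\<exists>e>0. \<forall>y\<in>ball x e. y \<in> K \<longleftrightarrow> (y - x) \<bullet> n < 0)"

text \<open>
  If \<open>n\<close> and \<open>n'\<close> were different unit normals, the points \<open>x + s * (n - n')\<close> with small \<open>s > 0\<close> would
  be outside of \<open>K\<close> according to \<open>n\<close> and inside according to \<open>n'\<close>.
\<close>
lemma half_ball_normal_unique:
  assumes "half_ball_normal K x n" "half_ball_normal K x n'"
  shows "n = n'"
proof (rule ccontr)
  assume ne: "n \<noteq> n'"
  obtain d d' where n: "norm n = 1" "0 < d" "\<forall>y\<in>ball x d. y \<in> K \<longleftrightarrow> (y - x) \<bullet> n < 0"
    and n': "norm n' = 1" "0 < d'" "\<forall>y\<in>ball x d'. y \<in> K \<longleftrightarrow> (y - x) \<bullet> n' < 0"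
    using assms by (auto simp: half_ball_normal_def)
  have nn: "n \<bullet> n = 1" "n' \<bullet> n' = 1" using n(1) n'(1) by (simp_all add: dot_square_norm)
  have "0 < (n - n') \<bullet> (n - n')" using ne by simp
  then have lt: "n \<bullet> n' < 1" using nn by (simp add: inner_diff inner_commute)
  define v where "v = n - n'"
  define s where "s = min d d' / (2 * norm v)"
  have v: "norm v > 0" using ne by (simp add: v_def)
  have s: "0 < s" "s * norm v < d" "s * norm v < d'" using n(2) n'(2) v by (auto simp: s_def)
  let ?y = "x + s *\<^sub>R v"
  have "?y \<in> ball x d" "?y \<in> ball x d'" using s by (auto simp: dist_norm)
  moreover have "(?y - x) \<bullet> n > 0" "(?y - x) \<bullet> n' < 0"
    using s(1) lt nn by (auto simp: v_def inner_diff_left inner_diff_right inner_commute[of n' n] mult_less_0_iff)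
  ultimately show False using n(3) n'(3) by fastforce
qed

text \<open>
  All points of \<open>F\<close> are boundary points of \<open>K\<close>, so near \<open>x\<close> they lie on the hyperplane that bounds the
  half-ball, and around each of them \<open>K\<close> is a smaller half-ball with the same normal.
\<close>
lemma half_ball_normal_locally_constant:
  assumes K: "open K" and F: "F \<subseteq> frontier K" and n: "half_ball_normal K x n"
  shows "\<exists>e>0. \<forall>x'\<in>F \<inter> ball x e. half_ball_normal K x' n"
proof -
  obtain e where e: "norm n = 1" "0 < e" "\<forall>y\<in>ball x e. y \<in> K \<longleftrightarrow> (y - x) \<bullet> n < 0"
    using n by (auto simp: half_ball_normal_def)
  have "half_ball_normal K x' n" if x': "x' \<in> F \<inter> ball x e" for x'
  proof -
    have fr: "x' \<in> closure K" "x' \<notin> K"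
      using x' F K by (auto simp: frontier_def interior_open)
    define d where "d = e - dist x x'"
    have d: "0 < d" using x' by (simp add: d_def)
    have sub: "ball x' d \<subseteq> ball x e"
      unfolding d_def using dist_triangle[of x _ x'] by (auto simp: dist_commute) (smt (verit) dist_commute dist_triangle)
    have "(x' - x) \<bullet> n \<ge> 0" using e(3) x' fr(2) by auto
    \<comment> \<open>A point beyond the hyperplane would have a whole neighbourhood outside of \<open>K\<close>.\<close>
    moreover have "\<not> (x' - x) \<bullet> n > 0"
    proof
      assume pos: "(x' - x) \<bullet> n > 0"
      have "open (ball x e \<inter> {y. (y - x) \<bullet> n > 0})"
        by (intro open_Int open_ball open_Collect_less continuous_intros)
      moreover have "x' \<in> ball x e \<inter> {y. (y - x) \<bullet> n > 0}" using pos x' by auto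
      ultimately have "ball x e \<inter> {y. (y - x) \<bullet> n > 0} \<inter> K \<noteq> {}"
        using fr(1) open_Int_closure_eq_empty by blast
      then show False using e(3) by fastforce
    qed
    ultimately have "(x' - x) \<bullet> n = 0" by linarith
    then have "(y - x') \<bullet> n = (y - x) \<bullet> n" for y by (simp add: inner_diff_left)
    then have "\<forall>y\<in>ball x' d. y \<in> K \<longleftrightarrow> (y - x') \<bullet> n < 0" using e(3) sub by auto
    then show ?thesis using e(1) d by (auto simp: half_ball_normal_def)
  qed
  then show ?thesis using e(2) by blast
qed

text \<open>
  At points of the face without a half-ball, for instance where another part of the boundary touches
  it, the definite description in \<open>outward_normal\<close> yields one fixed default vector.  The remaining
  points form a relatively open set, on which the normal is locally constant.
\<close>
lemma bounded_borel_outward_normal: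
  assumes K: "open K" and F: "F \<subseteq> frontier K" and FB: "F \<in> sets borel"
  shows "bounded_borel F (outward_normal K)"
proof -
  have on: "outward_normal K x = (THE n. half_ball_normal K x n)" for x
    by (simp add: outward_normal_def half_ball_normal_def)
  have on_eq: "outward_normal K x = n" if "half_ball_normal K x n" for x n
    unfolding on using that half_ball_normal_unique by blast
  define n0 where "n0 = (THE n::real^'a. False)"
  define G where "G = {x \<in> F. \<exists>n. half_ball_normal K x n}"
  have off: "outward_normal K x = n0" if "x \<in> F - G" for x
  proof -
    have "half_ball_normal K x = (\<lambda>_. False)" using that by (auto simp: G_def)
    then show ?thesis by (simp add: on n0_def)
  qed
  have loc: "\<exists>e>0. \<forall>x'\<in>F \<inter> ball x e. x' \<in> G \<and> outward_normal K x' = outward_normal K x"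
    if x: "x \<in> G" for x
  proof -
    obtain n where n: "half_ball_normal K x n" using x by (auto simp: G_def)
    obtain e where e: "e > 0" "\<forall>x'\<in>F \<inter> ball x e. half_ball_normal K x' n"
      using half_ball_normal_locally_constant[OF K F n] by blast
    then show ?thesis using on_eq n by (intro exI[of _ e]) (auto simp: G_def)
  qed
  have "openin (top_of_set F) G"
    unfolding openin_contains_ball using loc by (auto simp: G_def) blast
  then obtain U where "open U" "G = F \<inter> U" by (auto simp: openin_open)
  then have GB: "G \<in> sets borel" using FB by (simp add: sets.Int borel_open)
  have "continuous_on G (outward_normal K)"
    unfolding continuous_on_def
  proof
    fix x assume x: "x \<in> G"
    obtain e where e: "e > 0" "\<forall>x'\<in>F \<inter> ball x e. outward_normal K x' = outward_normal K x"
      using loc[OF x] by blast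
    then have "\<forall>\<^sub>F x' in at x within G. outward_normal K x' = outward_normal K x"
      unfolding eventually_at by (intro exI[of _ e]) (auto simp: G_def dist_commute)
    then show "(outward_normal K \<longlongrightarrow> outward_normal K x) (at x within G)"
      by (rule tendsto_eventually)
  qed
  then have "(\<lambda>x. indicator G x *\<^sub>R outward_normal K x) \<in> borel_measurable borel"
    using GB by (intro borel_measurable_continuous_on_indicator)
  moreover have "(\<lambda>x. indicator (F - G) x *\<^sub>R n0) \<in> borel_measurable borel"
    using FB GB by (intro borel_measurable_scaleR borel_measurable_indicator) auto
  moreover have "(\<lambda>x. indicator F x *\<^sub>R outward_normal K x)
      = (\<lambda>x. indicator G x *\<^sub>R outward_normal K x + indicator (F - G) x *\<^sub>R n0)"
    using off by (auto simp: indicator_def G_def)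
  ultimately have "(\<lambda>x. indicator F x *\<^sub>R outward_normal K x) \<in> borel_measurable borel"
    by simp
  moreover have "norm (outward_normal K x) \<le> 1 + norm n0" if "x \<in> F" for x
  proof (cases "x \<in> G")
    case True
    then obtain n where "half_ball_normal K x n" by (auto simp: G_def)
    then show ?thesis using on_eq by (auto simp: half_ball_normal_def)
  next
    case False
    then show ?thesis using off that by simp
  qed
  ultimately show ?thesis unfolding bounded_borel_def by blast
qed

lemma cell_size_pos:
  assumes "open K" "bounded K" "K \<noteq> {}"
  shows "0 < cell_size K"
proof -
  obtain c e where ce: "0 < e" "ball c e \<subseteq> K"
    using assms(1,3) by (meson all_not_in_conv openE)
  have "e \<le> cell_size K"
    unfolding cell_size_def
  proof (rule cInf_greatest)
    obtain x r where "K \<subseteq> cball x r" using assms(2) by (meson bounded_subset_cball)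
    then show "{2 * r |r. \<exists>x. K \<subseteq> cball x r} \<noteq> {}" by blast
    fix s assume "s \<in> {2 * r |r. \<exists>x. K \<subseteq> cball x r}"
    then obtain x r where r: "s = 2 * r" "K \<subseteq> cball x r" by blast
    then have "ball c e \<subseteq> cball x r" using ce by blast
    then have "e \<le> r" using ce(1) by (smt (verit) ball_subset_cball_iff zero_le_dist)
    then show "e \<le> s" using r ce(1) by simp
  qed
  then show ?thesis using ce(1) by linarith
qed

text \<open>
  The consequences of \<open>polytopal_mesh\<close> on which the analysis of the scheme rests.
\<close>
locale mesh =
  fixes \<Omega> :: "(real^'d) set" and \<T> \<E> :: "(real^'d) set set"
  assumes domain_borel: "\<Omega> \<in> sets borel"
    and finite_cells: "finite \<T>" and disjoint_cells: "pairwise disjnt \<T>"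
    and cell: "\<And>K. K \<in> \<T> \<Longrightarrow> open K" "\<And>K. K \<in> \<T> \<Longrightarrow> bounded K" "\<And>K. K \<in> \<T> \<Longrightarrow> K \<noteq> {}"
    and cell_subset: "\<And>K. K \<in> \<T> \<Longrightarrow> K \<subseteq> \<Omega>"
    and finite_faces: "finite \<E>" and disjoint_faces: "pairwise disjnt \<E>"
    and face_patch: "\<And>F. F \<in> \<E> \<Longrightarrow> patch (surface_measure F) F"
    and face_of_cell: "\<And>F. F \<in> \<E> \<Longrightarrow> \<exists>K\<in>\<T>. F \<in> cell_faces \<E> K"

lemma open_polytopal_bounded:
  assumes "open_polytopal n S"
  shows "bounded S"
proof -
  obtain \<P> where "finite \<P>" "\<forall>P\<in>\<P>. polytope P" "closure S = \<Union>\<P>"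
    using assms by (auto simp: open_polytopal_def)
  then have "bounded (closure S)" by (simp add: bounded_Union polytope_imp_bounded)
  then show ?thesis using closure_subset bounded_subset by blast
qed

lemma open_polytopal_rel_open:
  assumes "open_polytopal n S"
  shows "\<exists>G. open G \<and> S = affine hull S \<inter> G"
proof -
  have "openin (top_of_set (affine hull (closure S))) (rel_interior (closure S))"
    by (rule openin_rel_interior)
  then have "openin (top_of_set (affine hull S)) S"
    using assms by (simp add: open_polytopal_def)
  then show ?thesis by (simp add: openin_open)
qed

lemma open_polytopal_full_dim:
  fixes S :: "(real^'d) set"
  assumes "open_polytopal CARD('d) S"
  shows "open S" "interior (closure S) = S"
proof -
  have "affine hull S = UNIV"
    using assms by (simp add: open_polytopal_def flip: aff_dim_eq_full)
  then show "interior (closure S) = S"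
    using assms rel_interior_interior[of "closure S"] by (simp add: open_polytopal_def)
  then show "open S" by (metis open_interior)
qed

lemma polytopal_mesh_imp_mesh:
  fixes \<Omega> :: "(real^'d) set"
  assumes \<Omega>: "open_polytopal CARD('d) \<Omega>" and mesh: "polytopal_mesh \<Omega> \<T> \<E>"
  shows "mesh \<Omega> \<T> \<E>"
proof
  show "\<Omega> \<in> sets borel" using open_polytopal_full_dim(1)[OF \<Omega>] by simp
  show "finite \<T>" "pairwise disjnt \<T>" "finite \<E>" "pairwise disjnt \<E>"
    using mesh by (auto simp: polytopal_mesh_def)
  fix K assume K: "K \<in> \<T>"
  then have pK: "open_polytopal CARD('d) K" using mesh by (auto simp: polytopal_mesh_def)
  show "open K" "bounded K" "K \<noteq> {}"
    using open_polytopal_full_dim(1)[OF pK] open_polytopal_bounded[OF pK] pK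
    by (auto simp: open_polytopal_def)
  have "closure \<Omega> = (\<Union>K\<in>\<T>. closure K)" using mesh by (simp add: polytopal_mesh_def)
  then have "K \<subseteq> closure \<Omega>" using K closure_subset[of K] by blast
  then show "K \<subseteq> \<Omega>"
    using interior_maximal[of K "closure \<Omega>"] open_polytopal_full_dim[OF \<Omega>] \<open>open K\<close> by simp
next
  fix F assume F: "F \<in> \<E>"
  then have pF: "open_polytopal (CARD('d) - 1) F" using mesh by (auto simp: polytopal_mesh_def)
  then obtain G where "open G" "F = affine hull F \<inter> G" using open_polytopal_rel_open by blast
  then show "patch (surface_measure F) F"
    using pF open_polytopal_bounded[OF pF] by (intro patch_surface_measure) (auto simp: open_polytopal_def)
  have "(\<exists>K\<in>\<T>. \<exists>K'\<in>\<T>. K \<noteq> K' \<and> F \<subseteq> frontier K \<inter> frontier K') \<or>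
      (\<exists>K\<in>\<T>. F \<subseteq> frontier K \<inter> frontier \<Omega>)"
    using F mesh unfolding polytopal_mesh_def by blast
  then show "\<exists>K\<in>\<T>. F \<in> cell_faces \<E> K"
    using F by (auto simp: cell_faces_def)
qed

section \<open>Fields depending linearly on a parameter\<close>

text \<open>
  With the advecting function fixed, every integrand of the forms of the scheme is a product of two
  factors that depend linearly on the trial and the test function, respectively.  As the integral is additive only on integrable functions, linearity of the factors
  is stated jointly with the boundedness and measurability that make their products integrable.
\<close>
definition linear_fields ::
    "'z::real_vector set \<Rightarrow> (real^'d) set \<Rightarrow> ('z \<Rightarrow> real^'d \<Rightarrow> 'b::euclidean_space) \<Rightarrow> bool" where
  "linear_fields S D P \<longleftrightarrow>
     (\<forall>z\<in>S. bounded_borel D (P z)) \<and> (\<forall>x\<in>D. linear_on S (\<lambda>z. P z x))"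

lemma linear_fieldsI:
  assumes "\<And>z. z \<in> S \<Longrightarrow> bounded_borel D (P z)" "\<And>x. x \<in> D \<Longrightarrow> linear_on S (\<lambda>z. P z x)"
  shows "linear_fields S D P"
  using assms by (simp add: linear_fields_def)

lemma linear_fieldsD:
  assumes "linear_fields S D P"
  shows "z \<in> S \<Longrightarrow> bounded_borel D (P z)" "x \<in> D \<Longrightarrow> linear_on S (\<lambda>z. P z x)"
  using assms by (simp_all add: linear_fields_def)

lemma linear_fields_fst:
  assumes "linear_fields V D P"
  shows "linear_fields (V \<times> W) D (\<lambda>z. P (fst z))"
proof (rule linear_fieldsI)
  show "bounded_borel D (P (fst z))" if "z \<in> V \<times> W" for z
    using linear_fieldsD(1)[OF assms] that by auto
  show "linear_on (V \<times> W) (\<lambda>z. P (fst z) x)" if "x \<in> D" for x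
    using linear_onD[OF linear_fieldsD(2)[OF assms that]] by (intro linear_onI) auto
qed

lemma linear_fields_snd:
  assumes "linear_fields W D P"
  shows "linear_fields (V \<times> W) D (\<lambda>z. P (snd z))"
proof (rule linear_fieldsI)
  show "bounded_borel D (P (snd z))" if "z \<in> V \<times> W" for z
    using linear_fieldsD(1)[OF assms] that by auto
  show "linear_on (V \<times> W) (\<lambda>z. P (snd z) x)" if "x \<in> D" for x
    using linear_onD[OF linear_fieldsD(2)[OF assms that]] by (intro linear_onI) auto
qed

lemma linear_fields_scaleR_left:
  assumes "linear_fields S D P" "bounded_borel D q"
  shows "linear_fields S D (\<lambda>z x. P z x *\<^sub>R q x)"
proof (rule linear_fieldsI)
  show "bounded_borel D (\<lambda>x. P z x *\<^sub>R q x)" if "z \<in> S" for z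
    by (intro bounded_borel_scaleR assms(2) linear_fieldsD(1)[OF assms(1) that])
  show "linear_on S (\<lambda>z. P z x *\<^sub>R q x)" if "x \<in> D" for x
    using linear_onD[OF linear_fieldsD(2)[OF assms(1) that]]
    by (intro linear_onI) (simp_all add: scaleR_add_left)
qed

lemma linear_fields_scaleR_right:
  assumes "linear_fields S D P" "bounded_borel D q"
  shows "linear_fields S D (\<lambda>z x. q x *\<^sub>R P z x)"
proof (rule linear_fieldsI)
  show "bounded_borel D (\<lambda>x. q x *\<^sub>R P z x)" if "z \<in> S" for z
    by (intro bounded_borel_scaleR assms(2) linear_fieldsD(1)[OF assms(1) that])
  show "linear_on S (\<lambda>z. q x *\<^sub>R P z x)" if "x \<in> D" for x
    using linear_onD[OF linear_fieldsD(2)[OF assms(1) that]]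
    by (intro linear_onI) (simp_all add: scaleR_add_right)
qed

lemma linear_fields_mult_left:
  fixes q :: "real^'d \<Rightarrow> real"
  shows "linear_fields S D P \<Longrightarrow> bounded_borel D q \<Longrightarrow> linear_fields S D (\<lambda>z x. P z x * q x)"
  using linear_fields_scaleR_left[of S D P q] by simp

lemma linear_fields_mult_right:
  fixes q :: "real^'d \<Rightarrow> real"
  shows "linear_fields S D P \<Longrightarrow> bounded_borel D q \<Longrightarrow> linear_fields S D (\<lambda>z x. q x * P z x)"
  using linear_fields_scaleR_right[of S D P q] by simp

lemma linear_fields_inner_left:
  assumes "linear_fields S D P" "bounded_borel D q"
  shows "linear_fields S D (\<lambda>z x. P z x \<bullet> q x)"
proof (rule linear_fieldsI)
  show "bounded_borel D (\<lambda>x. P z x \<bullet> q x)" if "z \<in> S" for z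
    by (intro bounded_borel_inner assms(2) linear_fieldsD(1)[OF assms(1) that])
  show "linear_on S (\<lambda>z. P z x \<bullet> q x)" if "x \<in> D" for x
    using linear_onD[OF linear_fieldsD(2)[OF assms(1) that]]
    by (intro linear_onI) (simp_all add: inner_add_left)
qed

lemma linear_fields_inner_right:
  assumes "linear_fields S D P" "bounded_borel D q"
  shows "linear_fields S D (\<lambda>z x. q x \<bullet> P z x)"
proof (rule linear_fieldsI)
  show "bounded_borel D (\<lambda>x. q x \<bullet> P z x)" if "z \<in> S" for z
    by (intro bounded_borel_inner assms(2) linear_fieldsD(1)[OF assms(1) that])
  show "linear_on S (\<lambda>z. q x \<bullet> P z x)" if "x \<in> D" for x
    using linear_onD[OF linear_fieldsD(2)[OF assms(1) that]]
    by (intro linear_onI) (simp_all add: inner_add_right)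
qed

lemma linear_fields_diff:
  assumes "linear_fields S D P" "linear_fields S D Q" "D \<in> sets borel"
  shows "linear_fields S D (\<lambda>z x. P z x - Q z x)"
proof (rule linear_fieldsI)
  fix z assume "z \<in> S"
  then have "bounded_borel D (\<lambda>x. P z x + (-1) *\<^sub>R Q z x)"
    using assms by (intro bounded_borel_add bounded_borel_scaleR bounded_borel_const linear_fieldsD)
  then show "bounded_borel D (\<lambda>x. P z x - Q z x)" by simp
next
  fix x assume "x \<in> D"
  then show "linear_on S (\<lambda>z. P z x - Q z x)"
    using linear_on_combine[OF linear_fieldsD(2)[OF assms(1)] linear_fieldsD(2)[OF assms(2)], of x x 1 "-1"]
    by simp
qed

lemma linear_fields_vec:
  fixes P :: "'z::real_vector \<Rightarrow> real^'d \<Rightarrow> real"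
  assumes "linear_fields S D P" "D \<in> sets borel"
  shows "linear_fields S D (\<lambda>z x. vec (P z x) :: real^'d)"
proof (rule linear_fieldsI)
  fix z assume "z \<in> S"
  then show "bounded_borel D (\<lambda>x. vec (P z x) :: real^'d)"
    unfolding vec_def using assms by (intro bounded_borel_vec_lambda linear_fieldsD)
next
  fix x assume "x \<in> D"
  from linear_fieldsD(2)[OF assms(1) this]
  show "linear_on S (\<lambda>z. vec (P z x) :: real^'d)"
    by (auto simp: linear_on_def vec_eq_iff)
qed

lemma linear_on_integral:
  assumes M: "patch M D" and P: "linear_fields S D P" and q: "bounded_borel D q"
    and S: "subspace S"
  shows "linear_on S (\<lambda>z. LINT x:D|M. P z x \<bullet> q x)"
proof (rule linear_onI)
  note int = bounded_borel_set_integrable[OF M bounded_borel_inner[OF linear_fieldsD(1)[OF P] q]]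
  note lin = linear_onD[OF linear_fieldsD(2)[OF P]]
  fix y z assume yz: "y \<in> S" "z \<in> S"
  have "(LINT x:D|M. P (y + z) x \<bullet> q x) = (LINT x:D|M. P y x \<bullet> q x + P z x \<bullet> q x)"
    using lin(1) yz by (intro set_lebesgue_integral_cong patchD(4)[OF M]) (simp add: inner_add_left)
  then show "(LINT x:D|M. P (y + z) x \<bullet> q x) = (LINT x:D|M. P y x \<bullet> q x) + (LINT x:D|M. P z x \<bullet> q x)"
    using int[OF yz(1)] int[OF yz(2)] by simp
next
  fix c z assume z: "z \<in> S"
  have "(LINT x:D|M. P (c *\<^sub>R z) x \<bullet> q x) = (LINT x:D|M. c * (P z x \<bullet> q x))"
    using linear_onD(2)[OF linear_fieldsD(2)[OF P]] z
    by (intro set_lebesgue_integral_cong patchD(4)[OF M]) simp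
  then show "(LINT x:D|M. P (c *\<^sub>R z) x \<bullet> q x) = c *\<^sub>R (LINT x:D|M. P z x \<bullet> q x)" by simp
qed

lemma linear_on_sum_fun:
  assumes "\<And>i. i \<in> I \<Longrightarrow> linear_on S (f i)"
  shows "linear_on S (\<lambda>z. \<Sum>i\<in>I. f i z)"
proof (rule linear_onI)
  show "(\<Sum>i\<in>I. f i (u + v)) = (\<Sum>i\<in>I. f i u) + (\<Sum>i\<in>I. f i v)" if "u \<in> S" "v \<in> S" for u v
    unfolding sum.distrib[symmetric] using that by (intro sum.cong refl linear_onD(1)[OF assms])
  show "(\<Sum>i\<in>I. f i (c *\<^sub>R v)) = c *\<^sub>R (\<Sum>i\<in>I. f i v)" if "v \<in> S" for c v
    unfolding scaleR_sum_right using that by (intro sum.cong refl linear_onD(2)[OF assms])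
qed

lemma bilinear_on_combine:
  assumes "bilinear_on V W f" "bilinear_on V W g"
  shows "bilinear_on V W (\<lambda>v w. a * f v w + b * g v w)"
proof (rule bilinear_onI)
  show "linear_on W (\<lambda>w. a * f v w + b * g v w)" if "v \<in> V" for v
    using linear_on_combine[OF assms[THEN bilinear_onD(1)[OF _ that]], of a b] by simp
  show "linear_on V (\<lambda>v. a * f v w + b * g v w)" if "w \<in> W" for w
    using linear_on_combine[OF assms[THEN bilinear_onD(2)[OF _ that]], of a b] by simp
qed

definition polynomial_on :: "(real^'d) set \<Rightarrow> (real^'d \<Rightarrow> real) \<Rightarrow> bool" where
  "polynomial_on D v \<longleftrightarrow> (\<exists>p. real_polynomial_function p \<and> (\<forall>x\<in>D. v x = p x))"

lemma polynomial_on_if_restrict0: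
  assumes "restrict0 D v \<in> polys_on m D"
  shows "polynomial_on D v"
proof -
  obtain p where "polynomial_deg_le m p" "\<forall>x\<in>D. v x = p x"
    using assms restrict0_in_polys_on by blast
  then show ?thesis using polynomial_deg_le_imp_real_polynomial polynomial_on_def by blast
qed

lemma polynomial_on_if_polys_on:
  assumes "v \<in> polys_on m D"
  shows "polynomial_on D v"
proof -
  have "restrict0 D v = v" using assms by (auto simp: polys_on_def restrict0_def fun_eq_iff)
  then show ?thesis using polynomial_on_if_restrict0[of D v m] assms by simp
qed

lemma polynomial_on_bounded_borel:
  assumes "polynomial_on D v" "D \<in> sets borel" "bounded D"
  shows "bounded_borel D v"
proof -
  obtain p where "real_polynomial_function p" "\<forall>x\<in>D. v x = p x"
    using assms(1) by (auto simp: polynomial_on_def)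
  then show ?thesis
    using bounded_borel_continuous[OF real_polynomial_continuous assms(2,3)] bounded_borel_cong[of D v p] by blast
qed

lemma polys_on_bounded_borel:
  assumes "patch M D" "p \<in> polys_on m D"
  shows "bounded_borel D p"
  using polynomial_on_bounded_borel[OF polynomial_on_if_polys_on[OF assms(2)]] patchD[OF assms(1)]
  by blast

lemma subspace_polys_on: "subspace (polys_on m D)"
  using findim_polys_on[of m D] by (simp add: findim_def)

lemma frechet_derivative_cong_open:
  assumes "open K" "x \<in> K" "\<And>y. y \<in> K \<Longrightarrow> v y = p y"
  shows "frechet_derivative v (at x) = frechet_derivative p (at x)"
proof -
  have "(v has_derivative D) (at x) \<longleftrightarrow> (p has_derivative D) (at x)" for D
    using has_derivative_transform_within_open[of v D x UNIV K p]
      has_derivative_transform_within_open[of p D x UNIV K v] assms by auto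
  then show ?thesis by (simp add: frechet_derivative_def)
qed

lemma partial_derivative_linear_fields:
  assumes K: "open K" "bounded K" and V: "\<And>v. v \<in> V \<Longrightarrow> polynomial_on K v"
  shows "linear_fields V K (\<lambda>v x. frechet_derivative v (at x) h)"
proof (rule linear_fieldsI)
  fix v assume "v \<in> V"
  then obtain p where p: "real_polynomial_function p" "\<forall>x\<in>K. v x = p x"
    using V by (auto simp: polynomial_on_def)
  obtain p' where p': "real_polynomial_function p'" "\<forall>x. frechet_derivative p (at x) h = p' x"
    using real_polynomial_frechet_derivative[OF p(1)] by blast
  have "\<forall>x\<in>K. frechet_derivative v (at x) h = p' x"
    using frechet_derivative_cong_open[OF K(1), of _ v p] p p' by simp
  then have "polynomial_on K (\<lambda>x. frechet_derivative v (at x) h)"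
    using p'(1) by (auto simp: polynomial_on_def)
  then show "bounded_borel K (\<lambda>x. frechet_derivative v (at x) h)"
    using K by (intro polynomial_on_bounded_borel) auto
next
  fix x assume x: "x \<in> K"
  have diff: "(v has_derivative frechet_derivative v (at x)) (at x)" if v: "v \<in> V" for v
  proof -
    obtain p where p: "real_polynomial_function p" "\<forall>x\<in>K. v x = p x"
      using V[OF v] by (auto simp: polynomial_on_def)
    have "(p has_derivative frechet_derivative p (at x)) (at x)"
      by (rule frechet_derivative_works[THEN iffD1, OF differentiable_at_real_polynomial_function[OF p(1)]])
    then have "(v has_derivative frechet_derivative p (at x)) (at x)"
      by (rule has_derivative_transform_within_open[OF _ K(1) x]) (use p in simp)
    then show ?thesis
      using frechet_derivative_works differentiableI by blast
  qed
  show "linear_on V (\<lambda>v. frechet_derivative v (at x) h)"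
  proof (rule linear_onI)
    fix u v assume "u \<in> V" "v \<in> V"
    then have "(u + v has_derivative (\<lambda>h. frechet_derivative u (at x) h + frechet_derivative v (at x) h)) (at x)"
      unfolding plus_fun_def by (intro has_derivative_add diff)
    from frechet_derivative_at[OF this, symmetric]
    show "frechet_derivative (u + v) (at x) h = frechet_derivative u (at x) h + frechet_derivative v (at x) h"
      by simp
  next
    fix c v assume "v \<in> V"
    then have "(c *\<^sub>R v has_derivative (\<lambda>h. c *\<^sub>R frechet_derivative v (at x) h)) (at x)"
      unfolding scaleR_fun_def by (intro has_derivative_scaleR_right diff)
    from frechet_derivative_at[OF this, symmetric]
    show "frechet_derivative (c *\<^sub>R v) (at x) h = c *\<^sub>R frechet_derivative v (at x) h"
      by simp
  qed
qed

lemma grad_linear_fields: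
  assumes "open K" "bounded K" and "\<And>v. v \<in> V \<Longrightarrow> polynomial_on K v"
  shows "linear_fields V K grad"
proof (rule linear_fieldsI)
  note lf = partial_derivative_linear_fields[OF assms]
  show "bounded_borel K (grad v)" if "v \<in> V" for v
    unfolding grad_def[abs_def]
    using linear_fieldsD(1)[OF lf that] assms(1) by (intro bounded_borel_vec_lambda) auto
  show "linear_on V (\<lambda>v. grad v x)" if "x \<in> K" for x
    using linear_fieldsD(2)[OF lf that] by (auto simp: grad_def linear_on_def vec_eq_iff)
qed

text \<open>
  The cell is open and has \<open>x\<close> in its closure but not in itself, so the limit along the cell is taken
  over a nontrivial filter.
\<close>
lemma trace_from_eq:
  assumes K: "open K" and x: "x \<in> frontier K" and p: "continuous_on UNIV p"
    and v: "\<And>y. y \<in> K \<Longrightarrow> v y = p y"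
  shows "trace_from K v x = p x"
  unfolding trace_from_def
proof (rule tendsto_Lim)
  have "x \<in> closure K" "x \<notin> K" using x K by (auto simp: frontier_def interior_open)
  then show "at x within K \<noteq> bot"
    by (simp add: trivial_limit_within closure_def)
  have "(p \<longlongrightarrow> p x) (at x)" using p by (simp add: continuous_on_def)
  then have "(p \<longlongrightarrow> p x) (at x within K)" by (rule tendsto_within_subset) simp
  then show "(v \<longlongrightarrow> p x) (at x within K)"
    by (rule Lim_transform_eventually) (auto simp: eventually_at_filter v)
qed

lemma trace_linear_fields:
  assumes K: "open K" and F: "F \<subseteq> frontier K" "F \<in> sets borel" "bounded F"
    and V: "\<And>v. v \<in> V \<Longrightarrow> polynomial_on K v"
  shows "linear_fields V F (trace_from K)"
proof -
  have "\<exists>p. real_polynomial_function p \<and> (\<forall>y\<in>K. v y = p y)" if "v \<in> V" for v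
    using V[OF that] by (simp add: polynomial_on_def)
  then obtain p where p: "\<And>v. v \<in> V \<Longrightarrow> real_polynomial_function (p v)"
    "\<And>v y. v \<in> V \<Longrightarrow> y \<in> K \<Longrightarrow> v y = p v y" by metis
  have tr: "trace_from K v x = p v x" if "v \<in> V" "x \<in> F" for v x
    using that F(1) p by (intro trace_from_eq[OF K] real_polynomial_continuous) auto
  show ?thesis
  proof (rule linear_fieldsI)
    fix v assume v: "v \<in> V"
    then have "polynomial_on F (trace_from K v)" using tr p by (auto simp: polynomial_on_def)
    then show "bounded_borel F (trace_from K v)" using F by (intro polynomial_on_bounded_borel)
  next
    fix x assume x: "x \<in> F"
    show "linear_on V (\<lambda>v. trace_from K v x)"
    proof (rule linear_onI)
      fix u v assume uv: "u \<in> V" "v \<in> V"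
      have "trace_from K (u + v) x = p u x + p v x"
        using x F(1) p uv
        by (intro trace_from_eq[OF K] continuous_on_add real_polynomial_continuous) auto
      then show "trace_from K (u + v) x = trace_from K u x + trace_from K v x" using tr uv x by simp
    next
      fix c v assume v: "v \<in> V"
      have "trace_from K (c *\<^sub>R v) x = c * p v x"
        using x F(1) p v
        by (intro trace_from_eq[OF K] continuous_on_mult_left real_polynomial_continuous) auto
      then show "trace_from K (c *\<^sub>R v) x = c *\<^sub>R trace_from K v x" using tr v x by simp
    qed
  qed
qed

lemma vector_trace:
  fixes r :: "real^'d \<Rightarrow> real^'d"
  assumes K: "open K" and x: "x \<in> frontier K" and r: "\<And>i. polynomial_on K (\<lambda>y. r y $ i)"
  shows "trace_from K r x = (\<chi> i. trace_from K (\<lambda>y. r y $ i) x)"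
proof -
  obtain p where p: "\<And>i. real_polynomial_function (p i)" "\<And>i y. y \<in> K \<Longrightarrow> r y $ i = p i y"
    using r unfolding polynomial_on_def by metis
  have "trace_from K r x = (\<chi> i. p i x)"
    using x p by (intro trace_from_eq[OF K] continuous_on_vec_lambda real_polynomial_continuous) (auto simp: vec_eq_iff)
  moreover have "trace_from K (\<lambda>y. r y $ i) x = p i x" for i
    using x p by (intro trace_from_eq[OF K] real_polynomial_continuous) auto
  ultimately show ?thesis by simp
qed

lemma linear_fields_components:
  fixes \<Phi> :: "(real^'d \<Rightarrow> real) \<Rightarrow> real^'d \<Rightarrow> real" and Q :: "(real^'d \<Rightarrow> real^'d) set"
  assumes "linear_fields V D \<Phi>" "\<And>r. r \<in> Q \<Longrightarrow> (\<lambda>y. r y $ i) \<in> V"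
  shows "linear_fields Q D (\<lambda>r. \<Phi> (\<lambda>y. r y $ i))"
proof (rule linear_fieldsI)
  show "bounded_borel D (\<Phi> (\<lambda>y. r y $ i))" if "r \<in> Q" for r
    by (rule linear_fieldsD(1)[OF assms(1) assms(2)[OF that]])
  fix x assume x: "x \<in> D"
  note lin = linear_onD[OF linear_fieldsD(2)[OF assms(1) x]]
  show "linear_on Q (\<lambda>r. \<Phi> (\<lambda>y. r y $ i) x)"
  proof (rule linear_onI)
    show "\<Phi> (\<lambda>y. (q + r) y $ i) x = \<Phi> (\<lambda>y. q y $ i) x + \<Phi> (\<lambda>y. r y $ i) x" if "q \<in> Q" "r \<in> Q" for q r
      using lin(1)[OF assms(2)[OF that(1)] assms(2)[OF that(2)]] by (simp add: plus_fun_def)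
    show "\<Phi> (\<lambda>y. (c *\<^sub>R r) y $ i) x = c *\<^sub>R \<Phi> (\<lambda>y. r y $ i) x" if "r \<in> Q" for c r
      using lin(2)[OF assms(2)[OF that], of c] by (simp add: scaleR_fun_def)
  qed
qed

lemma linear_fields_vec_lambda:
  fixes P :: "'d \<Rightarrow> 'z::real_vector \<Rightarrow> real^'d \<Rightarrow> real"
  assumes "\<And>i. linear_fields S D (P i)" "D \<in> sets borel"
  shows "linear_fields S D (\<lambda>z x. \<chi> i. P i z x)"
proof (rule linear_fieldsI)
  show "bounded_borel D (\<lambda>x. \<chi> i. P i z x)" if "z \<in> S" for z
    using linear_fieldsD(1)[OF assms(1) that] assms(2) by (intro bounded_borel_vec_lambda)
  show "linear_on S (\<lambda>z. \<chi> i. P i z x)" if "x \<in> D" for x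
    using linear_fieldsD(2)[OF assms(1) that] by (auto simp: linear_on_def vec_eq_iff)
qed

lemma linear_fields_sum:
  assumes "\<And>i. i \<in> I \<Longrightarrow> linear_fields S D (P i)" "D \<in> sets borel"
  shows "linear_fields S D (\<lambda>z x. \<Sum>i\<in>I. P i z x)"
proof (rule linear_fieldsI)
  show "bounded_borel D (\<lambda>x. \<Sum>i\<in>I. P i z x)" if "z \<in> S" for z
    using linear_fieldsD(1)[OF assms(1) that] assms(2) by (intro bounded_borel_sum)
  show "linear_on S (\<lambda>z. \<Sum>i\<in>I. P i z x)" if "x \<in> D" for x
    using linear_fieldsD(2)[OF assms(1) that] by (intro linear_on_sum_fun)
qed

lemma linear_fields_cong:
  assumes "\<And>z x. z \<in> S \<Longrightarrow> x \<in> D \<Longrightarrow> P z x = Q z x" "subspace S" "linear_fields S D Q"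
  shows "linear_fields S D P"
proof (rule linear_fieldsI)
  show "bounded_borel D (P z)" if "z \<in> S" for z
    using bounded_borel_cong[of D "P z" "Q z"] assms(1) linear_fieldsD(1)[OF assms(3)] that by blast
  show "linear_on S (\<lambda>z. P z x)" if "x \<in> D" for x
    using linear_fieldsD(2)[OF assms(3) that] assms(1) that
    by (simp add: linear_on_def subspace_add[OF assms(2)] subspace_scale[OF assms(2)])
qed

lemma inner_product_polys_on:
  assumes M: "patch M D"
  shows "inner_product_on (polys_on m D) (\<lambda>p q. LINT x:D|M. p x * q x)"
proof -
  note bb = polys_on_bounded_borel[OF M]
  have id: "linear_fields (polys_on m D) D (\<lambda>p. p)"
    by (rule linear_fieldsI) (auto simp: bb linear_on_def)
  have lin: "linear_on (polys_on m D) (\<lambda>p. LINT x:D|M. p x * q x)" if "q \<in> polys_on m D" for q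
    using linear_on_integral[OF M id bb[OF that] subspace_polys_on] by simp
  have "0 < (LINT x:D|M. v x * v x)" if v: "v \<in> polys_on m D" "v \<noteq> 0" for v
  proof -
    obtain p where p: "real_polynomial_function p" "\<And>x. x \<in> D \<Longrightarrow> v x = p x"
      using polynomial_on_if_polys_on[OF v(1)] by (auto simp: polynomial_on_def)
    obtain x where x: "v x \<noteq> 0" using v(2) by (auto simp: fun_eq_iff)
    then have "x \<in> D" using v(1) by (auto simp: polys_on_def restrict0_def split: if_splits)
    then have "(LINT x:D|M. v x * v x) \<noteq> 0"
      using integral_square_zero_imp_zero[OF M real_polynomial_continuous[OF p(1)] p(2), of x] x by auto
    moreover have "0 \<le> (LINT x:D|M. v x * v x)"
      unfolding set_lebesgue_integral_def by (intro integral_nonneg_AE) simp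
    ultimately show ?thesis by simp
  qed
  then show ?thesis
    unfolding inner_product_on_def using lin
    by (auto intro!: bilinear_onI simp: mult.commute)
qed

lemma linear_on_integral_set_integrable:
  fixes g :: "real^'d \<Rightarrow> real" and V :: "(real^'d \<Rightarrow> real) set"
  assumes M: "patch M D" and g: "set_integrable M D g"
    and V: "\<And>v. v \<in> V \<Longrightarrow> bounded_borel D v"
  shows "linear_on V (\<lambda>v. LINT x:D|M. g x * v x)"
proof (rule linear_onI)
  have int: "set_integrable M D (\<lambda>x. g x * v x)" if "v \<in> V" for v
    by (rule set_integrable_mult_bounded_borel[OF M g V[OF that]])
  show "(LINT x:D|M. g x * (u + v) x) = (LINT x:D|M. g x * u x) + (LINT x:D|M. g x * v x)"
    if "u \<in> V" "v \<in> V" for u v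
    using int[OF that(1)] int[OF that(2)] by (simp add: distrib_left)
  show "(LINT x:D|M. g x * (c *\<^sub>R v) x) = c *\<^sub>R (LINT x:D|M. g x * v x)" if "v \<in> V" for c v
    by (simp add: mult.left_commute)
qed

lemma L2_proj_characterization:
  assumes M: "patch M D" and g: "set_integrable M D g"
  shows "L2_proj M m D g \<in> polys_on m D"
    and "q \<in> polys_on m D \<Longrightarrow> (LINT x:D|M. L2_proj M m D g x * q x) = (LINT x:D|M. g x * q x)"
    and "\<lbrakk>p \<in> polys_on m D; \<And>q. q \<in> polys_on m D \<Longrightarrow> (LINT x:D|M. p x * q x) = (LINT x:D|M. g x * q x)\<rbrakk>
      \<Longrightarrow> L2_proj M m D g = p"
proof -
  note bb = polys_on_bounded_borel[OF M]
  have eq: "(LINT x:D|M. (g x - p x) * q x) = (LINT x:D|M. g x * q x) - (LINT x:D|M. p x * q x)"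
    if "p \<in> polys_on m D" "q \<in> polys_on m D" for p q
    using set_integrable_mult_bounded_borel[OF M g bb[OF that(2)]]
      bounded_borel_set_integrable[OF M bounded_borel_mult[OF bb[OF that(1)] bb[OF that(2)]]]
    by (simp add: left_diff_distrib)
  have "\<exists>!p. p \<in> polys_on m D \<and> (\<forall>q\<in>polys_on m D. (LINT x:D|M. p x * q x) = (LINT x:D|M. g x * q x))"
    using bb by (intro riesz_representation findim_polys_on inner_product_polys_on[OF M]
        linear_on_integral_set_integrable[OF M g]) auto
  moreover have "L2_proj M m D g =
     (THE p. p \<in> polys_on m D \<and> (\<forall>q\<in>polys_on m D. (LINT x:D|M. p x * q x) = (LINT x:D|M. g x * q x)))"
    unfolding L2_proj_def by (intro arg_cong[of _ _ The] ext) (auto simp: eq)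
  ultimately show "L2_proj M m D g \<in> polys_on m D"
    and "q \<in> polys_on m D \<Longrightarrow> (LINT x:D|M. L2_proj M m D g x * q x) = (LINT x:D|M. g x * q x)"
    and "\<lbrakk>p \<in> polys_on m D; \<And>q. q \<in> polys_on m D \<Longrightarrow> (LINT x:D|M. p x * q x) = (LINT x:D|M. g x * q x)\<rbrakk>
      \<Longrightarrow> L2_proj M m D g = p"
    using theI'[of "\<lambda>p. p \<in> polys_on m D \<and> (\<forall>q\<in>polys_on m D. (LINT x:D|M. p x * q x) = (LINT x:D|M. g x * q x))"]
      the1_equality[of "\<lambda>p. p \<in> polys_on m D \<and> (\<forall>q\<in>polys_on m D. (LINT x:D|M. p x * q x) = (LINT x:D|M. g x * q x))" p]
    by auto
qed

text \<open>
  The projection is the Riesz representer of a functional that depends linearly on the projected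
  function.
\<close>
lemma L2_proj_linear_fields:
  assumes M: "patch M D" and P: "linear_fields S D P" and S: "subspace S"
  shows "linear_fields S D (\<lambda>z. L2_proj M m D (P z))"
proof -
  have int: "set_integrable M D (P z)" if "z \<in> S" for z
    by (rule bounded_borel_set_integrable[OF M linear_fieldsD(1)[OF P that]])
  note proj = L2_proj_characterization[OF M int]
  note sub = subspace_polys_on[of m D]
  note bb = polys_on_bounded_borel[OF M]
  have lin: "linear_on S (\<lambda>z. LINT x:D|M. P z x * q x)" if "q \<in> polys_on m D" for q
    using linear_on_integral[OF M P bb[OF that] S] by simp
  have linp: "linear_on (polys_on m D) (\<lambda>p. LINT x:D|M. p x * q x)" if "q \<in> polys_on m D" for q
    using bilinear_onD(2)[of "polys_on m D" "polys_on m D"] inner_product_polys_on[OF M] that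
    by (auto simp: inner_product_on_def)
  have add: "L2_proj M m D (P (y + z)) = L2_proj M m D (P y) + L2_proj M m D (P z)"
    if "y \<in> S" "z \<in> S" for y z
  proof (rule proj(3))
    show "y + z \<in> S" using that S by (simp add: subspace_add)
    show "L2_proj M m D (P y) + L2_proj M m D (P z) \<in> polys_on m D"
      using proj(1) that sub by (simp add: subspace_add)
    show "(LINT x:D|M. (L2_proj M m D (P y) + L2_proj M m D (P z)) x * q x) = (LINT x:D|M. P (y + z) x * q x)"
      if q: "q \<in> polys_on m D" for q
      using linear_onD(1)[OF linp[OF q] proj(1) proj(1)] linear_onD(1)[OF lin[OF q]]
        proj(2)[OF _ q] \<open>y \<in> S\<close> \<open>z \<in> S\<close> by simp
  qed
  have scale: "L2_proj M m D (P (c *\<^sub>R z)) = c *\<^sub>R L2_proj M m D (P z)" if "z \<in> S" for c z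
  proof (rule proj(3))
    show "c *\<^sub>R z \<in> S" using that S by (simp add: subspace_scale)
    show "c *\<^sub>R L2_proj M m D (P z) \<in> polys_on m D"
      using proj(1) that sub by (simp add: subspace_scale)
    show "(LINT x:D|M. (c *\<^sub>R L2_proj M m D (P z)) x * q x) = (LINT x:D|M. P (c *\<^sub>R z) x * q x)"
      if q: "q \<in> polys_on m D" for q
      using linear_onD(2)[OF linp[OF q] proj(1)] linear_onD(2)[OF lin[OF q]]
        proj(2)[OF _ q] \<open>z \<in> S\<close> by simp
  qed
  show ?thesis
  proof (rule linear_fieldsI)
    show "bounded_borel D (L2_proj M m D (P z))" if "z \<in> S" for z
      by (rule bb[OF proj(1)[OF that]])
    show "linear_on S (\<lambda>z. L2_proj M m D (P z) x)" for x
      by (rule linear_onI) (simp_all add: add scale)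
  qed
qed

section \<open>The discrete spaces\<close>

context mesh
begin

abbreviation "V k \<equiv> scalar_space \<Omega> \<T> k"
abbreviation "Q k \<equiv> flux_space \<Omega> \<T> k"
abbreviation "W l \<equiv> trace_space \<Omega> \<E> l"

lemma cell_patch: "K \<in> \<T> \<Longrightarrow> patch lebesgue K"
  using cell by (intro patch_lebesgue)

lemma cell_faceD:
  assumes "F \<in> cell_faces \<E> K"
  shows "F \<in> \<E>" "F \<subseteq> frontier K" "patch (surface_measure F) F" "F \<in> sets borel" "bounded F"
proof -
  show F: "F \<in> \<E>" "F \<subseteq> frontier K" using assms by (auto simp: cell_faces_def)
  show "patch (surface_measure F) F" by (rule face_patch[OF F(1)])
  from patchD(3,5)[OF this] show "F \<in> sets borel" "bounded F" .
qed

lemma finite_cell_faces: "finite (cell_faces \<E> K)"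
  using finite_faces by (simp add: cell_faces_def)

lemma cell_prod_bilinear:
  assumes S: "subspace S" and R: "subspace R"
    and P: "\<And>K. K \<in> \<T> \<Longrightarrow> linear_fields S K P" and P': "\<And>K. K \<in> \<T> \<Longrightarrow> linear_fields R K P'"
  shows "bilinear_on S R (\<lambda>y z. cell_prod \<T> (P y) (P' z))"
proof -
  have comm: "cell_prod \<T> u v = cell_prod \<T> v u" for u v :: "real^'d \<Rightarrow> 'c::euclidean_space"
    by (simp add: cell_prod_def inner_commute)
  have "linear_on R (\<lambda>z. cell_prod \<T> (P' z) (P y))" if "y \<in> S" for y
    unfolding cell_prod_def using that
    by (intro linear_on_sum_fun linear_on_integral[OF cell_patch P' linear_fieldsD(1)[OF P] R]) auto
  moreover have "linear_on S (\<lambda>y. cell_prod \<T> (P y) (P' z))" if "z \<in> R" for z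
    unfolding cell_prod_def using that
    by (intro linear_on_sum_fun linear_on_integral[OF cell_patch P linear_fieldsD(1)[OF P'] S]) auto
  ultimately show ?thesis by (intro bilinear_onI) (simp_all add: comm)
qed

lemma bdry_prod_commute: "bdry_prod \<T> \<E> u v = bdry_prod \<T> \<E> v u"
  by (simp add: bdry_prod_def mult.commute)

lemma bdry_prod_bilinear:
  assumes S: "subspace S" and R: "subspace R"
    and P: "\<And>K F. K \<in> \<T> \<Longrightarrow> F \<in> cell_faces \<E> K \<Longrightarrow> linear_fields S F (\<lambda>z. P z K)"
    and P': "\<And>K F. K \<in> \<T> \<Longrightarrow> F \<in> cell_faces \<E> K \<Longrightarrow> linear_fields R F (\<lambda>z. P' z K)"
  shows "bilinear_on S R (\<lambda>y z. bdry_prod \<T> \<E> (P y) (P' z))"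
proof -
  have lin: "linear_on A (\<lambda>z. bdry_prod \<T> \<E> (p z) q)"
    if A: "subspace A"
      and p: "\<And>K F. K \<in> \<T> \<Longrightarrow> F \<in> cell_faces \<E> K \<Longrightarrow> linear_fields A F (\<lambda>z. p z K)"
      and q: "\<And>K F. K \<in> \<T> \<Longrightarrow> F \<in> cell_faces \<E> K \<Longrightarrow> bounded_borel F (q K)"
    for A :: "'e::real_vector set" and p q
    unfolding bdry_prod_def
  proof (intro linear_on_sum_fun)
    fix K F assume "K \<in> \<T>" "F \<in> cell_faces \<E> K"
    then show "linear_on A (\<lambda>z. LINT x:F|surface_measure F. p z K x * q K x)"
      using linear_on_integral[OF cell_faceD(3) p q A, of F K K K] by simp
  qed
  have "linear_on R (\<lambda>z. bdry_prod \<T> \<E> (P' z) (P y))" if "y \<in> S" for y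
    by (rule lin[OF R P' linear_fieldsD(1)[OF P that]])
  moreover have "linear_on S (\<lambda>y. bdry_prod \<T> \<E> (P y) (P' z))" if "z \<in> R" for z
    by (rule lin[OF S P linear_fieldsD(1)[OF P' that]])
  ultimately show ?thesis
    by (intro bilinear_onI) (simp_all add: bdry_prod_commute[of "P _"])
qed

text \<open>
  Functions in the discrete spaces are automatically square integrable on the domain: they vanish
  outside of the cells, which are finitely many disjoint subsets of the domain.
\<close>
lemma cellwise_L2:
  fixes v :: "real^'d \<Rightarrow> 'b::euclidean_space"
  assumes v: "\<And>K. K \<in> \<T> \<Longrightarrow> bounded_borel K v" and v0: "\<And>x. x \<notin> \<Union>\<T> \<Longrightarrow> v x = 0"
  shows "L2_on lebesgue \<Omega> v"
proof -
  have split: "indicator \<Omega> x *\<^sub>R g x = (\<Sum>K\<in>\<T>. indicator K x *\<^sub>R g x)"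
    if g: "\<And>x. x \<notin> \<Union>\<T> \<Longrightarrow> g x = 0" for g :: "real^'d \<Rightarrow> 'c::real_vector" and x
  proof (cases "x \<in> \<Union>\<T>")
    case True
    then obtain K where K: "K \<in> \<T>" "x \<in> K" by blast
    have "(\<Sum>K'\<in>\<T>. indicator K' x *\<^sub>R g x) = (\<Sum>K'\<in>{K}. indicator K' x *\<^sub>R g x)"
      using K disjoint_cells finite_cells
      by (intro sum.mono_neutral_right) (auto simp: pairwise_def disjnt_def indicator_def)
    moreover have "x \<in> \<Omega>" using K cell_subset by blast
    ultimately show ?thesis using K by simp
  next
    case False
    then show ?thesis using g by simp
  qed
  have "(\<lambda>x. \<Sum>K\<in>\<T>. indicator K x *\<^sub>R v x) \<in> borel_measurable lebesgue"
    using bounded_borel_measurable[OF cell_patch v] by (intro borel_measurable_sum)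
  moreover have "integrable lebesgue (\<lambda>x. \<Sum>K\<in>\<T>. indicator K x *\<^sub>R (norm (v x))\<^sup>2)"
  proof (rule Bochner_Integration.integrable_sum)
    fix K assume K: "K \<in> \<T>"
    show "integrable lebesgue (\<lambda>x. indicator K x *\<^sub>R (norm (v x))\<^sup>2)"
      using bounded_borel_set_integrable[OF cell_patch[OF K] bounded_borel_inner[OF v[OF K] v[OF K]]]
      by (simp add: set_integrable_def power2_norm_eq_inner)
  qed
  moreover have "(\<lambda>x. indicator \<Omega> x *\<^sub>R v x) = (\<lambda>x. \<Sum>K\<in>\<T>. indicator K x *\<^sub>R v x)"
    by (intro ext split v0)
  moreover have "(\<lambda>x. indicator \<Omega> x *\<^sub>R (norm (v x))\<^sup>2)
      = (\<lambda>x. \<Sum>K\<in>\<T>. indicator K x *\<^sub>R (norm (v x))\<^sup>2)"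
    by (intro ext split) (simp add: v0)
  ultimately show ?thesis
    unfolding L2_on_def set_borel_measurable_def set_integrable_def by simp
qed

lemma piecewise_polys_bounded_borel:
  assumes "v \<in> piecewise_polys m \<T>" "K \<in> \<T>"
  shows "bounded_borel K v"
proof (rule polynomial_on_bounded_borel)
  show "polynomial_on K v"
    by (rule polynomial_on_if_restrict0[where m = m]) (use assms in \<open>simp add: piecewise_polys_def\<close>)
qed (use cell(1,2)[OF assms(2)] in simp_all)

lemma scalar_space_eq: "V k = piecewise_polys k \<T>"
proof (intro set_eqI iffI)
  fix v assume "v \<in> piecewise_polys k \<T>"
  then show "v \<in> V k"
    using cellwise_L2[of v] piecewise_polys_bounded_borel[of v k]
    by (auto simp: scalar_space_def piecewise_polys_def)
qed (auto simp: scalar_space_def piecewise_polys_def)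

lemma flux_space_eq: "Q k = {r. \<forall>i. (\<lambda>x. r x $ i) \<in> piecewise_polys (k - 1) \<T>}"
proof (intro set_eqI iffI)
  fix r :: "real^'d \<Rightarrow> real^'d"
  assume "r \<in> {r. \<forall>i. (\<lambda>x. r x $ i) \<in> piecewise_polys (k - 1) \<T>}"
  then have r: "(\<lambda>x. r x $ i) \<in> piecewise_polys (k - 1) \<T>" for i by blast
  have "bounded_borel K (\<lambda>x. \<chi> i. r x $ i)" if "K \<in> \<T>" for K
    by (intro bounded_borel_vec_lambda piecewise_polys_bounded_borel[OF r that])
       (simp add: cell(1)[OF that])
  moreover have r0: "r x = 0" if "x \<notin> \<Union>\<T>" for x
    using r that by (auto simp: piecewise_polys_def vec_eq_iff)
  ultimately have "L2_on lebesgue \<Omega> r" by (intro cellwise_L2) simp_all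
  then show "r \<in> Q k" using r r0 by (auto simp: flux_space_def piecewise_polys_def)
qed (auto simp: flux_space_def piecewise_polys_def)

lemma findim_scalar: "findim (V k)"
  unfolding scalar_space_eq by (rule findim_piecewise_polys[OF finite_cells disjoint_cells])

lemma findim_flux: "findim (Q k)"
  unfolding flux_space_eq
  by (intro findim_componentwise findim_piecewise_polys finite_cells disjoint_cells)

lemma trace_space_eq:
  "W l = {\<mu> \<in> piecewise_polys l \<E>. \<forall>F\<in>\<E>. F \<subseteq> frontier \<Omega> \<longrightarrow> (\<forall>x\<in>F. \<mu> x = 0)}"
proof -
  have "L2_on (surface_measure F) F \<mu>" if F: "F \<in> \<E>" and \<mu>: "restrict0 F \<mu> \<in> polys_on l F" for F \<mu>
  proof -
    have bb: "bounded_borel F \<mu>"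
      using polynomial_on_bounded_borel[OF polynomial_on_if_restrict0[OF \<mu>]] patchD[OF face_patch[OF F]]
      by blast
    show ?thesis
      using bounded_borel_measurable[OF face_patch[OF F] bb]
        bounded_borel_set_integrable[OF face_patch[OF F] bounded_borel_mult[OF bb bb]]
      by (simp add: L2_on_def set_borel_measurable_def power2_eq_square)
  qed
  then show ?thesis by (auto simp: trace_space_def piecewise_polys_def)
qed

lemma findim_trace: "findim (W l)"
proof (rule findim_subspace)
  show pw: "findim (piecewise_polys l \<E>)"
    by (rule findim_piecewise_polys[OF finite_faces disjoint_faces])
  then have "subspace (piecewise_polys l \<E>)" by (simp add: findim_def)
  then show "subspace (W l)"
    unfolding trace_space_eq
    by (intro subspaceI) (simp_all add: subspace_0 subspace_add subspace_scale)
qed (auto simp: trace_space_eq)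

lemmas subspace_scalar = findim_scalar[unfolded findim_def, THEN conjunct1]
  and subspace_flux = findim_flux[unfolded findim_def, THEN conjunct1]
  and subspace_trace = findim_trace[unfolded findim_def, THEN conjunct1]

lemma scalar_polynomial: "v \<in> V k \<Longrightarrow> K \<in> \<T> \<Longrightarrow> polynomial_on K v"
  by (auto simp: scalar_space_def intro: polynomial_on_if_restrict0)

lemma flux_polynomial: "r \<in> Q k \<Longrightarrow> K \<in> \<T> \<Longrightarrow> polynomial_on K (\<lambda>x. r x $ i)"
  by (auto simp: flux_space_def intro: polynomial_on_if_restrict0)

lemma trace_polynomial: "\<mu> \<in> W l \<Longrightarrow> F \<in> \<E> \<Longrightarrow> polynomial_on F \<mu>"
  by (auto simp: trace_space_def intro: polynomial_on_if_restrict0)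

lemma scalar_fields:
  assumes K: "K \<in> \<T>"
  shows "linear_fields (V k) K (\<lambda>v. v)" "linear_fields (V k) K grad"
proof -
  note poly = scalar_polynomial[OF _ K]
  show "linear_fields (V k) K (\<lambda>v. v)"
  proof (rule linear_fieldsI)
    show "bounded_borel K v" if "v \<in> V k" for v
      using cell(1,2)[OF K] by (intro polynomial_on_bounded_borel poly[OF that]) auto
  qed (simp add: linear_onI)
  show "linear_fields (V k) K grad"
    using cell(1,2)[OF K] poly by (rule grad_linear_fields)
qed

lemma scalar_trace_fields:
  assumes K: "K \<in> \<T>" and F: "F \<in> cell_faces \<E> K"
  shows "linear_fields (V k) F (trace_from K)"
  using cell(1)[OF K] cell_faceD(2,4,5)[OF F] scalar_polynomial[OF _ K] by (rule trace_linear_fields)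

lemma trace_fields:
  assumes F: "F \<in> cell_faces \<E> K"
  shows "linear_fields (W l) F (\<lambda>\<mu>. \<mu>)"
proof (rule linear_fieldsI)
  show "bounded_borel F \<mu>" if "\<mu> \<in> W l" for \<mu>
    by (rule polynomial_on_bounded_borel[OF trace_polynomial[OF that] cell_faceD(4,5)[OF F]])
      (rule cell_faceD(1)[OF F])
qed (simp add: linear_onI)

lemma flux_fields:
  assumes K: "K \<in> \<T>"
  shows "linear_fields (Q k) K (\<lambda>r. r)" "linear_fields (Q k) K divergence"
proof -
  let ?C = "piecewise_polys (k - 1) \<T>"
  have comp: "(\<lambda>x. r x $ i) \<in> ?C" if "r \<in> Q k" for r i using that by (auto simp: flux_space_eq)
  have poly: "polynomial_on K v" if "v \<in> ?C" for v
    using that K by (auto simp: piecewise_polys_def intro: polynomial_on_if_restrict0)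
  note KB = borel_open[OF cell(1)[OF K]]
  have "linear_fields ?C K (\<lambda>v. v)"
    by (rule linear_fieldsI) (simp_all add: linear_onI piecewise_polys_bounded_borel[OF _ K])
  then have "linear_fields (Q k) K (\<lambda>r x. r x $ i)" for i
    by (rule linear_fields_components) (rule comp)
  then have "linear_fields (Q k) K (\<lambda>r x. \<chi> i. r x $ i)"
    by (rule linear_fields_vec_lambda[OF _ KB])
  then show "linear_fields (Q k) K (\<lambda>r. r)" by simp
  have "linear_fields ?C K (\<lambda>v x. frechet_derivative v (at x) h)" for h
    using cell(1,2)[OF K] poly by (rule partial_derivative_linear_fields)
  then have "linear_fields (Q k) K (\<lambda>r x. frechet_derivative (\<lambda>y. r y $ i) (at x) (axis i 1))" for i
    by (rule linear_fields_components[where \<Phi> = "\<lambda>v x. frechet_derivative v (at x) (axis i 1)"]) (rule comp)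
  then show "linear_fields (Q k) K divergence"
    unfolding divergence_def[abs_def] by (rule linear_fields_sum[OF _ KB])
qed

lemma normal_bounded_borel:
  assumes K: "K \<in> \<T>" and F: "F \<in> cell_faces \<E> K"
  shows "bounded_borel F (outward_normal K)"
  using bounded_borel_outward_normal[OF cell(1)[OF K] cell_faceD(2,4)[OF F]] .

lemma flux_trace_fields:
  assumes K: "K \<in> \<T>" and F: "F \<in> cell_faces \<E> K"
  shows "linear_fields (Q k) F (\<lambda>r x. trace_from K r x \<bullet> outward_normal K x)"
proof (rule linear_fields_inner_left[OF _ normal_bounded_borel[OF K F]])
  let ?C = "piecewise_polys (k - 1) \<T>"
  have comp: "(\<lambda>x. r x $ i) \<in> ?C" if "r \<in> Q k" for r i using that by (auto simp: flux_space_eq)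
  have "linear_fields ?C F (trace_from K)"
    using cell(1)[OF K] cell_faceD(2,4,5)[OF F]
    by (rule trace_linear_fields) (use K in \<open>auto simp: piecewise_polys_def intro: polynomial_on_if_restrict0\<close>)
  then have "linear_fields (Q k) F (\<lambda>r x. trace_from K (\<lambda>y. r y $ i) x)" for i
    by (rule linear_fields_components[where \<Phi> = "trace_from K"]) (rule comp)
  then have "linear_fields (Q k) F (\<lambda>r x. \<chi> i. trace_from K (\<lambda>y. r y $ i) x)"
    by (rule linear_fields_vec_lambda[OF _ cell_faceD(4)[OF F]])
  then show "linear_fields (Q k) F (trace_from K)"
  proof (rule linear_fields_cong[OF _ subspace_flux, rotated])
    fix r x assume "r \<in> Q k" "x \<in> F"
    then show "trace_from K r x = (\<chi> i. trace_from K (\<lambda>y. r y $ i) x)"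
      using cell_faceD(2)[OF F] by (intro vector_trace[OF cell(1)[OF K]] flux_polynomial[OF _ K]) auto
  qed
qed

text \<open>
  The faces are disjoint and each local projection vanishes outside of its own face.
\<close>
lemma face_proj_eq:
  assumes K: "K \<in> \<T>" and F: "F \<in> cell_faces \<E> K" and v: "v \<in> V k" and x: "x \<in> F"
  shows "face_proj \<E> l K v x = L2_proj (surface_measure F) l F (trace_from K v) x"
proof -
  have "L2_proj (surface_measure F') l F' (trace_from K v) x = 0"
    if F': "F' \<in> cell_faces \<E> K" "F' \<noteq> F" for F'
  proof -
    have "x \<notin> F'"
      using disjoint_faces cell_faceD(1)[OF F] cell_faceD(1)[OF F'(1)] F'(2) x
      by (auto simp: pairwise_def disjnt_def)
    moreover have "L2_proj (surface_measure F') l F' (trace_from K v) \<in> polys_on l F'"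
      using L2_proj_characterization(1)[OF cell_faceD(3)[OF F'(1)] bounded_borel_set_integrable[OF cell_faceD(3)[OF F'(1)]
            linear_fieldsD(1)[OF scalar_trace_fields[OF K F'(1)] v]]] .
    ultimately show ?thesis by (auto simp: polys_on_def restrict0_def)
  qed
  then have "face_proj \<E> l K v x
      = (\<Sum>F'\<in>{F}. L2_proj (surface_measure F') l F' (trace_from K v) x)"
    unfolding face_proj_def using F finite_cell_faces by (intro sum.mono_neutral_right) auto
  then show ?thesis by simp
qed

lemma face_proj_fields:
  assumes K: "K \<in> \<T>" and F: "F \<in> cell_faces \<E> K"
  shows "linear_fields (V k) F (face_proj \<E> l K)"
  by (rule linear_fields_cong[OF face_proj_eq[OF K F] subspace_scalar
        L2_proj_linear_fields[OF cell_faceD(3)[OF F] scalar_trace_fields[OF K F] subspace_scalar]])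

end

section \<open>The diffusion form\<close>

lemma bilinear_on_compose:
  assumes f: "bilinear_on A B f" and p: "linear_on S p" "\<And>y. y \<in> S \<Longrightarrow> p y \<in> A"
    and q: "linear_on R q" "\<And>z. z \<in> R \<Longrightarrow> q z \<in> B"
  shows "bilinear_on S R (\<lambda>y z. f (p y) (q z))"
proof (rule bilinear_onI)
  show "linear_on R (\<lambda>z. f (p y) (q z))" if "y \<in> S" for y
    using linear_onD[OF bilinear_onD(1)[OF f p(2)[OF that]]] linear_onD[OF q(1)] q(2)
    by (intro linear_onI) auto
  show "linear_on S (\<lambda>y. f (p y) (q z))" if "z \<in> R" for z
    using linear_onD[OF bilinear_onD(2)[OF f q(2)[OF that]]] linear_onD[OF p(1)] p(2)
    by (intro linear_onI) auto
qed

lemma linear_on_fst: "linear_on S fst" and linear_on_snd: "linear_on S snd"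
  by (simp_all add: linear_on_def)

context mesh
begin

lemma cell_prod_commute: "cell_prod \<T> u v = cell_prod \<T> v u"
  by (simp add: cell_prod_def inner_commute)

lemma cell_prod_self_nonneg: "0 \<le> cell_prod \<T> v v"
  unfolding cell_prod_def set_lebesgue_integral_def
  by (intro sum_nonneg integral_nonneg_AE) simp

lemma cell_prod_self_pos:
  assumes K: "K \<in> \<T>" and p: "continuous_on UNIV p" "\<And>x. x \<in> K \<Longrightarrow> v x = p x" and x: "x \<in> K" "v x \<noteq> 0"
  shows "0 < cell_prod \<T> v v"
proof -
  have nonneg: "0 \<le> (LINT x:K'|lebesgue. v x \<bullet> v x)" for K'
    unfolding set_lebesgue_integral_def by (intro integral_nonneg_AE) simp
  have "(LINT x:K|lebesgue. v x \<bullet> v x) \<noteq> 0"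
    using integral_square_zero_imp_zero[OF cell_patch[OF K] p] x by blast
  then have "0 < (LINT x:K|lebesgue. v x \<bullet> v x)" using nonneg[of K] by simp
  also have "\<dots> \<le> cell_prod \<T> v v"
    unfolding cell_prod_def using K finite_cells nonneg by (intro member_le_sum) auto
  finally show ?thesis .
qed

lemma inner_product_scalar: "inner_product_on (V k) (cell_prod \<T>)"
proof -
  have "0 < cell_prod \<T> v v" if v: "v \<in> V k" "v \<noteq> 0" for v
  proof -
    obtain x where x: "v x \<noteq> 0" using v(2) by (auto simp: fun_eq_iff)
    then obtain K where K: "K \<in> \<T>" "x \<in> K" using v(1) unfolding scalar_space_def by blast
    obtain p where p: "real_polynomial_function p" "\<And>y. y \<in> K \<Longrightarrow> v y = p y"
      using scalar_polynomial[OF v(1) K(1)] by (auto simp: polynomial_on_def)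
    show ?thesis by (rule cell_prod_self_pos[OF K(1) real_polynomial_continuous[OF p(1)] p(2) K(2) x])
  qed
  then show ?thesis
    unfolding inner_product_on_def
    using cell_prod_bilinear[OF subspace_scalar subspace_scalar scalar_fields(1) scalar_fields(1)]
      cell_prod_commute by auto
qed

lemma inner_product_flux: "inner_product_on (Q k) (cell_prod \<T>)"
proof -
  have "0 < cell_prod \<T> r r" if r: "r \<in> Q k" "r \<noteq> 0" for r
  proof -
    obtain x where x: "r x \<noteq> 0" using r(2) by (auto simp: fun_eq_iff)
    then obtain K where K: "K \<in> \<T>" "x \<in> K" using r(1) unfolding flux_space_def by blast
    obtain p where p: "\<And>i. real_polynomial_function (p i)" "\<And>i y. y \<in> K \<Longrightarrow> r y $ i = p i y"
      using flux_polynomial[OF r(1) K(1)] unfolding polynomial_on_def by metis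
    have "continuous_on UNIV (\<lambda>y. \<chi> i. p i y)"
      using p(1) by (intro continuous_on_vec_lambda real_polynomial_continuous)
    then show ?thesis
    proof (rule cell_prod_self_pos[OF K(1)])
      show "r y = (\<chi> i. p i y)" if "y \<in> K" for y using p(2)[OF that] by (simp add: vec_eq_iff)
      show "x \<in> K" "r x \<noteq> 0" by fact+
    qed
  qed
  then show ?thesis
    unfolding inner_product_on_def
    using cell_prod_bilinear[OF subspace_flux subspace_flux flux_fields(1) flux_fields(1)]
      cell_prod_commute by auto
qed

lemma subspace_pairs: "subspace (V k \<times> W l)"
  by (intro subspace_Times subspace_scalar subspace_trace)

text \<open>
  The functional that \<open>hdg_K w \<mu>\<close> represents.
\<close>
definition flux_load :: "(real^'d \<Rightarrow> real) \<Rightarrow> (real^'d \<Rightarrow> real) \<Rightarrow> (real^'d \<Rightarrow> real^'d) \<Rightarrow> real" where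
  "flux_load w \<mu> r = - cell_prod \<T> w (divergence r)
     + bdry_prod \<T> \<E> (\<lambda>K. \<mu>) (\<lambda>K x. trace_from K r x \<bullet> outward_normal K x)"

lemma flux_load_bilinear:
  "bilinear_on (V k \<times> W l) (Q k) (\<lambda>z. flux_load (fst z) (snd z))"
proof -
  have "bilinear_on (V k \<times> W l) (Q k) (\<lambda>z r. (-1) * cell_prod \<T> (fst z) (divergence r)
     + 1 * bdry_prod \<T> \<E> (\<lambda>K. snd z) (\<lambda>K x. trace_from K r x \<bullet> outward_normal K x))"
    by (intro bilinear_on_combine cell_prod_bilinear bdry_prod_bilinear subspace_pairs subspace_flux
        linear_fields_fst linear_fields_snd scalar_fields flux_fields trace_fields flux_trace_fields)
  then show ?thesis by (simp add: flux_load_def[abs_def])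
qed

lemma hdg_K_ex1:
  assumes "w \<in> V k" "\<mu> \<in> W l"
  shows "\<exists>!q. q \<in> Q k \<and> (\<forall>r\<in>Q k. cell_prod \<T> q r = flux_load w \<mu> r)"
  using bilinear_onD(1)[OF flux_load_bilinear, of "(w, \<mu>)"] assms
  by (intro riesz_representation findim_flux inner_product_flux) simp

lemma hdg_K_representer:
  assumes "w \<in> V k" "\<mu> \<in> W l"
  shows "hdg_K \<Omega> \<T> \<E> k w \<mu> \<in> Q k"
    and "r \<in> Q k \<Longrightarrow> cell_prod \<T> (hdg_K \<Omega> \<T> \<E> k w \<mu>) r = flux_load w \<mu> r"
    and "\<lbrakk>q \<in> Q k; \<And>r. r \<in> Q k \<Longrightarrow> cell_prod \<T> q r = flux_load w \<mu> r\<rbrakk> \<Longrightarrow> hdg_K \<Omega> \<T> \<E> k w \<mu> = q"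
proof -
  let ?P = "\<lambda>q. q \<in> Q k \<and> (\<forall>r\<in>Q k. cell_prod \<T> q r = flux_load w \<mu> r)"
  have K: "hdg_K \<Omega> \<T> \<E> k w \<mu> = The ?P" by (simp add: hdg_K_def flux_load_def)
  note ex1 = hdg_K_ex1[OF assms]
  show "hdg_K \<Omega> \<T> \<E> k w \<mu> \<in> Q k"
    and "r \<in> Q k \<Longrightarrow> cell_prod \<T> (hdg_K \<Omega> \<T> \<E> k w \<mu>) r = flux_load w \<mu> r"
    using theI'[OF ex1] by (auto simp: K)
  show "hdg_K \<Omega> \<T> \<E> k w \<mu> = q" if "q \<in> Q k" "\<And>r. r \<in> Q k \<Longrightarrow> cell_prod \<T> q r = flux_load w \<mu> r"
    unfolding K by (rule the1_equality[OF ex1]) (use that in blast)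
qed

text \<open>
  Sums and multiples of representers represent the sums and multiples of the functionals.
\<close>
lemma hdg_K_linear: "linear_on (V k \<times> W l) (\<lambda>z. hdg_K \<Omega> \<T> \<E> k (fst z) (snd z))"
proof -
  note inner = inner_product_flux[of k, unfolded inner_product_on_def, THEN conjunct1]
  note load = linear_onD[OF bilinear_onD(2)[OF flux_load_bilinear[of k l]]]
  note prod = linear_onD[OF bilinear_onD(2)[OF inner]]
  show ?thesis
  proof (rule linear_onI)
    fix y z assume "y \<in> V k \<times> W l" "z \<in> V k \<times> W l"
    then have yz: "fst y \<in> V k" "snd y \<in> W l" "fst z \<in> V k" "snd z \<in> W l" by auto
    show "hdg_K \<Omega> \<T> \<E> k (fst (y + z)) (snd (y + z))
        = hdg_K \<Omega> \<T> \<E> k (fst y) (snd y) + hdg_K \<Omega> \<T> \<E> k (fst z) (snd z)"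
    proof (rule hdg_K_representer(3))
      show "fst (y + z) \<in> V k" "snd (y + z) \<in> W l"
        using yz by (simp_all add: subspace_add[OF subspace_scalar] subspace_add[OF subspace_trace])
      show "hdg_K \<Omega> \<T> \<E> k (fst y) (snd y) + hdg_K \<Omega> \<T> \<E> k (fst z) (snd z) \<in> Q k"
        using yz by (intro subspace_add[OF subspace_flux] hdg_K_representer(1))
      show "cell_prod \<T> (hdg_K \<Omega> \<T> \<E> k (fst y) (snd y) + hdg_K \<Omega> \<T> \<E> k (fst z) (snd z)) r
          = flux_load (fst (y + z)) (snd (y + z)) r" if r: "r \<in> Q k" for r
        using prod(1)[OF r hdg_K_representer(1)[OF yz(1,2)] hdg_K_representer(1)[OF yz(3,4)]] load(1)[OF r, of y z]
          hdg_K_representer(2)[OF yz(1,2) r] hdg_K_representer(2)[OF yz(3,4) r] \<open>y \<in> _\<close> \<open>z \<in> _\<close> by simp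
    qed
  next
    fix c z assume "z \<in> V k \<times> W l"
    then have z: "fst z \<in> V k" "snd z \<in> W l" by auto
    show "hdg_K \<Omega> \<T> \<E> k (fst (c *\<^sub>R z)) (snd (c *\<^sub>R z)) = c *\<^sub>R hdg_K \<Omega> \<T> \<E> k (fst z) (snd z)"
    proof (rule hdg_K_representer(3))
      show "fst (c *\<^sub>R z) \<in> V k" "snd (c *\<^sub>R z) \<in> W l"
        using z by (simp_all add: subspace_scale[OF subspace_scalar] subspace_scale[OF subspace_trace])
      show "c *\<^sub>R hdg_K \<Omega> \<T> \<E> k (fst z) (snd z) \<in> Q k"
        using z by (intro subspace_scale[OF subspace_flux] hdg_K_representer(1))
      show "cell_prod \<T> (c *\<^sub>R hdg_K \<Omega> \<T> \<E> k (fst z) (snd z)) r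
          = flux_load (fst (c *\<^sub>R z)) (snd (c *\<^sub>R z)) r" if r: "r \<in> Q k" for r
        using prod(2)[OF r hdg_K_representer(1)[OF z]] load(2)[OF r, of z c]
          hdg_K_representer(2)[OF z r] \<open>z \<in> _\<close> by simp
    qed
  qed
qed

lemma hdg_K_fields:
  assumes K: "K \<in> \<T>"
  shows "linear_fields (V k \<times> W l) K (\<lambda>z. hdg_K \<Omega> \<T> \<E> k (fst z) (snd z))"
proof (rule linear_fieldsI)
  show "bounded_borel K (hdg_K \<Omega> \<T> \<E> k (fst z) (snd z))" if "z \<in> V k \<times> W l" for z
    using that by (intro linear_fieldsD(1)[OF flux_fields(1)[OF K, of k]] hdg_K_representer(1)) auto
  show "linear_on (V k \<times> W l) (\<lambda>z. hdg_K \<Omega> \<T> \<E> k (fst z) (snd z) x)" for x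
    using linear_onD[OF hdg_K_linear[of k l]] by (intro linear_onI) simp_all
qed

definition diffusion_form :: "nat \<Rightarrow> nat \<Rightarrow> real \<Rightarrow> (real^'d \<Rightarrow> real) \<times> (real^'d \<Rightarrow> real) \<Rightarrow>
    (real^'d \<Rightarrow> real) \<times> (real^'d \<Rightarrow> real) \<Rightarrow> real" where
  "diffusion_form k l \<nu> y z =
     \<nu> * cell_prod \<T> (hdg_K \<Omega> \<T> \<E> k (fst y) (snd y)) (hdg_K \<Omega> \<T> \<E> k (fst z) (snd z))
     + hdg_S \<T> \<E> l \<nu> (fst y) (snd y) (fst z) (snd z)"

text \<open>
  The stabilization penalizes this difference between the projected trace from the cell and the
  numerical trace; it is linear in the pair of both.
\<close>
definition jump :: "nat \<Rightarrow> (real^'d \<Rightarrow> real) \<times> (real^'d \<Rightarrow> real) \<Rightarrow> (real^'d) set \<Rightarrow> real^'d \<Rightarrow> real" where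
  "jump l z K x = face_proj \<E> l K (fst z) x - snd z x"

lemma hdg_S_jump:
  "hdg_S \<T> \<E> l \<nu> (fst y) (snd y) (fst z) (snd z)
    = \<nu> * bdry_prod \<T> \<E> (\<lambda>K x. inverse (cell_size K) * jump l y K x) (jump l z)"
  by (simp add: hdg_S_def jump_def[abs_def])

lemma jump_fields:
  assumes "K \<in> \<T>" "F \<in> cell_faces \<E> K"
  shows "linear_fields (V k \<times> W l) F (\<lambda>z. jump l z K)"
  unfolding jump_def
  by (intro linear_fields_diff linear_fields_fst linear_fields_snd face_proj_fields trace_fields
      cell_faceD(4) assms) (rule assms)+

lemma diffusion_bilinear:
  "bilinear_on (V k \<times> W l) (V k \<times> W l) (diffusion_form k l \<nu>)"
proof -
  have "linear_fields (V k \<times> W l) F (\<lambda>z x. inverse (cell_size K) * jump l z K x)"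
    if "K \<in> \<T>" "F \<in> cell_faces \<E> K" for K F
    using linear_fields_mult_right[OF jump_fields[OF that] bounded_borel_const[OF cell_faceD(4)[OF that(2)]]] .
  then have "bilinear_on (V k \<times> W l) (V k \<times> W l)
      (\<lambda>y z. \<nu> * cell_prod \<T> (hdg_K \<Omega> \<T> \<E> k (fst y) (snd y)) (hdg_K \<Omega> \<T> \<E> k (fst z) (snd z))
       + \<nu> * bdry_prod \<T> \<E> (\<lambda>K x. inverse (cell_size K) * jump l y K x) (jump l z))"
    by (intro bilinear_on_combine cell_prod_bilinear bdry_prod_bilinear subspace_pairs hdg_K_fields
        jump_fields)
  then show ?thesis by (simp add: diffusion_form_def[abs_def] hdg_S_jump)
qed

lemma diffusion_sym: "diffusion_form k l \<nu> y z = diffusion_form k l \<nu> z y"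
  by (simp add: diffusion_form_def hdg_S_jump bdry_prod_def mult_ac
      cell_prod_commute[of "hdg_K \<Omega> \<T> \<E> k (fst y) (snd y)"])

lemma jump_term_nonneg:
  assumes "K \<in> \<T>"
  shows "0 \<le> (LINT x:F|surface_measure F. (inverse (cell_size K) * jump l z K x) * jump l z K x)"
proof -
  have "0 < cell_size K" using cell[OF assms] by (rule cell_size_pos)
  then have "0 \<le> (inverse (cell_size K) * jump l z K x) * jump l z K x" for x
    by (simp add: mult.assoc)
  then show ?thesis
    unfolding set_lebesgue_integral_def by (intro integral_nonneg_AE) simp
qed

lemma diffusion_nonneg:
  assumes "0 < \<nu>"
  shows "0 \<le> diffusion_form k l \<nu> z z"
  unfolding diffusion_form_def hdg_S_jump bdry_prod_def
  using assms by (intro add_nonneg_nonneg mult_nonneg_nonneg sum_nonneg cell_prod_self_nonneg jump_term_nonneg) auto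

text \<open>
  For a pair \<open>(0, \<mu>)\<close> the jump is \<open>- \<mu>\<close>, so on a face where \<open>\<mu>\<close> does not vanish the stabilization is the
  integral of \<open>\<mu>\<^sup>2\<close> with the positive weight \<open>1 / h\<^sub>K\<close>.  Every face belongs to some cell.
\<close>
lemma diffusion_pos:
  assumes \<nu>: "0 < \<nu>" and \<mu>: "\<mu> \<in> W l" "\<mu> \<noteq> 0"
  shows "0 < diffusion_form k l \<nu> (0, \<mu>) (0, \<mu>)"
proof -
  let ?z = "(0, \<mu>) :: (real^'d \<Rightarrow> real) \<times> (real^'d \<Rightarrow> real)"
  let ?I = "\<lambda>K F. LINT x:F|surface_measure F. (inverse (cell_size K) * jump l ?z K x) * jump l ?z K x"
  obtain x where x: "\<mu> x \<noteq> 0" using \<mu>(2) by (auto simp: fun_eq_iff)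
  then obtain F where F: "F \<in> \<E>" "x \<in> F" using \<mu>(1) unfolding trace_space_def by blast
  obtain K where K: "K \<in> \<T>" "F \<in> cell_faces \<E> K" using face_of_cell[OF F(1)] by blast
  obtain p where p: "real_polynomial_function p" "\<And>y. y \<in> F \<Longrightarrow> \<mu> y = p y"
    using trace_polynomial[OF \<mu>(1) F(1)] by (auto simp: polynomial_on_def)
  have jump: "jump l ?z K y = - \<mu> y" if "y \<in> F" for y
    using linear_on_zero[OF linear_fieldsD(2)[OF face_proj_fields[OF K] that] subspace_0[OF subspace_scalar]]
    by (simp add: jump_def)
  have size: "0 < cell_size K" using cell[OF K(1)] by (rule cell_size_pos)
  have "?I K F = (LINT y:F|surface_measure F. inverse (cell_size K) * (\<mu> y * \<mu> y))"
    using jump patchD(4)[OF cell_faceD(3)[OF K(2)]]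
    by (intro set_lebesgue_integral_cong) (auto simp: mult.assoc)
  also have "\<dots> = inverse (cell_size K) * (LINT y:F|surface_measure F. \<mu> y \<bullet> \<mu> y)"
    by simp
  also have "\<dots> \<noteq> 0"
    using integral_square_zero_imp_zero[OF face_patch[OF F(1)] real_polynomial_continuous[OF p(1)] p(2) _ F(2)] x size
    by auto
  finally have "0 < ?I K F" using jump_term_nonneg[OF K(1), of F l ?z] by linarith
  also have "?I K F \<le> (\<Sum>F\<in>cell_faces \<E> K. ?I K F)"
    using K jump_term_nonneg[OF K(1)] finite_cell_faces by (intro member_le_sum) auto
  also have "\<dots> \<le> (\<Sum>K\<in>\<T>. \<Sum>F\<in>cell_faces \<E> K. ?I K F)"
    using K jump_term_nonneg finite_cells
    by (intro member_le_sum[where f = "\<lambda>K. \<Sum>F\<in>cell_faces \<E> K. ?I K F"] sum_nonneg) auto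
  finally have "0 < bdry_prod \<T> \<E> (\<lambda>K x. inverse (cell_size K) * jump l ?z K x) (jump l ?z)"
    by (simp add: bdry_prod_def)
  then show ?thesis
    using \<nu> cell_prod_self_nonneg unfolding diffusion_form_def hdg_S_jump
    by (intro add_nonneg_pos mult_pos_pos mult_nonneg_nonneg) auto
qed

end

section \<open>The convection form\<close>

context mesh
begin

definition normal_flux :: "(real^'d \<Rightarrow> real) \<Rightarrow> (real^'d) set \<Rightarrow> real^'d \<Rightarrow> real" where
  "normal_flux v K x = vec (trace_from K v x) \<bullet> outward_normal K x"

definition convection_form :: "(real^'d \<Rightarrow> real) \<Rightarrow> (real^'d \<Rightarrow> real) \<times> (real^'d \<Rightarrow> real) \<Rightarrow>
    (real^'d \<Rightarrow> real) \<times> (real^'d \<Rightarrow> real) \<Rightarrow> real" where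
  "convection_form v y z = hdg_B \<T> \<E> v (fst y) (snd y) (fst z) (snd z)"

definition convection_cell_test where "convection_cell_test v u w = cell_prod \<T> (\<lambda>x. u x *\<^sub>R (vec (v x) :: real^'d)) (grad w)"
definition convection_cell_trial where "convection_cell_trial v u w = cell_prod \<T> (\<lambda>x. vec (v x) \<bullet> grad u x) w"
definition convection_face_test where "convection_face_test v u \<mu> =
  bdry_prod \<T> \<E> (\<lambda>K x. normal_flux v K x * trace_from K u x) (\<lambda>K. \<mu>)"
definition convection_face_trial where "convection_face_trial v \<zeta> w =
  bdry_prod \<T> \<E> (\<lambda>K x. normal_flux v K x * \<zeta> x) (\<lambda>K. trace_from K w)"

lemma convection_split:
  "convection_form v y z
    = (-1/3) * convection_cell_test v (fst y) (fst z) + (1/3) * convection_cell_trial v (fst y) (fst z)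
      + (-1/3) * convection_face_test v (fst y) (snd z) + (1/3) * convection_face_trial v (snd y) (fst z)"
  by (simp add: convection_form_def hdg_B_def convection_cell_test_def convection_cell_trial_def convection_face_test_def convection_face_trial_def normal_flux_def)

lemma vec_fields:
  assumes "K \<in> \<T>"
  shows "linear_fields (V k) K (\<lambda>v x. vec (v x) :: real^'d)"
  using linear_fields_vec[OF scalar_fields(1)[OF assms]] cell(1)[OF assms] by simp

lemma normal_flux_fields:
  assumes "K \<in> \<T>" "F \<in> cell_faces \<E> K"
  shows "linear_fields (V k) F (\<lambda>v. normal_flux v K)"
  unfolding normal_flux_def
  by (intro linear_fields_inner_left linear_fields_vec scalar_trace_fields normal_bounded_borel
      cell_faceD(4)) (rule assms)+

lemma conv_bilinear:
  assumes v: "v \<in> V k"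
  shows "bilinear_on (V k) (V k) (convection_cell_test v)" "bilinear_on (V k) (V k) (convection_cell_trial v)"
    "bilinear_on (V k) (W l) (convection_face_test v)" "bilinear_on (W l) (V k) (convection_face_trial v)"
proof -
  note vecv = linear_fieldsD(1)[OF vec_fields v] and fluxv = linear_fieldsD(1)[OF normal_flux_fields v]
  show "bilinear_on (V k) (V k) (convection_cell_test v)"
    unfolding convection_cell_test_def
    by (intro cell_prod_bilinear subspace_scalar linear_fields_scaleR_left scalar_fields vecv)
  show "bilinear_on (V k) (V k) (convection_cell_trial v)"
    unfolding convection_cell_trial_def
    by (intro cell_prod_bilinear subspace_scalar linear_fields_inner_right scalar_fields vecv)
  show "bilinear_on (V k) (W l) (convection_face_test v)"
    unfolding convection_face_test_def
    by (intro bdry_prod_bilinear subspace_scalar subspace_trace linear_fields_mult_right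
        scalar_trace_fields trace_fields fluxv)
  show "bilinear_on (W l) (V k) (convection_face_trial v)"
    unfolding convection_face_trial_def
    by (intro bdry_prod_bilinear subspace_scalar subspace_trace linear_fields_mult_right
        scalar_trace_fields trace_fields fluxv)
qed

lemma conv_linear:
  assumes u: "u \<in> V k" and w: "w \<in> V k" and \<zeta>: "\<zeta> \<in> W l" and \<mu>: "\<mu> \<in> W l"
  shows "linear_on (V k) (\<lambda>v. convection_cell_test v u w)" "linear_on (V k) (\<lambda>v. convection_cell_trial v u w)"
    "linear_on (V k) (\<lambda>v. convection_face_test v u \<mu>)" "linear_on (V k) (\<lambda>v. convection_face_trial v \<zeta> w)"
proof -
  note bu = linear_fieldsD(1)[OF scalar_fields(1) u] linear_fieldsD(1)[OF scalar_fields(2) u]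
    linear_fieldsD(1)[OF scalar_trace_fields u] linear_fieldsD(1)[OF trace_fields \<zeta>]
  have "bilinear_on (V k) (V k) (\<lambda>v w. cell_prod \<T> (\<lambda>x. u x *\<^sub>R (vec (v x) :: real^'d)) (grad w))"
    by (intro cell_prod_bilinear subspace_scalar linear_fields_scaleR_right scalar_fields vec_fields bu)
  from bilinear_onD(2)[OF this w] show "linear_on (V k) (\<lambda>v. convection_cell_test v u w)" by (simp add: convection_cell_test_def)
  have "bilinear_on (V k) (V k) (\<lambda>v w. cell_prod \<T> (\<lambda>x. vec (v x) \<bullet> grad u x) w)"
    by (intro cell_prod_bilinear subspace_scalar linear_fields_inner_left scalar_fields vec_fields bu)
  from bilinear_onD(2)[OF this w] show "linear_on (V k) (\<lambda>v. convection_cell_trial v u w)" by (simp add: convection_cell_trial_def)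
  have "bilinear_on (V k) (W l)
      (\<lambda>v \<mu>. bdry_prod \<T> \<E> (\<lambda>K x. normal_flux v K x * trace_from K u x) (\<lambda>K. \<mu>))"
    by (intro bdry_prod_bilinear subspace_scalar subspace_trace linear_fields_mult_left
        normal_flux_fields trace_fields bu)
  from bilinear_onD(2)[OF this \<mu>] show "linear_on (V k) (\<lambda>v. convection_face_test v u \<mu>)" by (simp add: convection_face_test_def)
  have "bilinear_on (V k) (V k)
      (\<lambda>v w. bdry_prod \<T> \<E> (\<lambda>K x. normal_flux v K x * \<zeta> x) (\<lambda>K. trace_from K w))"
    by (intro bdry_prod_bilinear subspace_scalar subspace_trace linear_fields_mult_left
        normal_flux_fields scalar_trace_fields bu)
  from bilinear_onD(2)[OF this w] show "linear_on (V k) (\<lambda>v. convection_face_trial v \<zeta> w)" by (simp add: convection_face_trial_def)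
qed

lemma convection_bilinear:
  assumes v: "v \<in> V k"
  shows "bilinear_on (V k \<times> W l) (V k \<times> W l) (convection_form v)"
proof -
  note c = conv_bilinear[OF v]
  note lift = bilinear_on_compose[OF _ linear_on_fst _ linear_on_fst]
    bilinear_on_compose[OF _ linear_on_fst _ linear_on_snd]
    bilinear_on_compose[OF _ linear_on_snd _ linear_on_fst]
  let ?S = "V k \<times> W l"
  have lifted:
    "bilinear_on ?S ?S (\<lambda>y z. convection_cell_test v (fst y) (fst z))"
    "bilinear_on ?S ?S (\<lambda>y z. convection_cell_trial v (fst y) (fst z))"
    "bilinear_on ?S ?S (\<lambda>y z. convection_face_test v (fst y) (snd z))"
    "bilinear_on ?S ?S (\<lambda>y z. convection_face_trial v (snd y) (fst z))"
    by (rule lift(1)[OF c(1)] lift(1)[OF c(2)] lift(2)[OF c(3)[where l = l]] lift(3)[OF c(4)[where l = l]]; auto)+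
  have "bilinear_on ?S ?S (\<lambda>y z. 1 * (1 * ((-1/3) * convection_cell_test v (fst y) (fst z) + (1/3) * convection_cell_trial v (fst y) (fst z))
      + (-1/3) * convection_face_test v (fst y) (snd z)) + (1/3) * convection_face_trial v (snd y) (fst z))"
    by (intro bilinear_on_combine lifted)
  then show ?thesis by (simp add: convection_split[abs_def])
qed

lemma convection_linear:
  assumes "y \<in> V k \<times> W l" "z \<in> V k \<times> W l"
  shows "linear_on (V k) (\<lambda>v. convection_form v y z)"
proof -
  have "fst y \<in> V k" "fst z \<in> V k" "snd y \<in> W l" "snd z \<in> W l" using assms by auto
  note c = conv_linear[OF this]
  have "linear_on (V k) (\<lambda>v. 1 *\<^sub>R (1 *\<^sub>R ((-1/3) *\<^sub>R convection_cell_test v (fst y) (fst z) + (1/3) *\<^sub>R convection_cell_trial v (fst y) (fst z))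
      + (-1/3) *\<^sub>R convection_face_test v (fst y) (snd z)) + (1/3) *\<^sub>R convection_face_trial v (snd y) (fst z))"
    by (intro linear_on_combine c)
  then show ?thesis by (simp add: convection_split)
qed

text \<open>
  The volume terms and the face terms cancel separately, whatever the advecting function \<open>v\<close> is.
\<close>
lemma convection_skew: "convection_form v z z = 0"
proof -
  have "convection_cell_test v u u = convection_cell_trial v u u" for u
    by (simp add: convection_cell_test_def convection_cell_trial_def cell_prod_def mult.commute)
  moreover have "convection_face_test v u \<mu> = convection_face_trial v \<mu> u" for u \<mu>
    by (simp add: convection_face_test_def convection_face_trial_def bdry_prod_def mult_ac)
  ultimately show ?thesis by (simp add: convection_split)
qed

text \<open>
  In each of the four terms one factor is the trial or the test function in the cells.
\<close>
lemma convection_trace_zero: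
  assumes v: "v \<in> V k" and \<zeta>: "\<zeta> \<in> W l" and \<mu>: "\<mu> \<in> W l"
  shows "convection_form v (0, \<zeta>) (0, \<mu>) = 0"
proof -
  have 0: "0 \<in> V k" by (rule subspace_0[OF subspace_scalar])
  note c = conv_bilinear[OF v]
  have "convection_cell_test v 0 0 = 0" "convection_cell_trial v 0 0 = 0" "convection_face_test v 0 \<mu> = 0" "convection_face_trial v \<zeta> 0 = 0"
    using linear_on_zero[OF bilinear_onD(2)[OF c(1) 0] 0] linear_on_zero[OF bilinear_onD(2)[OF c(2) 0] 0]
      linear_on_zero[OF bilinear_onD(2)[OF c(3) \<mu>] 0] linear_on_zero[OF bilinear_onD(1)[OF c(4) \<zeta>] 0]
    by simp_all
  then show ?thesis by (simp add: convection_split)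
qed

end

section \<open>Data of the problem\<close>

text \<open>
  On a set of finite measure \<open>\<bar>g\<bar> \<le> 1 + g\<^sup>2\<close> gives integrability.
\<close>
lemma L2_on_set_integrable:
  fixes g :: "real^'d \<Rightarrow> real"
  assumes g: "L2_on lebesgue \<Omega> g" and K: "patch lebesgue K" "K \<subseteq> \<Omega>"
  shows "set_integrable lebesgue K g"
proof -
  have meas: "set_borel_measurable lebesgue K g"
    using g patchD(4)[OF K(1)] K(2) by (auto simp: L2_on_def intro: set_borel_measurable_subset)
  have "set_integrable lebesgue K (\<lambda>x. (g x)\<^sup>2)"
    using g patchD(4)[OF K(1)] K(2) by (auto simp: L2_on_def intro: set_integrable_subset)
  moreover have "set_integrable lebesgue K (\<lambda>x. 1 :: real)"
    by (intro bounded_borel_set_integrable[OF K(1)] bounded_borel_const patchD(3)[OF K(1)])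
  ultimately have "set_integrable lebesgue K (\<lambda>x. 1 + (g x)\<^sup>2)" by simp
  then show ?thesis
  proof (rule set_integrable_bound[OF _ meas])
    show "AE x in lebesgue. x \<in> K \<longrightarrow> norm (g x) \<le> norm (1 + (g x)\<^sup>2)"
    proof (intro AE_I2 impI)
      fix x
      have "0 \<le> (\<bar>g x\<bar> - 1)\<^sup>2" by simp
      then have "2 * \<bar>g x\<bar> \<le> 1 + (g x)\<^sup>2" by (simp add: power2_diff)
      then show "norm (g x) \<le> norm (1 + (g x)\<^sup>2)" by simp
    qed
  qed
qed

lemma L2_diff_square_integrable:
  fixes g h :: "real^'d \<Rightarrow> real"
  assumes "L2_on lebesgue \<Omega> g" "L2_on lebesgue \<Omega> h"
  shows "set_integrable lebesgue \<Omega> (\<lambda>x. (g x - h x)\<^sup>2)"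
proof -
  have meas: "set_borel_measurable lebesgue \<Omega> (\<lambda>x. (g x - h x)\<^sup>2)"
  proof -
    have "(\<lambda>x. (indicator \<Omega> x *\<^sub>R g x - indicator \<Omega> x *\<^sub>R h x)\<^sup>2) \<in> borel_measurable lebesgue"
      using assms unfolding L2_on_def set_borel_measurable_def
      by (intro borel_measurable_power borel_measurable_diff) auto
    also have "(\<lambda>x. (indicator \<Omega> x *\<^sub>R g x - indicator \<Omega> x *\<^sub>R h x)\<^sup>2)
        = (\<lambda>x. indicator \<Omega> x *\<^sub>R (g x - h x)\<^sup>2)"
      by (auto simp: indicator_def)
    finally show ?thesis by (simp add: set_borel_measurable_def)
  qed
  have "set_integrable lebesgue \<Omega> (\<lambda>x. 2 * (g x)\<^sup>2 + 2 * (h x)\<^sup>2)"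
    using assms by (auto simp: L2_on_def)
  then show ?thesis
  proof (rule set_integrable_bound[OF _ meas])
    show "AE x in lebesgue. x \<in> \<Omega> \<longrightarrow> norm ((g x - h x)\<^sup>2) \<le> norm (2 * (g x)\<^sup>2 + 2 * (h x)\<^sup>2)"
    proof (intro AE_I2 impI)
      fix x
      have "0 \<le> (g x + h x)\<^sup>2" by simp
      then have "(g x - h x)\<^sup>2 \<le> 2 * (g x)\<^sup>2 + 2 * (h x)\<^sup>2" by (simp add: power2_diff power2_sum)
      then show "norm ((g x - h x)\<^sup>2) \<le> norm (2 * (g x)\<^sup>2 + 2 * (h x)\<^sup>2)" by simp
    qed
  qed
qed

text \<open>
  A form of the Cauchy-Schwarz inequality for the difference \<open>g - h\<close>, whose norm is at most \<open>r\<close>,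
  paired with a function bounded by \<open>C\<close>.
\<close>
lemma L2_pairing_bound:
  fixes g h w :: "real^'d \<Rightarrow> real"
  assumes g: "L2_on lebesgue \<Omega> g" and h: "L2_on lebesgue \<Omega> h"
    and K: "patch lebesgue K" "K \<subseteq> \<Omega>"
    and w: "bounded_borel K w" "\<And>x. x \<in> K \<Longrightarrow> \<bar>w x\<bar> \<le> C" and r: "0 < r"
    and close: "L2_dist lebesgue \<Omega> g h \<le> r"
  shows "\<bar>(LINT x:K|lebesgue. g x * w x) - (LINT x:K|lebesgue. h x * w x)\<bar>
    \<le> r * (C\<^sup>2 * measure lebesgue K + 1)"
proof -
  have ints: "set_integrable lebesgue K (\<lambda>x. g x * w x)" "set_integrable lebesgue K (\<lambda>x. h x * w x)"
    using set_integrable_mult_bounded_borel[OF K(1) L2_on_set_integrable[OF g K] w(1)]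
      set_integrable_mult_bounded_borel[OF K(1) L2_on_set_integrable[OF h K] w(1)] .
  have d2: "set_integrable lebesgue \<Omega> (\<lambda>x. (g x - h x)\<^sup>2)" by (rule L2_diff_square_integrable[OF g h])
  have d2K: "set_integrable lebesgue K (\<lambda>x. (g x - h x)\<^sup>2)"
    by (rule set_integrable_subset[OF d2 patchD(4)[OF K(1)] K(2)])
  have c: "set_integrable lebesgue K (\<lambda>x. c :: real)" for c
    by (intro bounded_borel_set_integrable[OF K(1)] bounded_borel_const patchD(3)[OF K(1)])
  have "(LINT x:K|lebesgue. (g x - h x)\<^sup>2) \<le> (LINT x:\<Omega>|lebesgue. (g x - h x)\<^sup>2)"
    unfolding set_lebesgue_integral_def
    using d2 d2K K(2) by (intro integral_mono) (auto simp: set_integrable_def indicator_def)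
  also have "\<dots> = (L2_dist lebesgue \<Omega> g h)\<^sup>2"
  proof -
    have "0 \<le> (LINT x:\<Omega>|lebesgue. (g x - h x)\<^sup>2)"
      unfolding set_lebesgue_integral_def by (intro integral_nonneg_AE) simp
    then show ?thesis by (simp add: L2_dist_def)
  qed
  also have "\<dots> \<le> r\<^sup>2"
    using close by (intro power_mono) (auto simp: L2_dist_def set_lebesgue_integral_def intro!: integral_nonneg_AE)
  finally have dr: "(LINT x:K|lebesgue. (g x - h x)\<^sup>2) \<le> r\<^sup>2" .
  define D where "D x = indicator K x *\<^sub>R (g x * w x - h x * w x)" for x
  define U where "U x = indicator K x *\<^sub>R (r * C\<^sup>2 + 1 / r * (g x - h x)\<^sup>2)" for x
  have D: "integrable lebesgue D"
    using set_integral_diff(1)[OF ints] by (simp add: set_integrable_def D_def[abs_def])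
  have Uset: "set_integrable lebesgue K (\<lambda>x. r * C\<^sup>2 + 1 / r * (g x - h x)\<^sup>2)"
    by (intro set_integral_add(1) set_integrable_mult_right c) (use d2K in blast)
  have U: "integrable lebesgue U"
    using Uset by (simp add: set_integrable_def U_def[abs_def])
  \<comment> \<open>Young's inequality with weight \<open>r\<close>.\<close>
  have DU: "norm (D x) \<le> U x" for x
  proof (cases "x \<in> K")
    case True
    let ?d = "\<bar>g x - h x\<bar>"
    have "0 \<le> (r * C - ?d)\<^sup>2" by simp
    then have "2 * (r * (C * ?d)) \<le> r * (r * C\<^sup>2) + ?d\<^sup>2"
      by (simp add: power2_diff power_mult_distrib power2_eq_square[of r] mult_ac)
    moreover have "\<bar>w x\<bar> * ?d \<le> C * ?d" using w(2)[OF True] by (rule mult_right_mono) simp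
    then have "2 * (r * (\<bar>w x\<bar> * ?d)) \<le> 2 * (r * (C * ?d))" using r by simp
    moreover have "0 \<le> r * (\<bar>w x\<bar> * ?d)" using r by simp
    ultimately have "r * (\<bar>w x\<bar> * ?d) \<le> r * (r * C\<^sup>2) + ?d\<^sup>2" by linarith
    also have "\<dots> = r * (r * C\<^sup>2 + 1 / r * ?d\<^sup>2)" using r by (simp add: distrib_left)
    finally have "\<bar>w x\<bar> * ?d \<le> r * C\<^sup>2 + 1 / r * ?d\<^sup>2" using r by simp
    moreover have "norm (D x) = \<bar>w x\<bar> * ?d"
      using True by (simp add: D_def abs_mult mult.commute flip: left_diff_distrib)
    ultimately show ?thesis using True by (simp add: U_def)
  qed (simp add: D_def U_def)
  have "\<bar>(LINT x:K|lebesgue. g x * w x) - (LINT x:K|lebesgue. h x * w x)\<bar> = norm (integral\<^sup>L lebesgue D)"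
    using set_integral_diff(2)[OF ints] by (simp add: set_lebesgue_integral_def D_def[abs_def])
  also have "\<dots> \<le> (\<integral>x. norm (D x) \<partial>lebesgue)" by (rule integral_norm_bound)
  also have "\<dots> \<le> integral\<^sup>L lebesgue U"
    by (rule integral_mono[OF integrable_norm[OF D] U DU])
  also have "\<dots> = (LINT x:K|lebesgue. r * C\<^sup>2 + 1 / r * (g x - h x)\<^sup>2)"
    by (simp add: set_lebesgue_integral_def U_def[abs_def])
  also have "\<dots> = r * C\<^sup>2 * measure lebesgue K + (1/r) * (LINT x:K|lebesgue. (g x - h x)\<^sup>2)"
    using c d2K patchD(4,6)[OF K(1)]
    by (subst set_integral_add(2)) (auto simp: set_lebesgue_integral_def intro: set_integrable_mult_right)
  also have "\<dots> \<le> r * C\<^sup>2 * measure lebesgue K + (1/r) * r\<^sup>2"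
    using dr r by (intro add_left_mono mult_left_mono) auto
  also have "\<dots> = r * (C\<^sup>2 * measure lebesgue K + 1)"
    using r by (simp add: power2_eq_square algebra_simps)
  finally show ?thesis .
qed

context mesh
begin

lemma source_linear:
  assumes "L2_on lebesgue \<Omega> g"
  shows "linear_on (V k) (\<lambda>w. cell_prod \<T> g w)"
  unfolding cell_prod_def inner_real_def
proof (intro linear_on_sum_fun)
  fix K assume K: "K \<in> \<T>"
  show "linear_on (V k) (\<lambda>w. LINT x:K|lebesgue. g x * w x)"
    by (rule linear_on_integral_set_integrable[OF cell_patch[OF K]
          L2_on_set_integrable[OF assms cell_patch[OF K] cell_subset[OF K]]
          linear_fieldsD(1)[OF scalar_fields(1)[OF K]]])
qed

lemma source_continuous:
  assumes f: "\<And>t. t \<in> {0..T} \<Longrightarrow> L2_on lebesgue \<Omega> (f t)"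
    and lim: "\<And>t. t \<in> {0..T} \<Longrightarrow> ((\<lambda>s. L2_dist lebesgue \<Omega> (f s) (f t)) \<longlongrightarrow> 0) (at t within {0..T})"
    and w: "w \<in> V k"
  shows "continuous_on {0..T} (\<lambda>t. cell_prod \<T> (f t) w)"
  unfolding cell_prod_def inner_real_def
proof (intro continuous_on_sum)
  fix K assume K: "K \<in> \<T>"
  have bw: "bounded_borel K w" by (rule linear_fieldsD(1)[OF scalar_fields(1)[OF K] w])
  then obtain C where C: "\<And>x. x \<in> K \<Longrightarrow> \<bar>w x\<bar> \<le> C" by (auto simp: bounded_borel_def)
  define N where "N = C\<^sup>2 * measure lebesgue K + 1"
  have N: "0 < N" by (simp add: N_def add_nonneg_pos)
  show "continuous_on {0..T} (\<lambda>t. LINT x:K|lebesgue. f t x * w x)"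
    unfolding continuous_on_def
  proof
    fix t assume t: "t \<in> {0..T}"
    show "((\<lambda>s. LINT x:K|lebesgue. f s x * w x) \<longlongrightarrow> (LINT x:K|lebesgue. f t x * w x)) (at t within {0..T})"
    proof (rule tendstoI)
      fix e :: real assume e: "0 < e"
      define r where "r = e / (2 * N)"
      have r: "0 < r" "r * N < e" using e N by (auto simp: r_def field_simps)
      have "\<forall>\<^sub>F s in at t within {0..T}. dist (L2_dist lebesgue \<Omega> (f s) (f t)) 0 < r"
        using lim[OF t] r(1) by (rule tendstoD)
      moreover have "\<forall>\<^sub>F s in at t within {0..T}. s \<in> {0..T}"
        by (simp add: eventually_at_filter)
      ultimately show "\<forall>\<^sub>F s in at t within {0..T}.
          dist (LINT x:K|lebesgue. f s x * w x) (LINT x:K|lebesgue. f t x * w x) < e"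
      proof eventually_elim
        case (elim s)
        then have "L2_dist lebesgue \<Omega> (f s) (f t) \<le> r" by (simp add: dist_real_def)
        from L2_pairing_bound[OF f[OF elim(2)] f[OF t] cell_patch[OF K] cell_subset[OF K] bw C r(1) this]
        show ?case using r(2) by (simp add: N_def dist_real_def)
      qed
    qed
  qed
qed

lemma cell_proj_in_scalar:
  assumes "L2_on lebesgue \<Omega> u0"
  shows "cell_proj \<T> k u0 \<in> V k"
proof -
  have proj: "L2_proj lebesgue k K u0 \<in> polys_on k K" if "K \<in> \<T>" for K
    by (rule L2_proj_characterization(1)[OF cell_patch[OF that]
          L2_on_set_integrable[OF assms cell_patch[OF that] cell_subset[OF that]]])
  have off: "L2_proj lebesgue k K u0 x = 0" if "K \<in> \<T>" "x \<notin> K" for K x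
    using proj[OF that(1)] that(2) by (auto simp: polys_on_def restrict0_def)
  have "restrict0 K (cell_proj \<T> k u0) = L2_proj lebesgue k K u0" if K: "K \<in> \<T>" for K
  proof
    fix x
    show "restrict0 K (cell_proj \<T> k u0) x = L2_proj lebesgue k K u0 x"
    proof (cases "x \<in> K")
      case True
      have "cell_proj \<T> k u0 x = (\<Sum>K'\<in>{K}. L2_proj lebesgue k K' u0 x)"
        unfolding cell_proj_def
      proof (rule sum.mono_neutral_right)
        show "\<forall>K'\<in>\<T> - {K}. L2_proj lebesgue k K' u0 x = 0"
        proof
          fix K' assume K': "K' \<in> \<T> - {K}"
          then have "x \<notin> K'" using disjoint_cells K True by (auto simp: pairwise_def disjnt_def)
          then show "L2_proj lebesgue k K' u0 x = 0" using off K' by blast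
        qed
      qed (use finite_cells K in auto)
      then show ?thesis using True by (simp add: restrict0_def)
    next
      case False
      then show ?thesis using off[OF K] by (simp add: restrict0_def)
    qed
  qed
  moreover have "cell_proj \<T> k u0 x = 0" if "x \<notin> \<Union>\<T>" for x
    unfolding cell_proj_def using off that by (intro sum.neutral) blast
  ultimately show ?thesis
    using proj by (simp add: scalar_space_eq piecewise_polys_def)
qed

end

section \<open>The semi-discrete scheme\<close>

context mesh
begin

lemma hdg_evolution_problem:
  assumes "0 < \<nu>" "0 < T"
    and "\<And>t. t \<in> {0..T} \<Longrightarrow> L2_on lebesgue \<Omega> (f t)"
    and "\<And>t. t \<in> {0..T} \<Longrightarrow> ((\<lambda>s. L2_dist lebesgue \<Omega> (f s) (f t)) \<longlongrightarrow> 0) (at t within {0..T})"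
  shows "evolution_problem (V k) (W l) (cell_prod \<T>) (diffusion_form k l \<nu>) convection_form
    (\<lambda>t. cell_prod \<T> (f t)) T"
proof
  show "0 < T" by fact
  show "findim (V k)" "findim (W l)" by (rule findim_scalar findim_trace)+
  show "inner_product_on (V k) (cell_prod \<T>)" by (rule inner_product_scalar)
  show "bilinear_on (V k \<times> W l) (V k \<times> W l) (diffusion_form k l \<nu>)" by (rule diffusion_bilinear)
  show "diffusion_form k l \<nu> y z = diffusion_form k l \<nu> z y" for y z by (rule diffusion_sym)
  show "0 \<le> diffusion_form k l \<nu> z z" for z by (rule diffusion_nonneg[OF assms(1)])
  show "0 < diffusion_form k l \<nu> (0, \<mu>) (0, \<mu>)" if "\<mu> \<in> W l" "\<mu> \<noteq> 0" for \<mu>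
    by (rule diffusion_pos[OF assms(1) that])
  show "bilinear_on (V k \<times> W l) (V k \<times> W l) (convection_form v)" if "v \<in> V k" for v
    by (rule convection_bilinear[OF that])
  show "linear_on (V k) (\<lambda>v. convection_form v y z)" if "y \<in> V k \<times> W l" "z \<in> V k \<times> W l" for y z
    by (rule convection_linear[OF that])
  show "convection_form v z z = 0" for v z by (rule convection_skew)
  show "convection_form v (0, \<zeta>) (0, \<mu>) = 0" if "v \<in> V k" "\<zeta> \<in> W l" "\<mu> \<in> W l" for v \<zeta> \<mu>
    by (rule convection_trace_zero[OF that])
  show "linear_on (V k) (cell_prod \<T> (f t))" if "t \<in> {0..T}" for t
    by (rule source_linear[OF assms(3)[OF that]])
  show "continuous_on {0..T} (\<lambda>t. cell_prod \<T> (f t) w)" if "w \<in> V k" for w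
    by (rule source_continuous[OF assms(3,4) that])
qed

text \<open>
  In the nodal basis the inner product with \<open>w\<close> is a fixed linear combination of point values, and so
  is the function formed by the pointwise derivatives.
\<close>
lemma pointwise_derivative_pairing:
  assumes T: "0 < T" and t: "t \<in> {0..T}" and u: "\<And>s. s \<in> {0..T} \<Longrightarrow> u s \<in> V k"
    and diff: "\<And>x. (\<lambda>s. u s x) differentiable (at t within {0..T})" and w: "w \<in> V k"
  shows "((\<lambda>s. cell_prod \<T> (u s) w) has_real_derivative
    cell_prod \<T> (\<lambda>x. vector_derivative (\<lambda>s. u s x) (at t within {0..T})) w) (at t within {0..T})"
proof -
  define D where "D x = vector_derivative (\<lambda>s. u s x) (at t within {0..T})" for x
  have D: "((\<lambda>s. u s x) has_real_derivative D x) (at t within {0..T})" for x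
    using diff[of x] vector_derivative_works[of "\<lambda>s. u s x" "at t within {0..T}"]
    by (simp add: D_def has_real_derivative_iff_has_vector_derivative)
  obtain P g where P: "finite P" and g: "\<And>p. p \<in> P \<Longrightarrow> g p \<in> V k"
    and nodal: "\<And>v. v \<in> V k \<Longrightarrow> v = (\<Sum>p\<in>P. v p *\<^sub>R g p)"
    by (rule nodal_basis[OF findim_scalar]) (rule that)
  note lin = bilinear_onD(2)[OF inner_product_scalar[of k, unfolded inner_product_on_def, THEN conjunct1] w]
  have pair: "cell_prod \<T> (\<Sum>p\<in>P. c p *\<^sub>R g p) w = (\<Sum>p\<in>P. c p * cell_prod \<T> (g p) w)" for c
    using linear_on_sum[OF lin subspace_scalar, of P g] g by simp
  have "D = (\<Sum>p\<in>P. D p *\<^sub>R g p)"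
  proof
    fix x
    have "((\<lambda>s. \<Sum>p\<in>P. u s p * g p x) has_real_derivative (\<Sum>p\<in>P. D p * g p x)) (at t within {0..T})"
      by (intro DERIV_sum DERIV_cmult_right D)
    then have "((\<lambda>s. u s x) has_real_derivative (\<Sum>p\<in>P. D p * g p x)) (at t within {0..T})"
    proof (rule has_field_derivative_transform_within[OF _ zero_less_one t])
      fix s assume "s \<in> {0..T}"
      then have "u s x = (\<Sum>p\<in>P. u s p *\<^sub>R g p) x" using nodal[OF u] by metis
      then show "(\<Sum>p\<in>P. u s p * g p x) = u s x" by (simp add: sum_fun_apply)
    qed
    then show "D x = (\<Sum>p\<in>P. D p *\<^sub>R g p) x"
      using has_real_derivative_unique_Icc[OF T t D] by (simp add: sum_fun_apply)
  qed
  then have DP: "cell_prod \<T> D w = (\<Sum>p\<in>P. D p * cell_prod \<T> (g p) w)"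
    using pair[of D] by simp
  have "((\<lambda>s. \<Sum>p\<in>P. u s p * cell_prod \<T> (g p) w) has_real_derivative cell_prod \<T> D w) (at t within {0..T})"
    unfolding DP by (intro DERIV_sum DERIV_cmult_right D)
  then have "((\<lambda>s. cell_prod \<T> (u s) w) has_real_derivative cell_prod \<T> D w) (at t within {0..T})"
  proof (rule has_field_derivative_transform_within[OF _ zero_less_one t])
    fix s assume "s \<in> {0..T}"
    then have "u s = (\<Sum>p\<in>P. u s p *\<^sub>R g p)" using nodal[OF u] by blast
    then show "(\<Sum>p\<in>P. u s p * cell_prod \<T> (g p) w) = cell_prod \<T> (u s) w"
      using pair[of "u s"] by simp
  qed
  then show ?thesis by (simp add: D_def[abs_def])
qed

text \<open>
  The value at a point is a linear combination of inner products with an orthonormal basis.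
\<close>
lemma pointwise_differentiable:
  assumes t: "t \<in> {0..T}" and u: "\<And>s. s \<in> {0..T} \<Longrightarrow> u s \<in> V k"
    and diff: "\<And>w. w \<in> V k \<Longrightarrow> (\<lambda>s. cell_prod \<T> (u s) w) differentiable (at t within {0..T})"
  shows "(\<lambda>s. u s x) differentiable (at t within {0..T})"
proof -
  obtain n :: nat and e where e: "\<And>i. i < n \<Longrightarrow> e i \<in> V k"
    and expand: "\<And>v. v \<in> V k \<Longrightarrow> v = (\<Sum>i<n. cell_prod \<T> v (e i) *\<^sub>R e i)"
    by (rule orthonormal_basis[OF findim_scalar inner_product_scalar]) (rule that)
  have "(\<lambda>s. \<Sum>i<n. cell_prod \<T> (u s) (e i) * e i x) differentiable (at t within {0..T})"
    using diff[OF e] by (intro differentiable_sum differentiable_mult) auto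
  moreover have "(\<Sum>i<n. cell_prod \<T> (u s) (e i) * e i x) = u s x" if "s \<in> {0..T}" for s
  proof -
    have "u s x = (\<Sum>i<n. cell_prod \<T> (u s) (e i) *\<^sub>R e i) x" using expand[OF u[OF that]] by metis
    then show ?thesis by (simp add: sum_fun_apply)
  qed
  ultimately show ?thesis
    by (rule differentiable_transform_within[OF _ zero_less_one t])
qed

end

theorem theorem3p2:
  fixes \<Omega> :: "(real^'d) set" and \<T> \<E> :: "(real^'d) set set"
    and \<theta> \<rho> \<nu> T :: real and k l :: nat
    and u0 :: "real^'d \<Rightarrow> real" and f :: "real \<Rightarrow> real^'d \<Rightarrow> real"
  assumes "CARD('d) = 2 \<or> CARD('d) = 3"
    and "open_polytopal CARD('d) \<Omega>"
    and "polytopal_mesh \<Omega> \<T> \<E>"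
    and "shape_regular \<theta> \<rho> \<T> \<E>"
    and "1 \<le> k" and "l = k - 1 \<or> l = k"
    and "0 < \<nu>" and "0 < T"
    and "L2_on lebesgue \<Omega> u0"
    and "\<And>t. t \<in> {0..T} \<Longrightarrow> L2_on lebesgue \<Omega> (f t)"
    and "\<And>t. t \<in> {0..T} \<Longrightarrow>
           ((\<lambda>s. L2_dist lebesgue \<Omega> (f s) (f t)) \<longlongrightarrow> 0) (at t within {0..T})"
  shows "\<exists>q u uhat. hdg_solution \<Omega> \<T> \<E> k l \<nu> T f u0 q u uhat \<and>
           (\<forall>q' u' uhat'. hdg_solution \<Omega> \<T> \<E> k l \<nu> T f u0 q' u' uhat' \<longrightarrow>
              (\<forall>t\<in>{0..T}. q' t = q t \<and> u' t = u t \<and> uhat' t = uhat t))"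
proof -
  interpret mesh \<Omega> \<T> \<E>
    by (rule polytopal_mesh_imp_mesh[OF assms(2,3)])
  interpret ev: evolution_problem "scalar_space \<Omega> \<T> k" "trace_space \<Omega> \<E> l" "cell_prod \<T>"
    "diffusion_form k l \<nu>" convection_form "\<lambda>t. cell_prod \<T> (f t)" T
    by (rule hdg_evolution_problem[OF assms(7,8,10,11)])
  have T0: "0 \<in> {0..T}" using assms(8) by simp
  let ?D = "\<lambda>u t x. vector_derivative (\<lambda>s. u s x) (at t within {0..T})"
  have weak_solution: "ev.solution u uhat \<and> u 0 = cell_proj \<T> k u0 \<and>
      (\<forall>t\<in>{0..T}. q t = - hdg_K \<Omega> \<T> \<E> k (u t) (uhat t))"
    if sol: "hdg_solution \<Omega> \<T> \<E> k l \<nu> T f u0 q u uhat" for q u uhat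
  proof -
    have s: "u t \<in> scalar_space \<Omega> \<T> k" "uhat t \<in> trace_space \<Omega> \<E> l"
      "\<And>x. (\<lambda>s. u s x) differentiable (at t within {0..T})"
      "\<And>x. q t x + hdg_K \<Omega> \<T> \<E> k (u t) (uhat t) x = 0"
      "\<And>w \<mu>. w \<in> scalar_space \<Omega> \<T> k \<Longrightarrow> \<mu> \<in> trace_space \<Omega> \<E> l \<Longrightarrow>
         cell_prod \<T> (?D u t) w + diffusion_form k l \<nu> (u t, uhat t) (w, \<mu>)
         + convection_form (u t) (u t, uhat t) (w, \<mu>) = cell_prod \<T> (f t) w"
      if "t \<in> {0..T}" for t
      using sol that by (simp_all add: hdg_solution_def diffusion_form_def convection_form_def add.assoc)
    have "q t = - hdg_K \<Omega> \<T> \<E> k (u t) (uhat t)" if "t \<in> {0..T}" for t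
      using s(4)[OF that] by (auto simp: fun_eq_iff add_eq_0_iff2)
    moreover have "ev.solution u uhat"
      unfolding ev.solution_def
    proof (intro ballI conjI s(1,2))
      fix t w \<mu> assume t: "t \<in> {0..T}" and w: "w \<in> scalar_space \<Omega> \<T> k" and \<mu>: "\<mu> \<in> trace_space \<Omega> \<E> l"
      have "cell_prod \<T> (?D u t) w = cell_prod \<T> (f t) w
          - diffusion_form k l \<nu> (u t, uhat t) (w, \<mu>) - convection_form (u t) (u t, uhat t) (w, \<mu>)"
        using s(5)[OF t w \<mu>] by linarith
      then show "((\<lambda>s. cell_prod \<T> (u s) w) has_real_derivative cell_prod \<T> (f t) w
          - diffusion_form k l \<nu> (u t, uhat t) (w, \<mu>) - convection_form (u t) (u t, uhat t) (w, \<mu>))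
          (at t within {0..T})"
        using pointwise_derivative_pairing[OF assms(8) t s(1) s(3)[OF t] w] by simp
    qed
    ultimately show ?thesis using sol by (simp add: hdg_solution_def)
  qed
  have strong_solution: "hdg_solution \<Omega> \<T> \<E> k l \<nu> T f u0 (\<lambda>t. - hdg_K \<Omega> \<T> \<E> k (u t) (uhat t)) u uhat"
    if sol: "ev.solution u uhat" and init: "u 0 = cell_proj \<T> k u0" for u uhat
  proof -
    have s: "u t \<in> scalar_space \<Omega> \<T> k" "uhat t \<in> trace_space \<Omega> \<E> l"
      "\<And>w \<mu>. w \<in> scalar_space \<Omega> \<T> k \<Longrightarrow> \<mu> \<in> trace_space \<Omega> \<E> l \<Longrightarrow>
        ((\<lambda>s. cell_prod \<T> (u s) w) has_real_derivative cell_prod \<T> (f t) w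
          - diffusion_form k l \<nu> (u t, uhat t) (w, \<mu>) - convection_form (u t) (u t, uhat t) (w, \<mu>))
          (at t within {0..T})"
      if "t \<in> {0..T}" for t
      using sol that by (simp_all add: ev.solution_def)
    have diff: "(\<lambda>s. u s x) differentiable (at t within {0..T})" if t: "t \<in> {0..T}" for t x
    proof (rule pointwise_differentiable[OF t s(1)])
      fix w assume "w \<in> scalar_space \<Omega> \<T> k"
      from s(3)[OF t this ev.zeros(2)]
      show "(\<lambda>s. cell_prod \<T> (u s) w) differentiable (at t within {0..T})"
        using real_differentiable_def by blast
    qed
    have eq: "cell_prod \<T> (?D u t) w + diffusion_form k l \<nu> (u t, uhat t) (w, \<mu>)
         + convection_form (u t) (u t, uhat t) (w, \<mu>) = cell_prod \<T> (f t) w"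
      if t: "t \<in> {0..T}" and w: "w \<in> scalar_space \<Omega> \<T> k" and \<mu>: "\<mu> \<in> trace_space \<Omega> \<E> l" for t w \<mu>
      using has_real_derivative_unique_Icc[OF assms(8) t
          pointwise_derivative_pairing[OF assms(8) t s(1) diff[OF t] w] s(3)[OF t w \<mu>]] by simp
    have "- hdg_K \<Omega> \<T> \<E> k (u t) (uhat t) \<in> flux_space \<Omega> \<T> k" if "t \<in> {0..T}" for t
      using hdg_K_representer(1)[OF s(1)[OF that] s(2)[OF that]] by (simp add: subspace_neg[OF subspace_flux])
    then show ?thesis
      unfolding hdg_solution_def
      using s(1,2) diff eq init by (simp add: diffusion_form_def convection_form_def add.assoc)
  qed
  obtain u uhat where sol: "ev.solution u uhat" "u 0 = cell_proj \<T> k u0"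
    and unique: "\<And>u' uhat'. ev.solution u' uhat' \<Longrightarrow> u' 0 = cell_proj \<T> k u0 \<Longrightarrow>
      \<forall>t\<in>{0..T}. u' t = u t \<and> uhat' t = uhat t"
    using ev.unique_solution[OF cell_proj_in_scalar[OF assms(9)]] by blast
  show ?thesis
  proof (intro exI conjI allI impI)
    show "hdg_solution \<Omega> \<T> \<E> k l \<nu> T f u0 (\<lambda>t. - hdg_K \<Omega> \<T> \<E> k (u t) (uhat t)) u uhat"
      by (rule strong_solution[OF sol])
    fix q' u' uhat' assume "hdg_solution \<Omega> \<T> \<E> k l \<nu> T f u0 q' u' uhat'"
    from weak_solution[OF this]
    have weak: "ev.solution u' uhat'" "u' 0 = cell_proj \<T> k u0"
      "\<forall>t\<in>{0..T}. q' t = - hdg_K \<Omega> \<T> \<E> k (u' t) (uhat' t)" by simp_all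
    show "\<forall>t\<in>{0..T}. q' t = - hdg_K \<Omega> \<T> \<E> k (u t) (uhat t) \<and> u' t = u t \<and> uhat' t = uhat t"
      using unique[OF weak(1,2)] weak(3) by simp
  qed
qed

end
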